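(* Let $d\geq 2$ and let $E$ be the attractor of an affine iterated function system $\Phi=\{\phi_i(x)=T_ix+a_i\}_{i=1}^{\ell}$ on $\mathbb{R}^d$. Suppose that $E$ is not contained in a hyperplane of $\mathbb{R}^d$. Then $E$ is arithmetically thick if at least one of the following conditions holds: (i) $T_iT_j=T_jT_i$ for all $1\leq i,j\leq\ell$; (ii) $(T_1,\ldots,T_\ell)$ is irreducible, and the multiplicative semigroup generated by $T_1,\ldots,T_\ell$ contains an element which has a simple dominant eigenvalue; (iii) $d=2$.
   Context: An affine iterated function system (IFS) on $\mathbb{R}^d$ is a finite family of maps $\phi_i(x)=T_ix+a_i$, $1\le i\le\ell$, where each $T_i$ is an invertible real $d\times d$ matrix with operator norm $\|T_i\|<1$ and $a_i\in\mathbb{R}^d$; its attractor is the unique non-empty compact set $E$ with $E=\bigcup_{i=1}^\ell\phi_i(E)$. A tuple $(M_1,\ldots,M_k)$ of real $d\times d$ matrices is irreducible if there is no non-zero proper linear subspace $V$ of $\mathbb{R}^d$ with $M_iV\subset V$ for all $i$. A real $d\times d$ matrix $M$ has a simple dominant eigenvalue if it has an eigenvalue $\lambda$ of algebraic multiplicity $1$ such that $|\lambda|$ is greater than the magnitude of any other eigenvalue of $M$. A compact set $E\subset\mathbb{R}^d$ is arithmetically thick if there is a positive integer $n$ such that $\oplus_nE=\{x_1+\cdots+x_n: x_i\in E,\ 1\le i\le n\}$ has non-empty interior. *)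

theory Defs
  imports "HOL-Analysis.Analysis" "HOL-Computational_Algebra.Polynomial"
begin

text \<open>
  Tuples \<open>M\<^sub>1, \<dots>, M\<^sub>l\<close> are functions on \<open>nat\<close> of which only the values at \<open>{1..l}\<close>
  matter.  The dimension \<open>d\<close> is \<open>CARD('n)\<close>, and norms are Euclidean.
\<close>

definition affine_map :: "real^'n^'n \<Rightarrow> real^'n \<Rightarrow> real^'n \<Rightarrow> real^'n" where
  "affine_map T a x = T *v x + a"

definition affine_ifs :: "nat \<Rightarrow> (nat \<Rightarrow> real^'n^'n) \<Rightarrow> (nat \<Rightarrow> real^'n) \<Rightarrow> (nat \<Rightarrow> real^'n \<Rightarrow> real^'n) \<Rightarrow> bool"
  where "affine_ifs l T a \<phi> \<longleftrightarrow>
    (\<forall>i\<in>{1..l}. invertible (T i) \<and> onorm ((*v) (T i)) < 1 \<and> \<phi> i = affine_map (T i) (a i))"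

text \<open>
  For contractions there is at most one such \<open>E\<close> (Hutchinson), so this predicate determines
  the attractor.  Non-emptiness of \<open>E\<close> forces \<open>l \<ge> 1\<close>.
\<close>

definition is_attractor :: "nat \<Rightarrow> (nat \<Rightarrow> real^'n \<Rightarrow> real^'n) \<Rightarrow> (real^'n) set \<Rightarrow> bool" where
  "is_attractor l \<phi> E \<longleftrightarrow> E \<noteq> {} \<and> compact E \<and> E = (\<Union>i\<in>{1..l}. \<phi> i ` E)"

text \<open>Hyperplanes are affine: they need not pass through the origin.\<close>

definition hyperplane :: "(real^'n) set \<Rightarrow> bool" where
  "hyperplane H \<longleftrightarrow> (\<exists>v c. v \<noteq> 0 \<and> H = {x. v \<bullet> x = c})"

definition irreducible_tuple :: "nat \<Rightarrow> (nat \<Rightarrow> real^'n^'n) \<Rightarrow> bool" where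
  "irreducible_tuple l M \<longleftrightarrow>
    \<not> (\<exists>V. subspace V \<and> V \<noteq> {0} \<and> V \<noteq> UNIV \<and> (\<forall>i\<in>{1..l}. (*v) (M i) ` V \<subseteq> V))"

inductive_set mult_semigroup :: "(real^'n^'n) set \<Rightarrow> (real^'n^'n) set"
  for S :: "(real^'n^'n) set" where
  generator: "A \<in> S \<Longrightarrow> A \<in> mult_semigroup S"
| product: "A \<in> mult_semigroup S \<Longrightarrow> B \<in> mult_semigroup S \<Longrightarrow> A ** B \<in> mult_semigroup S"

definition complex_matrix :: "real^'n^'n \<Rightarrow> complex^'n^'n" where
  "complex_matrix M = (\<chi> i j. complex_of_real (M $ i $ j))"

definition eigenvalue :: "complex^'n^'n \<Rightarrow> complex \<Rightarrow> bool" where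
  "eigenvalue M z \<longleftrightarrow> (\<exists>v. v \<noteq> 0 \<and> M *v v = z *s v)"

definition charpoly :: "complex^'n^'n \<Rightarrow> complex poly" where
  "charpoly M = det (mat [:0, 1:] - (\<chi> i j. [:M $ i $ j:]))"

text \<open>
  Eigenvalues of a real matrix are taken in \<open>\<complex>\<close>.  A dominant one is necessarily real, since its
  conjugate is an eigenvalue of the same modulus.  The algebraic multiplicity is the order of
  the root of the characteristic polynomial.
\<close>

definition has_simple_dominant_eigenvalue :: "real^'n^'n \<Rightarrow> bool" where
  "has_simple_dominant_eigenvalue M \<longleftrightarrow>
    (\<exists>z. eigenvalue (complex_matrix M) z \<and> order z (charpoly (complex_matrix M)) = 1 \<and>
      (\<forall>w. eigenvalue (complex_matrix M) w \<and> w \<noteq> z \<longrightarrow> cmod w < cmod z))"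

definition sum_power :: "nat \<Rightarrow> (real^'n) set \<Rightarrow> (real^'n) set" where
  "sum_power n E = {(\<Sum>i=1..n. x i) | x. \<forall>i\<in>{1..n}. x i \<in> E}"

definition arithmetically_thick :: "(real^'n) set \<Rightarrow> bool" where
  "arithmetically_thick E \<longleftrightarrow> compact E \<and> (\<exists>n\<ge>1. interior (sum_power n E) \<noteq> {})"

end

theory Submission
  imports Defs "HOL-Computational_Algebra.Fundamental_Theorem_Algebra"
begin

text \<open>
  A sum of many copies of \<open>E\<close> is steered towards a prescribed target: each copy is refined from a
  cylinder to a smaller one, and at every scale enough copies are available to bring the error
  down to that scale.  This succeeds if, at every scale, a bounded number of cylinders can be moved
  jointly, by a vector of that scale, in any direction.  Since \<open>E\<close> spans, the moves inside
  \<open>E\<close> itself point everywhere; what has to be controlled is their image under the linear part of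
  the current cylinder.

  If the linear parts commute, finitely many words can be completed to words with one common linear
  part, and the moves are the same at all scales up to that linear map.  If some word has a simple
  dominant eigenvalue, long cylinders are essentially one-dimensional; a subsystem preserving a
  narrow cone around the dominant direction keeps that direction fixed, and irreducibility
  supplies finitely many prefixes that rotate it to a basis.  In the plane, an irreducible system
  without such a word has linear parts of bounded distortion.  A reducible planar system is
  triangular; there one is left with the case in which the invariant line dominates, where two
  words with equal diagonals but different shears produce moves exactly along that line.
\<close>

section \<open>Sums of steered copies\<close>

text \<open>The demand on moves is one-sided and uniform: for every error \<open>e\<close> some move
  \<open>m\<close> satisfies \<open>norm m \<le> h\<close> and
  \<open>m \<bullet> e \<ge> c * norm e\<close>. Nothing is asked of how the moves in different
  directions fit together, so a few discrete choices per level suffice. The price is that a refined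
  configuration must be admissible again, with the same \<open>c\<close> and \<open>h\<close>. This
  shapes every case, because the length of a word says little about the size of its linear part:
  words are padded until the size falls into a fixed window (\<open>calibrate\<close>), or completed
  to a prescribed matrix, or controlled by a recursion of ratio at most 1/4. Positions are images of
  a base point \<open>b\<close> that need not lie in \<open>E\<close>: an interior point of the
  convex hull, or a midpoint of two points, which makes moves of both signs available. Points of
  \<open>E\<close> return only in the limit, through compactness of the sums. Where one copy cannot
  move in all directions, the steering theorem is applied to \<open>sum_power r E\<close>, whose
  elements are bundles of \<open>r\<close> copies.\<close>

lemma sum_power_Suc:
  "sum_power (Suc n) E = {x + y | x y. x \<in> sum_power n E \<and> y \<in> E}"
proof (intro equalityI subsetI)
  fix z assume "z \<in> sum_power (Suc n) E"
  then obtain x where x: "z = (\<Sum>i=1..Suc n. x i)" "\<forall>i\<in>{1..Suc n}. x i \<in> E"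
    by (auto simp: sum_power_def)
  have "(\<Sum>i=1..n. x i) \<in> sum_power n E" using x by (auto simp: sum_power_def)
  then show "z \<in> {x + y | x y. x \<in> sum_power n E \<and> y \<in> E}"
    using x by (intro CollectI exI[of _ "\<Sum>i=1..n. x i"] exI[of _ "x (Suc n)"]) auto
next
  fix z assume "z \<in> {x + y | x y. x \<in> sum_power n E \<and> y \<in> E}"
  then obtain x y where xy: "z = (\<Sum>i=1..n. x i) + y" "\<forall>i\<in>{1..n}. x i \<in> E" "y \<in> E"
    by (auto simp: sum_power_def)
  then have "z = (\<Sum>i=1..Suc n. (x(Suc n := y)) i)" by auto
  moreover have "\<forall>i\<in>{1..Suc n}. (x(Suc n := y)) i \<in> E" using xy by auto
  ultimately show "z \<in> sum_power (Suc n) E" unfolding sum_power_def by blast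
qed

lemma sum_power_0: "sum_power 0 E = {0}"
  by (auto simp: sum_power_def)

lemma sum_power_1: "sum_power 1 E = E"
  using sum_power_Suc[of 0 E] by (simp add: sum_power_0)

lemma sum_power_sum:
  assumes "finite I" "\<And>i. i \<in> I \<Longrightarrow> x i \<in> E"
  shows "sum x I \<in> sum_power (card I) E"
  using assms
proof (induction I rule: finite_induct)
  case empty
  then show ?case by (simp add: sum_power_0)
next
  case (insert i I)
  then have "sum x I + x i \<in> sum_power (Suc (card I)) E"
    unfolding sum_power_Suc by blast
  then show ?case using insert by (simp add: add.commute)
qed

lemma sum_power_add:
  assumes "x \<in> sum_power m E" "y \<in> sum_power n E"
  shows "x + y \<in> sum_power (m + n) E"
  using assms(2)
proof (induction n arbitrary: y)
  case 0
  then show ?case using assms(1) by (simp add: sum_power_0)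
next
  case (Suc n)
  then obtain u v where "y = u + v" "u \<in> sum_power n E" "v \<in> E"
    unfolding sum_power_Suc by blast
  with Suc.IH[of u] have "(x + u) + v \<in> sum_power (Suc (m + n)) E"
    unfolding sum_power_Suc by blast
  then show ?case using \<open>y = u + v\<close> by (simp add: add.assoc)
qed

lemma sum_power_sum_power:
  assumes "K \<subseteq> sum_power r E"
  shows "sum_power n K \<subseteq> sum_power (n * r) E"
proof (induction n)
  case 0
  then show ?case by (simp add: sum_power_0)
next
  case (Suc n)
  show ?case
  proof
    fix z assume "z \<in> sum_power (Suc n) K"
    then obtain x y where "z = x + y" "x \<in> sum_power n K" "y \<in> K"
      unfolding sum_power_Suc by blast
    then show "z \<in> sum_power (Suc n * r) E"
      using sum_power_add[of x "n * r" E y r] Suc assms by (auto simp: add.commute)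
  qed
qed

lemma compact_sum_power:
  assumes "compact E"
  shows "compact (sum_power n E)"
proof (induction n)
  case 0
  then show ?case by (simp add: sum_power_0)
next
  case (Suc n)
  then show ?case unfolding sum_power_Suc using compact_sums[OF _ assms] by blast
qed

text \<open>Expanding the square, the gain is \<open>2 * c * norm e\<close> and the loss
  \<open>h\<^sup>2\<close>; once \<open>norm e\<close> exceeds \<open>h\<^sup>2 / c\<close>, the
  loss is at most half of the gain. Below that threshold the triangle inequality gives the constant:
  the error is already at the scale of a single move.\<close>

lemma norm_diff_steered:
  fixes e m :: "'a::real_inner"
  assumes "0 < c" "m \<bullet> e \<ge> c * norm e" "norm m \<le> h"
  shows "norm (e - m) \<le> max (h\<^sup>2 / c + h) (norm e - c / 2)"
proof (cases "norm e \<le> h\<^sup>2 / c")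
  case True
  then show ?thesis using norm_triangle_ineq4[of e m] assms by linarith
next
  case False
  then have big: "h\<^sup>2 \<le> c * norm e" using assms(1) by (simp add: field_simps)
  have "norm e > 0"
    by (metis False assms(1) less_eq_real_def norm_ge_zero not_le zero_le_divide_iff zero_le_power2
        order_le_less_trans)
  have "c * norm e \<le> norm m * norm e"
    using assms(2) norm_cauchy_schwarz order_trans by blast
  then have "c \<le> h" using \<open>norm e > 0\<close> assms(3) by simp
  \<comment> \<open>The aim is \<open>c \<le> norm e\<close>, which makes
    \<open>norm e - c / 2\<close> nonnegative before square roots are compared.\<close>
  then have "c * c \<le> h\<^sup>2" using assms(1) by (simp add: power2_eq_square mult_mono)
  then have "c * c \<le> c * norm e" using big by linarith
  then have ce: "c \<le> norm e" using assms(1) by simp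
  have "norm m ^ 2 \<le> h\<^sup>2" using assms(3) by (intro power_mono) auto
  moreover have "(norm (e - m))\<^sup>2 = (norm e)\<^sup>2 - 2 * (m \<bullet> e) + (norm m)\<^sup>2"
    by (simp add: power2_norm_eq_inner inner_diff_left inner_diff_right inner_commute)
  ultimately have "(norm (e - m))\<^sup>2 \<le> (norm e)\<^sup>2 - c * norm e"
    using assms(2) big by linarith
  also have "\<dots> \<le> (norm e - c / 2)\<^sup>2"
    by (simp add: power2_eq_square algebra_simps)
  finally have "norm (e - m) \<le> norm e - c / 2"
    by (rule power2_le_imp_le) (use ce assms(1) in linarith)
  then show ?thesis by simp
qed

text \<open>
  \<open>P k x\<close> is to be read as: \<open>x\<close> is the base point of an admissible configuration of
  level \<open>k\<close>; its moves have the shape of \<open>G k\<close>.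
\<close>

lemma steered_copies:
  fixes G :: "nat \<Rightarrow> 'a::euclidean_space \<Rightarrow> 'a" and N :: nat
  assumes "linear (G k)" "0 < c"
    and step: "\<And>x e. P k x \<Longrightarrow> \<exists>m. P (Suc k) (x + G k m) \<and>
        norm m \<le> h \<and> m \<bullet> e \<ge> c * norm e"
    and "\<And>i. i < N \<Longrightarrow> P k (x i)"
  shows "\<exists>x' e'. (\<forall>i<N. P (Suc k) (x' i)) \<and>
    (\<Sum>i<N. x i) + G k e = (\<Sum>i<N. x' i) + G k e' \<and>
    norm e' \<le> max (h\<^sup>2 / c + h) (norm e - N * (c / 2))"
  using assms(4)
proof (induction N)
  case 0
  show ?case by (auto intro!: exI[of _ e])
next
  case (Suc N)
  then obtain x' e' where IH: "\<forall>i<N. P (Suc k) (x' i)"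
    "(\<Sum>i<N. x i) + G k e = (\<Sum>i<N. x' i) + G k e'"
    "norm e' \<le> max (h\<^sup>2 / c + h) (norm e - N * (c / 2))"
    using less_SucI by metis
  \<comment> \<open>The copies are refined one after another, each against the error
    \<open>e'\<close> that the earlier ones have left.\<close>
  obtain m where m: "P (Suc k) (x N + G k m)" "norm m \<le> h" "m \<bullet> e' \<ge> c * norm e'"
    using step[OF Suc.prems[of N], of e'] by auto
  define y where "y = x N + G k m"
  have "norm (e' - m) \<le> max (h\<^sup>2 / c + h) (norm e' - c / 2)"
    using norm_diff_steered m assms(2) by blast
  also have "\<dots> \<le> max (h\<^sup>2 / c + h) (norm e - Suc N * (c / 2))"
  proof -
    have "real (Suc N) * (c / 2) = real N * (c / 2) + c / 2" by (simp add: algebra_simps)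
    moreover have "0 < c / 2" using assms(2) by simp
    ultimately show ?thesis using IH(3) by linarith
  qed
  finally have n: "norm (e' - m) \<le> max (h\<^sup>2 / c + h) (norm e - Suc N * (c / 2))" .
  have "(\<Sum>i<Suc N. x i) + G k e = (\<Sum>i<N. x' i) + y + G k (e' - m)"
    using IH(2) by (simp add: y_def linear_diff[OF assms(1)] algebra_simps)
  also have "(\<Sum>i<N. x' i) + y = (\<Sum>i<Suc N. (x'(N := y)) i)" by simp
  finally have "(\<Sum>i<Suc N. x i) + G k e = (\<Sum>i<Suc N. (x'(N := y)) i) + G k (e' - m)" .
  moreover have "\<forall>i<Suc N. P (Suc k) ((x'(N := y)) i)"
    using IH(1) m(1) by (auto simp: less_Suc_eq y_def)
  ultimately show ?case using n by blast
qed

text \<open>\<open>D\<close> converts scales: an error \<open>e\<close> of level \<open>k\<close> is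
  the error \<open>D' e\<close> of level \<open>Suc k\<close>, longer by at most the factor
  \<open>L\<close>. The number \<open>N\<close> of copies is fixed so that refining all of them
  brings any error up to \<open>R\<close> down to \<open>r0\<close>, below which steering gives no
  guarantee of progress, and \<open>R\<close> leaves room for the rescaling. So the error never
  leaves the ball of radius \<open>R\<close>, and each target
  \<open>real N *\<^sub>R x0 + G 0 e\<close> with \<open>norm e \<le> R\<close> is a limit of sums
  of points of \<open>K\<close>.\<close>

theorem interior_sum_power_steered:
  fixes G :: "nat \<Rightarrow> real^'n \<Rightarrow> real^'n"
  assumes G: "\<And>k. linear (G k)" "\<And>k x. G (Suc k) x = G k (D x)" "inj (G 0)"
    and D: "linear D'" "\<And>x. D (D' x) = x"
    and \<eta>: "\<And>k x. norm (G k x) \<le> \<eta> k * norm x" "\<eta> \<longlonglongrightarrow> 0"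
    and "0 < c"
    and step: "\<And>k x e. P k x \<Longrightarrow>
      \<exists>m. P (Suc k) (x + G k m) \<and> norm m \<le> h \<and> m \<bullet> e \<ge> c * norm e"
    and near: "\<And>k x. P k x \<Longrightarrow> \<exists>y\<in>K. norm (y - x) \<le> \<eta> k * h"
    and P0: "P 0 x0" and K: "compact K"
  shows "\<exists>N\<ge>1. interior (sum_power N K) \<noteq> {}"
proof -
  define r0 where "r0 = h\<^sup>2 / c + h"
  obtain L where L: "L > 0" "\<And>x. norm (D' x) \<le> L * norm x"
    using linear_bounded_pos[OF D(1)] by blast
  have h0: "0 \<le> h" using step[OF P0, of 0] norm_ge_zero order_trans by blast
  then have r0: "0 \<le> r0" using \<open>0 < c\<close> by (simp add: r0_def)
  define R where "R = L * r0 + r0 + 1"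
  have R: "R > 0" "r0 \<le> R" "L * r0 \<le> R" using r0 L by (auto simp: R_def add_nonneg_pos)
  define N where "N = nat \<lceil>2 * R / c\<rceil> + 1"
  have N: "R \<le> real N * (c / 2)"
  proof -
    have "2 * R / c \<le> real N" unfolding N_def by linarith
    then show ?thesis using \<open>0 < c\<close> by (simp add: field_simps)
  qed
  have approx: "\<exists>x e'. (\<forall>i<N. P k (x i)) \<and>
      real N *\<^sub>R x0 + G 0 e = (\<Sum>i<N. x i) + G k e' \<and> norm e' \<le> R"
    if "norm e \<le> R" for e k
  proof (induction k)
    case 0
    show ?case using P0 that
      by (intro exI[of _ "\<lambda>_. x0"] exI[of _ e]) (simp add: sum_constant_scaleR del: sum_constant)
  next
    case (Suc k)
    then obtain x e' where k: "\<forall>i<N. P k (x i)"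
      "real N *\<^sub>R x0 + G 0 e = (\<Sum>i<N. x i) + G k e'" "norm e' \<le> R" by blast
    then obtain x' e'' where k': "\<forall>i<N. P (Suc k) (x' i)"
      "(\<Sum>i<N. x i) + G k e' = (\<Sum>i<N. x' i) + G k e''"
      "norm e'' \<le> max (h\<^sup>2 / c + h) (norm e' - N * (c / 2))"
      using steered_copies[of G k c P h N x e'] G(1) \<open>0 < c\<close> step by blast
    have "norm e'' \<le> r0" using k'(3) k(3) N r0 unfolding r0_def by linarith
    then have "norm (D' e'') \<le> R"
      using L R(3) by (meson mult_left_mono less_imp_le order_trans)
    moreover have "real N *\<^sub>R x0 + G 0 e = (\<Sum>i<N. x' i) + G (Suc k) (D' e'')"
      unfolding G(2)[of k "D' e''"] D(2)[of e''] using k(2) k'(2) by (rule trans)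
    ultimately show ?case using k'(1) by blast
  qed
  have sub: "real N *\<^sub>R x0 + G 0 e \<in> sum_power N K" if "norm e \<le> R" for e
  proof -
    let ?y = "real N *\<^sub>R x0 + G 0 e"
    have "\<exists>z\<in>sum_power N K. norm (z - ?y) \<le> \<eta> k * (real N * h + R)" for k
    proof -
      obtain x e' where k: "\<forall>i<N. P k (x i)"
        "?y = (\<Sum>i<N. x i) + G k e'" "norm e' \<le> R"
            using approx[OF \<open>norm e \<le> R\<close>] by blast
      have "\<forall>i<N. \<exists>z. z \<in> K \<and>
          norm (z - x i) \<le> \<eta> k * h" using near k(1) by blast
      then obtain z where z: "\<And>i. i < N \<Longrightarrow>
          z i \<in> K" "\<And>i. i < N \<Longrightarrow> norm (z i - x i) \<le> \<eta> k * h"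
        by metis
      have "sum z {..<N} \<in> sum_power (card {..<N}) K"
        by (rule sum_power_sum) (use z in auto)
      moreover have "norm (sum z {..<N} - ?y) \<le> \<eta> k * (real N * h + R)"
      proof -
        have "sum z {..<N} - ?y = (\<Sum>i<N. z i - x i) - G k e'"
          using k(2) by (simp add: sum_subtractf)
        also have "norm \<dots> \<le> (\<Sum>i<N. norm (z i - x i)) + norm (G k e')"
          by (rule order_trans[OF norm_triangle_ineq4 add_right_mono[OF norm_sum]])
        also have "(\<Sum>i<N. norm (z i - x i)) \<le> (\<Sum>i<N. \<eta> k * h)"
          by (rule sum_mono) (use z in auto)
        also have "norm (G k e') \<le> \<eta> k * R"
        proof -
          \<comment> \<open>Testing the bound on a unit vector gives
            \<open>0 \<le> \<eta> k\<close>; any coordinate will do, hence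
            \<open>undefined\<close>.\<close>
          have "norm (G k (axis undefined 1)) \<le> \<eta> k"
            using \<eta>(1)[of k "axis undefined 1"] by simp
          then have "0 \<le> \<eta> k" using norm_ge_zero order_trans by blast
          then have "\<eta> k * norm e' \<le> \<eta> k * R" using k(3) by (rule mult_left_mono[rotated])
          then show ?thesis using \<eta>(1)[of k e'] by linarith
        qed
        finally show ?thesis by (simp add: algebra_simps)
      qed
      ultimately show ?thesis by auto
    qed
    then obtain z where z: "\<And>k. z k \<in> sum_power N K"
      "\<And>k. norm (z k - ?y) \<le> \<eta> k * (real N * h + R)" by metis
    have "(\<lambda>k. \<eta> k * (real N * h + R)) \<longlonglongrightarrow> 0"
      using tendsto_mult_right[OF \<eta>(2), of "real N * h + R"] by simp
    then have "(\<lambda>k. z k - ?y) \<longlonglongrightarrow> 0"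
      by (rule Lim_null_comparison[rotated]) (use z in auto)
    then have "z \<longlonglongrightarrow> ?y" by (rule LIM_zero_cancel)
    then show ?thesis
      using closed_sequentially[OF compact_imp_closed[OF compact_sum_power[OF K]]] z(1) by blast
  qed
  have "open (G 0 ` ball 0 R)"
    using open_surjective_linear_image[OF open_ball G(1)] linear_injective_imp_surjective[OF G(1) G(3)]
    by blast
  then have "open ((+) (real N *\<^sub>R x0) ` G 0 ` ball 0 R)" by (rule open_translation)
  moreover have "(+) (real N *\<^sub>R x0) ` G 0 ` ball 0 R \<subseteq> sum_power N K" using sub by auto
  ultimately have "(+) (real N *\<^sub>R x0) ` G 0 ` ball 0 R \<subseteq> interior (sum_power N K)"
    by (rule interior_maximal[rotated])
  moreover have "(+) (real N *\<^sub>R x0) ` G 0 ` ball 0 R \<noteq> {}" using R(1) by auto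
  ultimately show ?thesis by (intro exI[of _ N]) (auto simp: N_def)
qed

section \<open>Self-affine sets\<close>

text \<open>A pair stands for the affine map with linear part \<open>fst g\<close> and translation
  \<open>snd g\<close>; pairs are kept instead of functions so that the linear part of a composition
  stays accessible.\<close>

definition act :: "(real^'n^'n) \<times> (real^'n) \<Rightarrow> real^'n \<Rightarrow> real^'n" where
  "act g x = fst g *v x + snd g"

definition amult :: "(real^'n^'n) \<times> (real^'n) \<Rightarrow> (real^'n^'n) \<times> (real^'n)
    \<Rightarrow> (real^'n^'n) \<times> (real^'n)"
    (infixl "\<odot>" 70) where
  "g \<odot> h = (fst g ** fst h, fst g *v snd h + snd g)"

lemma fst_amult [simp]: "fst (g \<odot> h) = fst g ** fst h"
  by (simp add: amult_def)

lemma act_amult [simp]: "act (g \<odot> h) x = act g (act h x)"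
  by (simp add: act_def amult_def matrix_vector_mul_assoc matrix_vector_right_distrib)

lemma act_diff: "act g x - act g y = fst g *v (x - y)"
  by (simp add: act_def matrix_vector_mult_diff_distrib)

lemma amult_assoc: "(f \<odot> g) \<odot> h = f \<odot> (g \<odot> h)"
  by (simp add: amult_def matrix_mul_assoc matrix_vector_mul_assoc matrix_vector_right_distrib)

lemma interior_sum_power_thick:
  assumes "compact E" "1 \<le> r" "\<exists>N\<ge>1. interior (sum_power N (sum_power r E)) \<noteq> {}"
  shows "arithmetically_thick E"
proof -
  obtain N where N: "N \<ge> 1" "interior (sum_power N (sum_power r E)) \<noteq> {}" using assms(3) by blast
  have "interior (sum_power N (sum_power r E)) \<subseteq> interior (sum_power (N * r) E)"
    by (intro interior_mono sum_power_sum_power order_refl)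
  then have "interior (sum_power (N * r) E) \<noteq> {}" using N by blast
  moreover have "N * r \<ge> 1" using N assms(2) by simp
  ultimately show ?thesis using assms(1) by (auto simp: arithmetically_thick_def)
qed

locale self_affine =
  fixes l :: nat and T :: "nat \<Rightarrow> real^'n^'n" and a :: "nat \<Rightarrow> real^'n"
      and E :: "(real^'n) set"
  assumes invertible_T: "i \<in> {1..l} \<Longrightarrow> invertible (T i)"
    and onorm_T: "i \<in> {1..l} \<Longrightarrow> onorm ((*v) (T i)) < 1"
    and E_nonempty: "E \<noteq> {}"
    and compact_E: "compact E"
    and E_eq: "E = (\<Union>i\<in>{1..l}. (\<lambda>x. T i *v x + a i) ` E)"
    and not_flat: "v \<noteq> 0 \<Longrightarrow> \<exists>x\<in>E. v \<bullet> x \<noteq> c"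
begin

text \<open>The inserted 0 keeps \<open>Max\<close> defined and nonnegative before any letter is
  known to exist.\<close>

definition ratio :: real where
  "ratio = Max (insert 0 ((\<lambda>i. onorm ((*v) (T i))) ` {1..l}))"

lemma ratio: "0 \<le> ratio" "ratio < 1"
proof -
  have "0 \<in> insert 0 ((\<lambda>i. onorm ((*v) (T i))) ` {1..l})" by blast
  then show "0 \<le> ratio" unfolding ratio_def by (intro Max_ge) simp_all
  show "ratio < 1" unfolding ratio_def by (subst Max_less_iff) (use onorm_T in auto)
qed

lemma norm_T_le: "i \<in> {1..l} \<Longrightarrow> norm (T i *v x) \<le> ratio * norm x"
proof -
  assume i: "i \<in> {1..l}"
  have "norm (T i *v x) \<le> onorm ((*v) (T i)) * norm x"
    by (rule onorm) (rule matrix_vector_mul_bounded_linear)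
  also have "\<dots> \<le> ratio * norm x"
  proof (rule mult_right_mono)
    show "onorm ((*v) (T i)) \<le> ratio" unfolding ratio_def by (rule Max_ge) (simp, use i in blast)
  qed simp
  finally show ?thesis .
qed

text \<open>The last condition makes the ball invariant under every letter, as
  \<open>ratio * R + (1 - ratio) * R = R\<close>. An invariant ball is wanted besides
  \<open>E\<close> because base points need not lie in \<open>E\<close>.\<close>

definition radius :: real where
  "radius = (SOME R. 0 < R \<and> E \<subseteq> cball 0 R \<and>
      (\<forall>i\<in>{1..l}. norm (a i) \<le> (1 - ratio) * R))"

lemma radius: "0 < radius" "E \<subseteq> cball 0 radius" "i \<in> {1..l} \<Longrightarrow>
    norm (a i) \<le> (1 - ratio) * radius"
proof -
  obtain B where B: "\<forall>x\<in>E. norm x \<le> B"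
      using compact_imp_bounded[OF compact_E] bounded_iff by blast
  define M where "M = Max (insert 0 ((\<lambda>i. norm (a i)) ` {1..l}))"
  define R where "R = 1 + \<bar>B\<bar> + M / (1 - ratio)"
  have fin: "finite (insert 0 ((\<lambda>i. norm (a i)) ` {1..l}))" by simp
  have M: "0 \<le> M" "\<forall>i\<in>{1..l}. norm (a i) \<le> M"
    unfolding M_def using Max_ge[OF fin] by blast+
  have "0 < R" using M ratio by (simp add: R_def add_pos_nonneg)
  moreover have "E \<subseteq> cball 0 R"
  proof
    fix x assume "x \<in> E"
    then have "norm x \<le> \<bar>B\<bar>" using B by force
    moreover have "0 \<le> M / (1 - ratio)" using M ratio by simp
    ultimately show "x \<in> cball 0 R" by (simp add: R_def)
  qed
  moreover have "\<forall>i\<in>{1..l}. norm (a i) \<le> (1 - ratio) * R"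
  proof
    fix i assume "i \<in> {1..l}"
    then have "norm (a i) \<le> (1 - ratio) * (M / (1 - ratio))" using M ratio by simp
    also have "\<dots> \<le> (1 - ratio) * R" using ratio by (intro mult_left_mono) (auto simp: R_def)
    finally show "norm (a i) \<le> (1 - ratio) * R" .
  qed
  ultimately have "\<exists>R. 0 < R \<and> E \<subseteq> cball 0 R \<and>
      (\<forall>i\<in>{1..l}. norm (a i) \<le> (1 - ratio) * R)" by blast
  from someI_ex[OF this]
  have *: "0 < radius \<and> E \<subseteq> cball 0 radius \<and>
      (\<forall>i\<in>{1..l}. norm (a i) \<le> (1 - ratio) * radius)"
    unfolding radius_def .
  show "0 < radius" "E \<subseteq> cball 0 radius" using * by blast+
  show "i \<in> {1..l} \<Longrightarrow> norm (a i) \<le> (1 - ratio) * radius" using * by blast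
qed

text \<open>These are maps, not symbol sequences: words defining the same pair are identified.
  Length 0 gives the identity, which therefore lies in \<open>semigroup\<close>; nonempty words
  appear as \<open>words (Suc n)\<close> where strict contraction matters.\<close>

primrec words :: "nat \<Rightarrow> ((real^'n^'n) \<times> (real^'n)) set" where
  "words 0 = {(mat 1, 0)}"
| "words (Suc n) = {g \<odot> (T i, a i) | g i. g \<in> words n \<and> i \<in> {1..l}}"

definition semigroup :: "((real^'n^'n) \<times> (real^'n)) set" where
  "semigroup = (\<Union>n. words n)"

lemma words_semigroup: "g \<in> words n \<Longrightarrow> g \<in> semigroup"
  by (auto simp: semigroup_def)

lemma semigroup_words: "g \<in> semigroup \<Longrightarrow> \<exists>n. g \<in> words n"
  by (auto simp: semigroup_def)

lemma letter_words: "i \<in> {1..l} \<Longrightarrow> (T i, a i) \<in> words 1"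
  by (simp add: amult_def) blast

lemma words_SucI: "g \<in> words n \<Longrightarrow> i \<in> {1..l} \<Longrightarrow>
    g \<odot> (T i, a i) \<in> words (Suc n)"
  unfolding words.simps by blast

lemma words_SucE:
  assumes "g \<in> words (Suc n)"
  obtains h i where "g = h \<odot> (T i, a i)" "h \<in> words n" "i \<in> {1..l}"
  using assms unfolding words.simps by blast

declare words.simps(2) [simp del]

lemma words_add: "g \<in> words m \<Longrightarrow> h \<in> words n \<Longrightarrow>
    g \<odot> h \<in> words (m + n)"
proof (induction n arbitrary: h)
  case 0
  then show ?case by (simp add: amult_def)
next
  case (Suc n)
  then obtain h' i where "h = h' \<odot> (T i, a i)" "h' \<in> words n" "i \<in> {1..l}"
    using words_SucE by blast
  then show ?case using words_SucI[OF Suc.IH[of h'], of i] Suc.prems(1) by (simp add: amult_assoc)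
qed

lemma semigroup_amult: "g \<in> semigroup \<Longrightarrow> h \<in> semigroup \<Longrightarrow>
    g \<odot> h \<in> semigroup"
  using words_add unfolding semigroup_def by blast

lemma finite_words: "finite (words n)"
proof (induction n)
  case (Suc n)
  have "words (Suc n) = (\<Union>g\<in>words n. (\<lambda>i. g \<odot> (T i, a i)) ` {1..l})"
    unfolding words.simps by blast
  then show ?case using Suc by simp
qed simp

lemma words_induct [consumes 1, case_names Nil Snoc]:
  assumes "g \<in> semigroup" "P (mat 1, 0)"
    "\<And>g i. g \<in> semigroup \<Longrightarrow> P g \<Longrightarrow>
        i \<in> {1..l} \<Longrightarrow> P (g \<odot> (T i, a i))"
  shows "P g"
proof -
  obtain n where "g \<in> words n" using assms(1) semigroup_words by blast
  then show ?thesis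
  proof (induction n arbitrary: g)
    case 0
    then show ?case using assms(2) by simp
  next
    case (Suc n)
    then obtain h i where h: "g = h \<odot> (T i, a i)" "h \<in> words n" "i \<in> {1..l}"
      using words_SucE by blast
    then show ?case using assms(3)[of h i] Suc.IH[of h] words_semigroup[of h n] by simp
  qed
qed

lemma norm_words: "g \<in> words n \<Longrightarrow> norm (fst g *v x) \<le> ratio ^ n * norm x"
proof (induction n arbitrary: g x)
  case 0
  then show ?case by simp
next
  case (Suc n)
  then obtain g' i where g: "g = g' \<odot> (T i, a i)" "g' \<in> words n" "i \<in> {1..l}"
    using words_SucE by blast
  have "norm (fst g *v x) \<le> ratio ^ n * norm (T i *v x)"
    using Suc.IH[OF g(2)] g(1) by (simp add: matrix_vector_mul_assoc[symmetric])
  also have "\<dots> \<le> ratio ^ n * (ratio * norm x)"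
    by (intro mult_left_mono norm_T_le g) (simp add: ratio)
  finally show ?case by (simp add: mult.assoc mult.left_commute)
qed

lemma norm_semigroup: "g \<in> semigroup \<Longrightarrow> norm (fst g *v x) \<le> norm x"
proof -
  assume "g \<in> semigroup"
  then obtain n where "g \<in> words n" using semigroup_words by blast
  then have "norm (fst g *v x) \<le> ratio ^ n * norm x" by (rule norm_words)
  also have "\<dots> \<le> 1 * norm x"
    by (intro mult_right_mono power_le_one) (use ratio in auto)
  finally show ?thesis by simp
qed

lemma invertible_semigroup: "g \<in> semigroup \<Longrightarrow> invertible (fst g)"
  by (induction rule: words_induct) (auto simp: invertible_mult invertible_T invertible_def[of "mat 1"])

lemma letter_E: "y \<in> E \<longleftrightarrow> (\<exists>i\<in>{1..l}. \<exists>z\<in>E. y =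
    act (T i, a i) z)"
  by (subst E_eq) (auto simp: act_def)

lemma act_E: "g \<in> semigroup \<Longrightarrow> x \<in> E \<Longrightarrow> act g x \<in> E"
proof (induction arbitrary: x rule: words_induct)
  case Nil
  then show ?case by (simp add: act_def)
next
  case (Snoc g i)
  then have "act (T i, a i) x \<in> E" using letter_E by blast
  then show ?case using Snoc by simp
qed

lemma act_ball: "g \<in> semigroup \<Longrightarrow> x \<in> cball 0 radius \<Longrightarrow>
    act g x \<in> cball 0 radius"
proof (induction arbitrary: x rule: words_induct)
  case Nil
  then show ?case by (simp add: act_def)
next
  case (Snoc g i)
  have "norm (T i *v x + a i) \<le> ratio * norm x + (1 - ratio) * radius"
    using norm_T_le[of i x] radius(3)[of i] Snoc by (intro norm_triangle_le) simp
  also have "\<dots> \<le> ratio * radius + (1 - ratio) * radius"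
    using Snoc ratio by (intro add_right_mono mult_left_mono) auto
  finally have "act (T i, a i) x \<in> cball 0 radius" by (simp add: act_def algebra_simps)
  then show ?case using Snoc by simp
qed

lemma E_words: "x \<in> E \<Longrightarrow> \<exists>g\<in>words n. \<exists>y\<in>E. x = act g y"
proof (induction n)
  case 0
  then show ?case by (auto simp: act_def)
next
  case (Suc n)
  then obtain g y where g: "g \<in> words n" "y \<in> E" "x = act g y" by blast
  then obtain i z where "i \<in> {1..l}" "z \<in> E" "y = act (T i, a i) z"
    using letter_E by blast
  then have "g \<odot> (T i, a i) \<in> words (Suc n)" "x = act (g \<odot> (T i, a i)) z"
    using g words_SucI by auto
  then show ?case using \<open>z \<in> E\<close> by blast
qed

lemma letter_exists: "1 \<in> {1..l}"
proof -
  obtain i where "i \<in> {1..l}" using E_nonempty letter_E by blast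
  then show ?thesis by simp
qed

section \<open>Words that steer in every direction\<close>

lemma ratio_power_small: "0 < \<epsilon> \<Longrightarrow>
    \<exists>n0. \<forall>n\<ge>n0. ratio ^ n * (2 * radius) < \<epsilon>"
proof -
  assume "0 < \<epsilon>"
  have "(\<lambda>n. ratio ^ n * (2 * radius)) \<longlonglongrightarrow> 0 * (2 * radius)"
    by (intro tendsto_mult tendsto_const LIMSEQ_power_zero) (use ratio in simp)
  then have "\<forall>\<^sub>F n in sequentially. ratio ^ n * (2 * radius) < \<epsilon>"
    using \<open>0 < \<epsilon>\<close> by (simp add: order_tendstoD)
  then show ?thesis by (simp add: eventually_sequentially)
qed

lemma dist_act_words:
  assumes "g \<in> words n" "x \<in> cball 0 radius" "y \<in> cball 0 radius"
  shows "norm (act g x - act g y) \<le> ratio ^ n * (2 * radius)"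
proof -
  have "norm (act g x - act g y) \<le> ratio ^ n * norm (x - y)"
    by (simp add: act_diff norm_words assms)
  also have "norm (x - y) \<le> 2 * radius"
    using norm_triangle_ineq4[of x y] assms by simp
  finally show ?thesis using ratio by (simp add: mult_left_mono)
qed

text \<open>As \<open>E\<close> lies in no hyperplane, its convex hull contains a ball around some
  \<open>b\<close>, so in every direction \<open>E\<close> reaches beyond \<open>b\<close> by a
  fixed amount. A point that does so lies in cylinders of every length, and a long cylinder is too
  small to lose more than half of the advantage. The estimate covers the whole invariant ball, so
  that any suffix may be appended to \<open>u\<close> later.\<close>

lemma steering_words:
  obtains b c n0 where "b \<in> cball 0 radius" "0 < c"
    "\<And>n e. n \<ge> n0 \<Longrightarrow> \<exists>u\<in>words n. \<forall>x\<in>cball 0 radius.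
        (act u x - b) \<bullet> e \<ge> c * norm e"
proof -
  have "interior (convex hull E) \<noteq> {}"
  proof
    assume "interior (convex hull E) = {}"
    then obtain v c where v: "v \<noteq> 0" "convex hull E \<subseteq> {x. v \<bullet> x = c}"
      using empty_interior_subset_hyperplane[OF convex_convex_hull] by metis
    then show False using not_flat[OF v(1), of c] hull_subset[of E convex] by blast
  qed
  then obtain b r where b: "r > 0" "ball b r \<subseteq> convex hull E"
    using mem_interior by blast
  \<comment> \<open>A quarter of the radius: \<open>y\<close> below is then at distance at most half
    the radius from \<open>b\<close>, and half of the gain \<open>2 * c\<close> can be spent on the
    diameter of a cylinder.\<close>
  define c where "c = r / 4"
  have "c > 0" using b by (simp add: c_def)
  have far: "\<exists>q\<in>E. (q - b) \<bullet> e \<ge> 2 * c * norm e" for e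
  proof (rule ccontr)
    assume "\<not> ?thesis"
    then have "e \<bullet> x < e \<bullet> b + 2 * c * norm e" if "x \<in> E" for x
      using that by (force simp: not_le inner_diff_left inner_commute[of e])
    then have "E \<subseteq> {x. e \<bullet> x < e \<bullet> b + 2 * c * norm e}" by blast
    then have H: "convex hull E \<subseteq> {x. e \<bullet> x < e \<bullet> b + 2 * c * norm e}"
      by (simp add: hull_minimal convex_halfspace_lt)
    \<comment> \<open>For \<open>e = 0\<close> this is \<open>b\<close> itself, and the strict
      inequality is contradictory all the same.\<close>
    define y where "y = b + (2 * c / norm e) *\<^sub>R e"
    have "y \<in> ball b r" using b by (simp add: y_def dist_norm c_def)
    then have "e \<bullet> y < e \<bullet> b + 2 * c * norm e" using H b by blast
    then show False
      by (cases "e = 0") (auto simp: y_def inner_add_right power2_norm_eq_inner[symmetric] power2_eq_square)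
  qed
  obtain n0 where n0: "\<forall>n\<ge>n0. ratio ^ n * (2 * radius) < c"
    using ratio_power_small \<open>c > 0\<close> by blast
  have bX: "b \<in> cball 0 radius"
  proof -
    have "convex hull E \<subseteq> cball 0 radius" using radius(2) by (simp add: hull_minimal)
    then show ?thesis using b centre_in_ball by blast
  qed
  have "\<exists>u\<in>words n. \<forall>x\<in>cball 0 radius.
      (act u x - b) \<bullet> e \<ge> c * norm e" if "n \<ge> n0" for n e
  proof -
    obtain q where q: "q \<in> E" "(q - b) \<bullet> e \<ge> 2 * c * norm e" using far by blast
    obtain u p where u: "u \<in> words n" "p \<in> E" "q = act u p" using E_words q by blast
    have "(act u x - b) \<bullet> e \<ge> c * norm e" if "x \<in> cball 0 radius" for x
    proof -
      have "norm (act u x - q) \<le> c"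
        using dist_act_words[of u n x p] u that radius(2) n0 \<open>n \<ge> n0\<close> by fastforce
      then have "norm (act u x - q) * norm e \<le> c * norm e" by (rule mult_right_mono) simp
      then have "\<bar>(act u x - q) \<bullet> e\<bar> \<le> c * norm e"
        using Cauchy_Schwarz_ineq2 order_trans by blast
      moreover have "(act u x - b) \<bullet> e = (act u x - q) \<bullet> e + (q - b) \<bullet> e"
        by (simp add: inner_diff_left)
      ultimately show ?thesis using q(2) by linarith
    qed
    then show ?thesis using u by blast
  qed
  then show thesis using that bX \<open>c > 0\<close> by blast
qed

text \<open>Images of \<open>p\<close> under long words come arbitrarily close to every point of
  \<open>E\<close>, so a functional constant on the orbit of \<open>p\<close> would be constant on
  \<open>E\<close>.\<close>

lemma act_not_constant:
  assumes "p \<in> cball 0 radius" "f \<noteq> 0"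
  shows "\<exists>g\<in>semigroup. f \<bullet> (act g p - p) \<noteq> 0"
proof (rule ccontr)
  assume "\<not> ?thesis"
  then have *: "f \<bullet> act g p = f \<bullet> p" if "g \<in> semigroup" for g
    using that by (auto simp: inner_diff_right)
  obtain q where q: "q \<in> E" "f \<bullet> q \<noteq> f \<bullet> p" using not_flat assms by blast
  define \<epsilon> where "\<epsilon> = \<bar>f \<bullet> q - f \<bullet> p\<bar> / norm f"
  have "\<epsilon> > 0" using q assms by (simp add: \<epsilon>_def)
  then obtain n where n: "ratio ^ n * (2 * radius) < \<epsilon>" using ratio_power_small by blast
  obtain u y where u: "u \<in> words n" "y \<in> E" "q = act u y" using E_words q by blast
  then have "norm (q - act u p) < \<epsilon>" using dist_act_words[of u n y p] radius(2) assms n by fastforce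
  moreover have "\<bar>f \<bullet> (q - act u p)\<bar> \<le> norm f * norm (q - act u p)"
    by (rule Cauchy_Schwarz_ineq2)
  ultimately have "\<bar>f \<bullet> (q - act u p)\<bar> < norm f * \<epsilon>"
    using assms(2) by (meson mult_strict_left_mono order_le_less_trans zero_less_norm_iff)
  moreover have "f \<bullet> (q - act u p) = f \<bullet> q - f \<bullet> p"
    using * u(1) words_semigroup by (simp add: inner_diff_right)
  ultimately show False using assms(2) by (simp add: \<epsilon>_def)
qed

lemma fixed_point:
  assumes "g \<in> words (Suc n)"
  shows "\<exists>p\<in>E. act g p = p"
proof -
  have "\<exists>!x\<in>E. act g x = x"
  proof (rule Banach_fix[of E "ratio ^ Suc n"])
    show "complete E" using compact_E compact_imp_complete by blast
    show "E \<noteq> {}" by (rule E_nonempty)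
    show "0 \<le> ratio ^ Suc n" using ratio by simp
    have "ratio ^ Suc n \<le> ratio ^ 1" by (rule power_decreasing) (use ratio in auto)
    then show "ratio ^ Suc n < 1" using ratio(2) by simp
    show "act g ` E \<subseteq> E" using act_E words_semigroup[OF assms] by blast
    show "dist (act g x) (act g y) \<le> ratio ^ Suc n * dist x y" for x y
      using norm_words[OF assms, of "x - y"] by (simp add: dist_norm act_diff)
  qed
  then show ?thesis by blast
qed

end

section \<open>Commuting linear parts\<close>

text \<open>The first index at or below \<open>t\<close> works: the value before it exceeded
  \<open>t\<close>, and one step loses at most the factor \<open>\<tau>\<close>. The bound at index
  0 covers the case without a predecessor.\<close>

lemma calibrate:
  fixes \<nu> :: "nat \<Rightarrow> real"
  assumes "0 < t" "\<tau> * t \<le> \<nu> 0" "\<And>m. \<tau> * \<nu> m \<le>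
      \<nu> (Suc m)" "0 < \<tau>" "\<nu> \<longlonglongrightarrow> 0"
  shows "\<exists>m. \<tau> * t \<le> \<nu> m \<and> \<nu> m \<le> t"
proof -
  have "\<forall>\<^sub>F m in sequentially. \<nu> m < t" using assms(1,5) by (simp add: order_tendstoD)
  then have ex: "\<exists>m. \<nu> m \<le> t" by (auto simp: eventually_sequentially intro: less_imp_le)
  define m where "m = (LEAST m. \<nu> m \<le> t)"
  have m: "\<nu> m \<le> t" unfolding m_def using ex by (rule LeastI_ex)
  show ?thesis
  proof (cases m)
    case 0
    then show ?thesis using m assms(2) by blast
  next
    case (Suc k)
    then have "\<not> \<nu> k \<le> t"
        using not_less_Least[of k "\<lambda>m. \<nu> m \<le> t"] by (simp add: m_def)
    then have "\<tau> * t \<le> \<tau> * \<nu> k" using assms(4) by simp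
    then have "\<tau> * t \<le> \<nu> m" using assms(3)[of k] Suc by simp
    then show ?thesis using m by blast
  qed
qed

context self_affine
begin

text \<open>Dropping the first occurrence of \<open>u\<close> from the list leaves the suffix:
  \<open>u\<close> commutes with the factors in front of it and can be pulled to the left. Only
  linear parts agree afterwards; the translations differ, and the moves live in that
  difference.\<close>

lemma commuting_completion:
  assumes "set us \<subseteq> semigroup" "u \<in> set us"
    "\<And>v. v \<in> set us \<Longrightarrow> fst u ** fst v = fst v ** fst u"
  shows "\<exists>h\<in>semigroup. fst u ** fst h = fst (foldr (\<odot>) us (mat 1, 0))"
  using assms
proof (induction us)
  case (Cons v us)
  have us: "foldr (\<odot>) us (mat 1, 0) \<in> semigroup" if "set us \<subseteq> semigroup" for us
    using that
  proof (induction us)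
    case Nil
    then show ?case using words_semigroup[of _ 0] by simp
  qed (simp add: semigroup_amult)
  show ?case
  proof (cases "u = v")
    case True
    then show ?thesis using us[of us] Cons.prems(1) by auto
  next
    case False
    then obtain h where h: "h \<in> semigroup" "fst u ** fst h = fst (foldr (\<odot>) us (mat 1, 0))"
      using Cons by auto
    have "fst u ** fst (v \<odot> h) = fst v ** (fst u ** fst h)"
      using Cons.prems(3)[of v] by (simp add: matrix_mul_assoc)
    also have "\<dots> = fst (foldr (\<odot>) (v # us) (mat 1, 0))" using h by simp
    finally show ?thesis using h(1) Cons.prems(1) semigroup_amult[of v h]
      by (intro bexI[of _ "v \<odot> h"]) simp_all
  qed
qed simp

text \<open>Each step appends a completed word of linear part \<open>D\<close>, so all
  configurations of level \<open>k\<close> have the same linear part, the power of \<open>D\<close>,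
  and differ in position only. Commutation is asked of \<open>U\<close> alone, which admits
  noncommuting systems whose steering words can be chosen among commuting ones.\<close>

lemma thick_if_commuting:
  assumes U: "finite U" "\<And>u. u \<in> U \<Longrightarrow> \<exists>n. u \<in> words (Suc n)"
    and comm: "\<And>u v. u \<in> U \<Longrightarrow> v \<in> U \<Longrightarrow>
        fst u ** fst v = fst v ** fst u"
    and b: "b \<in> cball 0 radius" "0 < c"
    and steer: "\<And>e. \<exists>u\<in>U. \<forall>x\<in>cball 0 radius.
        (act u x - b) \<bullet> e \<ge> c * norm e"
  shows "arithmetically_thick E"
proof -
  obtain us where us: "set us = U" using finite_list[OF U(1)] by blast
  define D where "D = fst (foldr (\<odot>) us (mat 1, 0))"
  have sg: "U \<subseteq> semigroup" using U(2) words_semigroup by blast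
  have compl: "\<exists>h\<in>semigroup. fst u ** fst h = D" if "u \<in> U" for u
    using commuting_completion[of us u] that us sg comm unfolding D_def by blast
  obtain u where u: "u \<in> U" using steer by blast
  then obtain h n where h: "h \<in> semigroup" "D = fst (u \<odot> h)" "u \<in> words (Suc n)"
    using compl U(2) by (metis fst_amult)
  have normD: "norm (D *v x) \<le> ratio * norm x" for x
  proof -
    have "norm (D *v x) \<le> ratio ^ Suc n * norm (fst h *v x)"
      using norm_words[OF h(3), of "fst h *v x"] h(2) by (simp add: matrix_vector_mul_assoc)
    also have "\<dots> \<le> ratio ^ 1 * norm x"
      by (intro mult_mono norm_semigroup h power_decreasing) (use ratio in auto)
    finally show ?thesis by simp
  qed
  have invD: "invertible D" using invertible_semigroup semigroup_amult h u sg by blast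
  then obtain D' where D': "D ** D' = mat 1" using invertible_def by blast
  define G where "G k = ((*v) D ^^ k)" for k
  define P where "P k x \<longleftrightarrow> (\<exists>g\<in>semigroup. x = act g b \<and>
      (\<forall>y. fst g *v y = G k y))" for k x
  have "\<exists>N\<ge>1. interior (sum_power N E) \<noteq> {}"
  proof (rule interior_sum_power_steered[where G = G and D = "(*v) D" and D' = "(*v) D'"
        and \<eta> = "\<lambda>k. ratio ^ k" and P = P and h = "2 * radius" and c = c])
    show lin: "linear (G k)" for k
    proof (induction k)
      case 0
      show ?case by (simp add: G_def linear_iff)
    next
      case (Suc k)
      then show ?case using linear_compose[of "G k" "(*v) D"] by (simp add: G_def o_def)
    qed
    show "G (Suc k) x = G k (D *v x)" for k x by (simp add: G_def funpow_Suc_right del: funpow.simps)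
    show "inj (G 0)" by (simp add: G_def)
    show "linear ((*v) D')" by simp
    show "D *v (D' *v x) = x" for x
      using D' by (simp add: matrix_vector_mul_assoc)
    show "norm (G k x) \<le> ratio ^ k * norm x" for k x
    proof (induction k)
      case (Suc k)
      have "norm (G (Suc k) x) \<le> ratio * norm (G k x)" using normD by (simp add: G_def)
      also have "\<dots> \<le> ratio * (ratio ^ k * norm x)" by (intro mult_left_mono Suc ratio)
      finally show ?case by (simp add: mult.assoc)
    qed (simp add: G_def)
    show "(\<lambda>k. ratio ^ k) \<longlonglongrightarrow> 0" using ratio by (intro LIMSEQ_power_zero) simp
    show "0 < c" "compact E" using b compact_E by auto
    show "P 0 b" unfolding P_def
      by (intro bexI[of _ "(mat 1, 0)"]) (auto simp: G_def act_def words_semigroup[of _ 0])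
    show "\<exists>y\<in>E. norm (y - x) \<le> ratio ^ k * (2 * radius)" if "P k x" for k x
    proof -
      obtain g where g: "g \<in> semigroup" "x = act g b" "\<forall>y. fst g *v y = G k y"
        using \<open>P k x\<close> P_def by blast
      obtain p where p: "p \<in> E" using E_nonempty by blast
      have "norm (act g p - x) \<le> ratio ^ k * norm (p - b)"
        using g \<open>norm (G k (p - b)) \<le> ratio ^ k * norm (p - b)\<close> by (simp add: act_diff)
      also have "\<dots> \<le> ratio ^ k * (2 * radius)"
        using norm_triangle_ineq4[of p b] b(1) p radius(2) ratio(1) by (intro mult_left_mono) fastforce+
      finally show ?thesis using act_E[OF g(1) p] by blast
    qed
    show "\<exists>m. P (Suc k) (x + G k m) \<and> norm m \<le> 2 * radius \<and>
        c * norm e \<le> m \<bullet> e"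
      if "P k x" for k x e
    proof -
      obtain g where g: "g \<in> semigroup" "x = act g b" "\<forall>y. fst g *v y = G k y"
        using \<open>P k x\<close> P_def by blast
      obtain u where u: "u \<in> U" "\<forall>x\<in>cball 0 radius.
          (act u x - b) \<bullet> e \<ge> c * norm e"
        using steer by blast
      obtain h where h: "h \<in> semigroup" "fst u ** fst h = D" using compl u by blast
      define w where "w = u \<odot> h"
      have "u \<in> semigroup" using u sg by blast
      then have w: "w \<in> semigroup" "fst w = D" using h semigroup_amult[of u h] by (simp_all add: w_def)
      define m where "m = act w b - b"
      have "act (g \<odot> w) b = x + G k m"
        using act_diff[of g "act w b" b] g by (simp add: m_def diff_eq_eq add.commute)
      moreover have "P (Suc k) (act (g \<odot> w) b)"
        unfolding P_def
        by (intro bexI[of _ "g \<odot> w"] conjI refl semigroup_amult g w)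
          (use g w \<open>\<And>k x. G (Suc k) x =
              G k (D *v x)\<close> in \<open>simp add: matrix_vector_mul_assoc[symmetric]\<close>)
      moreover have "norm m \<le> 2 * radius"
        using norm_triangle_ineq4[of "act w b" b] act_ball[OF w(1) b(1)] b(1) by (simp add: m_def)
      \<comment> \<open>The completing suffix \<open>h\<close> does not spoil the direction of
        \<open>u\<close>: it keeps \<open>b\<close> in the ball, on all of which \<open>u\<close>
        steers.\<close>
      moreover have "c * norm e \<le> m \<bullet> e"
        using u(2) act_ball[OF h(1) b(1)] by (simp add: m_def w_def)
      ultimately show ?thesis by auto
    qed
  qed
  then show ?thesis by (intro interior_sum_power_thick[OF compact_E, of 1]) (simp_all only: sum_power_1
      order_refl)
qed

end

section \<open>Contracting words and invariant cones\<close>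

text \<open>For spanning \<open>B\<close> the sum is a norm of \<open>e\<close>, hence comparable
  with the Euclidean one by compactness of the unit sphere.\<close>

lemma spanning_sum_abs_inner_ge:
  fixes B :: "'a::euclidean_space set"
  assumes "finite B" "span B = UNIV"
  shows "\<exists>c>0. \<forall>e. (\<Sum>x\<in>B. \<bar>e \<bullet> x\<bar>) \<ge> c * norm e"
proof -
  define F where "F e = (\<Sum>x\<in>B. \<bar>e \<bullet> x\<bar>)" for e
  have pos: "F e > 0" if "e \<noteq> 0" for e
  proof (rule ccontr)
    assume "\<not> F e > 0"
    moreover have "F e \<ge> 0" unfolding F_def by (rule sum_nonneg) simp
    ultimately have "F e = 0" by linarith
    then have "\<forall>x\<in>B. e \<bullet> x = 0"
      using assms(1) unfolding F_def by (subst (asm) sum_nonneg_eq_0_iff) auto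
    then have "B \<subseteq> {x. e \<bullet> x = 0}" by blast
    then have "span B \<subseteq> {x. e \<bullet> x = 0}" by (rule span_minimal[OF _ subspace_hyperplane])
    then have "e \<bullet> e = 0" using assms(2) by blast
    then show False using that by simp
  qed
  have "\<exists>c>0. \<forall>e\<in>sphere 0 1. F e \<ge> c"
  proof (cases "sphere (0::'a) 1 = {}")
    case True
    then show ?thesis by (auto intro: exI[of _ 1])
  next
    case False
    have "continuous_on (sphere 0 1) F" unfolding F_def by (intro continuous_intros)
    then obtain e0 where "e0 \<in> sphere 0 1" "\<forall>e\<in>sphere 0 1. F e0 \<le> F e"
      using continuous_attains_inf[OF compact_sphere False] by blast
    then show ?thesis using pos[of e0] by (intro exI[of _ "F e0"]) force
  qed
  then obtain c where c: "c > 0" "\<And>e. norm e = 1 \<Longrightarrow> F e \<ge> c" by auto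
  have "F e \<ge> c * norm e" for e
  proof (cases "e = 0")
    case False
    have "F e = norm e * F (e /\<^sub>R norm e)"
      using False by (simp add: F_def sum_distrib_left abs_mult mult.assoc[symmetric])
    moreover have "F (e /\<^sub>R norm e) \<ge> c" using False by (intro c) simp
    ultimately show ?thesis using False by (simp add: mult.commute mult_left_mono)
  qed (simp add: F_def)
  then show ?thesis using c(1) unfolding F_def by blast
qed

text \<open>With \<open>f \<bullet> v = 1\<close>, a vector splits into its part along
  \<open>v\<close>, of height \<open>f \<bullet> x\<close>, and a remainder in the kernel of
  \<open>f\<close>. The remainder is measured against the height, not its modulus, so for positive
  \<epsilon> this is one half of the double cone, and it is convex.\<close>

definition eigen_cone :: "'a::real_inner \<Rightarrow> 'a \<Rightarrow> real \<Rightarrow> 'a set" where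
  "eigen_cone f v \<epsilon> = {x. norm (x - (f \<bullet> x) *\<^sub>R v) \<le> \<epsilon> * (f \<bullet> x)}"

lemma cone_inner_nonneg: "x \<in> eigen_cone f v \<epsilon> \<Longrightarrow>
    0 < \<epsilon> \<Longrightarrow> 0 \<le> f \<bullet> x"
proof -
  assume "x \<in> eigen_cone f v \<epsilon>" "0 < \<epsilon>"
  then have "0 \<le> \<epsilon> * (f \<bullet> x)" unfolding eigen_cone_def
      by (auto intro: order_trans[OF norm_ge_zero])
  then show ?thesis using \<open>0 < \<epsilon>\<close> by (simp add: zero_le_mult_iff)
qed

lemma cone_add: "x \<in> eigen_cone f v \<epsilon> \<Longrightarrow>
    y \<in> eigen_cone f v \<epsilon> \<Longrightarrow> x + y \<in> eigen_cone f v \<epsilon>"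
proof -
  assume "x \<in> eigen_cone f v \<epsilon>" "y \<in> eigen_cone f v \<epsilon>"
  moreover have "(x + y) - (f \<bullet> (x + y)) *\<^sub>R v =
      (x - (f \<bullet> x) *\<^sub>R v) + (y - (f \<bullet> y) *\<^sub>R v)"
    by (simp add: inner_add_right algebra_simps)
  ultimately show ?thesis
    unfolding eigen_cone_def using norm_triangle_ineq[of "x - (f \<bullet> x) *\<^sub>R v"
        "y - (f \<bullet> y) *\<^sub>R v"]
    by (simp add: inner_add_right algebra_simps)
qed

lemma cone_scaleR: "x \<in> eigen_cone f v \<epsilon> \<Longrightarrow> 0 \<le> c \<Longrightarrow>
    c *\<^sub>R x \<in> eigen_cone f v \<epsilon>"
proof -
  assume "x \<in> eigen_cone f v \<epsilon>" "0 \<le> c"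
  moreover have "c *\<^sub>R x - (f \<bullet> (c *\<^sub>R x)) *\<^sub>R v =
      c *\<^sub>R (x - (f \<bullet> x) *\<^sub>R v)"
    by (simp add: algebra_simps)
  ultimately show ?thesis
    unfolding eigen_cone_def using mult_left_mono[of "norm (x - (f \<bullet> x) *\<^sub>R v)"
        "\<epsilon> * (f \<bullet> x)" c]
    by (simp add: mult.left_commute)
qed

lemma cone_mono: "x \<in> eigen_cone f v \<delta> \<Longrightarrow> 0 < \<delta> \<Longrightarrow>
    \<delta> \<le> \<epsilon> \<Longrightarrow> x \<in> eigen_cone f v \<epsilon>"
  using cone_inner_nonneg[of x f v \<delta>] mult_right_mono[of \<delta> \<epsilon> "f \<bullet> x"]
  by (auto simp: eigen_cone_def)

text \<open>The narrower aperture pays for the subtraction: the remainders add up to at most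
  \<epsilon> times a quarter of the sum of the heights, and if one height is at least twice the
  other, a quarter of their sum is below their difference.\<close>

lemma cone_diff:
  assumes "x \<in> eigen_cone f v (\<epsilon> / 4)" "y \<in> eigen_cone f v (\<epsilon> / 4)"
      "0 < \<epsilon>" "2 * (f \<bullet> y) \<le> f \<bullet> x"
  shows "x - y \<in> eigen_cone f v \<epsilon>"
proof -
  have nn: "0 \<le> f \<bullet> x" "0 \<le> f \<bullet> y" using cone_inner_nonneg assms by force+
  have eq: "(x - y) - (f \<bullet> (x - y)) *\<^sub>R v =
      (x - (f \<bullet> x) *\<^sub>R v) - (y - (f \<bullet> y) *\<^sub>R v)"
    by (simp add: inner_diff_right algebra_simps)
  have "norm ((x - y) - (f \<bullet> (x - y)) *\<^sub>R v) \<le>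
      \<epsilon> / 4 * (f \<bullet> x) + \<epsilon> / 4 * (f \<bullet> y)"
    unfolding eq using assms(1,2) norm_triangle_ineq4[of "x - (f \<bullet> x) *\<^sub>R v"
        "y - (f \<bullet> y) *\<^sub>R v"]
    by (simp add: eigen_cone_def)
  also have "\<dots> = \<epsilon> * ((f \<bullet> x + f \<bullet> y) / 4)" by (simp add: field_simps)
  also have "\<dots> \<le> \<epsilon> * (f \<bullet> (x - y))"
    using assms(3,4) nn by (intro mult_left_mono) (auto simp: inner_diff_right)
  finally show ?thesis by (simp add: eigen_cone_def)
qed

lemma norm_cone: 
  assumes "x \<in> eigen_cone f v \<epsilon>" "\<epsilon> \<le> 1" "0 < \<epsilon>"
  shows "norm x \<le> (norm v + 1) * (f \<bullet> x)"
proof -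
  have nn: "0 \<le> f \<bullet> x" using cone_inner_nonneg assms by blast
  have "norm x \<le> norm ((f \<bullet> x) *\<^sub>R v) + norm (x - (f \<bullet> x) *\<^sub>R v)"
    using norm_triangle_ineq[of "(f \<bullet> x) *\<^sub>R v" "x - (f \<bullet> x) *\<^sub>R v"] by simp
  also have "\<dots> \<le> (f \<bullet> x) * norm v + 1 * (f \<bullet> x)"
    using assms nn mult_right_mono[of \<epsilon> 1 "f \<bullet> x"] by (simp add: eigen_cone_def)
  finally show ?thesis by (simp add: algebra_simps)
qed

section \<open>Iterates of a word with a dominant eigenvector\<close>

primrec apow :: "(real^'n^'n) \<times> (real^'n) \<Rightarrow> nat \<Rightarrow> (real^'n^'n) \<times>
    (real^'n)" where
  "apow g 0 = (mat 1, 0)"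
| "apow g (Suc n) = apow g n \<odot> g"

text \<open>The kernel of the left eigenvector \<open>f\<close> is an invariant complement of the
  line of \<open>v\<close>. The factor 1/2 is a normalisation that a suitable power of a proximal
  word attains; positivity of \<open>\<mu>\<close> keeps the cone from being reflected.\<close>

locale contracting_word = self_affine l T a E
  for l :: nat and T :: "nat \<Rightarrow> real^'n^'n" and a :: "nat \<Rightarrow> real^'n"
      and E :: "(real^'n) set" +
  fixes w :: "(real^'n^'n) \<times> (real^'n)" and n :: nat and \<mu> :: real and v f p :: "real^'n"
  assumes w: "w \<in> words (Suc n)"
    and \<mu>_pos: "0 < \<mu>"
    and right: "fst w *v v = \<mu> *\<^sub>R v"
    and left: "\<And>x. f \<bullet> (fst w *v x) = \<mu> * (f \<bullet> x)"
    and fv: "f \<bullet> v = 1"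
    and contract: "\<And>x. f \<bullet> x = 0 \<Longrightarrow> norm (fst w *v x) \<le> \<mu> / 2 * norm x"
    and p: "p \<in> E" "act w p = p"
begin

lemma wsg: "w \<in> semigroup"
  using w words_semigroup by blast

lemma pw_semigroup: "apow w k \<in> semigroup"
  by (induction k) (auto simp: wsg semigroup_amult words_semigroup[of _ 0])

lemma pw_fixes: "act (apow w k) p = p"
  by (induction k) (auto simp: p, simp add: act_def)

lemma pw_left: "f \<bullet> (fst (apow w k) *v x) = \<mu> ^ k * (f \<bullet> x)"
  by (induction k arbitrary: x) (auto simp: left matrix_vector_mul_assoc[symmetric])

lemma pw_right: "fst (apow w k) *v v = \<mu> ^ k *\<^sub>R v"
  by (induction k) (auto simp: right matrix_vector_mul_assoc[symmetric] matrix_vector_mult_scaleR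
      mult.commute)

lemma pw_contract: "f \<bullet> x = 0 \<Longrightarrow>
    norm (fst (apow w k) *v x) \<le> (\<mu> / 2) ^ k * norm x"
proof (induction k arbitrary: x)
  case (Suc k)
  have "norm (fst (apow w (Suc k)) *v x) \<le> (\<mu> / 2) ^ k * norm (fst w *v x)"
    using Suc.IH[of "fst w *v x"] Suc.prems by (simp add: left matrix_vector_mul_assoc[symmetric])
  also have "\<dots> \<le> (\<mu> / 2) ^ k * (\<mu> / 2 * norm x)"
    using Suc.prems \<mu>_pos by (intro mult_left_mono contract) auto
  finally show ?case by (simp add: mult.assoc mult.left_commute)
qed simp

lemma pw_norm: "norm (fst (apow w k) *v x) \<le> ratio ^ k * norm x"
proof (induction k arbitrary: x)
  case (Suc k)
  have "norm (fst (apow w (Suc k)) *v x) \<le> ratio ^ k * norm (fst w *v x)"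
    using Suc.IH[of "fst w *v x"] by (simp add: matrix_vector_mul_assoc[symmetric])
  also have "\<dots> \<le> ratio ^ k * (ratio ^ Suc n * norm x)"
    using ratio by (intro mult_left_mono norm_words w) auto
  also have "\<dots> \<le> ratio ^ k * (ratio ^ 1 * norm x)"
    using ratio by (intro mult_left_mono mult_right_mono power_decreasing) auto
  finally show ?case by (simp add: mult.assoc mult.left_commute)
qed simp

text \<open>The remainder is smaller than the main term by the factor \<open>(1/2) ^ k\<close>, so
  high powers of \<open>w\<close> turn any vector with nonzero height towards the line of
  \<open>v\<close>.\<close>

lemma pw_remainder:
  "norm (fst (apow w k) *v x - (\<mu> ^ k * (f \<bullet> x)) *\<^sub>R v) \<le>
      (\<mu> / 2) ^ k * norm (x - (f \<bullet> x) *\<^sub>R v)"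
proof -
  have "f \<bullet> (x - (f \<bullet> x) *\<^sub>R v) = 0" by (simp add: inner_diff_right fv)
  then have "norm (fst (apow w k) *v (x - (f \<bullet> x) *\<^sub>R v)) \<le>
      (\<mu> / 2) ^ k * norm (x - (f \<bullet> x) *\<^sub>R v)"
    by (rule pw_contract)
  then show ?thesis
    by (simp add: matrix_vector_mult_diff_distrib matrix_vector_mult_scaleR pw_right mult.commute)
qed

lemma pw_cone: 
  assumes "x \<in> eigen_cone f v \<delta>"
  shows "fst (apow w k) *v x \<in> eigen_cone f v \<delta>"
proof -
  have "norm (fst (apow w k) *v x - (\<mu> ^ k * (f \<bullet> x)) *\<^sub>R v) \<le>
      (\<mu> / 2) ^ k * norm (x - (f \<bullet> x) *\<^sub>R v)"
    by (rule pw_remainder)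
  also have "\<dots> \<le> \<mu> ^ k * (\<delta> * (f \<bullet> x))"
    using assms \<mu>_pos by (intro mult_mono power_mono) (auto simp: eigen_cone_def)
  finally show ?thesis by (simp add: eigen_cone_def pw_left mult.left_commute)
qed

lemma norm_remainder: "norm (x - (f \<bullet> x) *\<^sub>R v) \<le> (1 + norm f * norm v) * norm x"
proof -
  have "norm (x - (f \<bullet> x) *\<^sub>R v) \<le> norm x + \<bar>f \<bullet> x\<bar> * norm v"
    using norm_triangle_ineq4[of x "(f \<bullet> x) *\<^sub>R v"] by simp
  also have "\<dots> \<le> norm x + norm f * norm x * norm v"
    by (intro add_left_mono mult_right_mono Cauchy_Schwarz_ineq2) simp
  finally show ?thesis by (simp add: algebra_simps)
qed

lemma \<mu>_less_1: "\<mu> < 1"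
proof -
  have "v \<noteq> 0" using fv by auto
  have "\<mu> * norm v \<le> ratio ^ Suc n * norm v"
    using norm_words[OF w, of v] \<mu>_pos by (simp add: right)
  then have "\<mu> \<le> ratio ^ Suc n" using \<open>v \<noteq> 0\<close> by simp
  also have "\<dots> \<le> ratio ^ 1" by (rule power_decreasing) (use ratio in auto)
  finally show ?thesis using ratio(2) by simp
qed

lemma p_ball: "p \<in> cball 0 radius"
  using p radius(2) by blast

lemma pw_act_close: "q \<in> cball 0 radius \<Longrightarrow>
    norm (act (apow w k) q - p) \<le> ratio ^ k * (2 * radius)"
proof -
  assume q: "q \<in> cball 0 radius"
  have "norm (act (apow w k) q - p) = norm (fst (apow w k) *v (q - p))"
    using act_diff[of "apow w k" q p] by (simp add: pw_fixes)
  also have "\<dots> \<le> ratio ^ k * norm (q - p)" by (rule pw_norm)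
  also have "norm (q - p) \<le> 2 * radius"
    using norm_triangle_ineq4[of q p] q p_ball by simp
  finally show ?thesis using ratio by (simp add: mult_left_mono)
qed

text \<open>A high power of \<open>w\<close> maps the whole ball close to its fixed point
  \<open>p\<close>. Whatever \<open>r\<close> is appended, \<open>p\<close> is therefore sent near
  \<open>act t p\<close>, and the displacement keeps its sign.\<close>

lemma inner_act_close:
  assumes "t \<in> semigroup" "f \<bullet> (act t p - p) \<noteq> 0"
  shows "\<exists>k0. \<forall>k\<ge>k0. \<forall>r\<in>semigroup.
      f \<bullet> (act (t \<odot> apow w k \<odot> r) p - p) \<noteq> 0 \<and>
    sgn (f \<bullet> (act (t \<odot> apow w k \<odot> r) p - p)) = sgn (f \<bullet> (act t p - p))"
proof -
  have "f \<noteq> 0" using fv by auto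
  define \<epsilon> where "\<epsilon> = \<bar>f \<bullet> (act t p - p)\<bar> / norm f"
  have "\<epsilon> > 0" using assms(2) \<open>f \<noteq> 0\<close> by (simp add: \<epsilon>_def)
  then obtain k0 where k0: "\<forall>k\<ge>k0. ratio ^ k * (2 * radius) < \<epsilon>"
      using ratio_power_small by blast
  show ?thesis
  proof (intro exI[of _ k0] allI impI ballI)
    fix k r assume k: "k0 \<le> k" and r: "r \<in> semigroup"
    have "norm (act (t \<odot> apow w k \<odot> r) p - act t p) \<le> norm (act (apow w k) (act r p) - p)"
      by (simp add: act_diff norm_semigroup assms(1))
    also have "\<dots> < \<epsilon>" using pw_act_close[OF act_ball[OF r p_ball], of k] k0 k by fastforce
    finally have "norm f * norm (act (t \<odot> apow w k \<odot> r) p - act t p) < norm f * \<epsilon>"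
      using \<open>f \<noteq> 0\<close> by simp
    then have "\<bar>f \<bullet> (act (t \<odot> apow w k \<odot> r) p
        - act t p)\<bar> < \<bar>f \<bullet> (act t p - p)\<bar>"
      using Cauchy_Schwarz_ineq2[of f "act (t \<odot> apow w k \<odot> r) p
          - act t p"] \<open>f \<noteq> 0\<close>
      by (simp add: \<epsilon>_def)
    moreover have "f \<bullet> (act (t \<odot> apow w k \<odot> r) p - p) =
        f \<bullet> (act (t \<odot> apow w k \<odot> r) p - act t p) + f \<bullet> (act t p - p)"
      by (simp add: inner_diff_right)
    ultimately show "f \<bullet> (act (t \<odot> apow w k \<odot> r) p - p) \<noteq> 0 \<and>
        sgn (f \<bullet> (act (t \<odot> apow w k \<odot> r) p - p)) = sgn (f \<bullet> (act t p - p))"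
      by (auto simp: sgn_if abs_if split: if_splits)
  qed
qed

text \<open>Both quantities are first made nonzero: \<open>t1\<close> displaces \<open>p\<close>,
  and after padding with \<open>w\<close> a suffix \<open>r\<close> gives \<open>v\<close> a nonzero
  height, which exists because the orbit of \<open>v\<close> spans. The sign of the height is then
  corrected by squaring: the word read twice, with a high power of \<open>w\<close> between, has
  height close to \<open>\<mu> ^ k\<close> times the square of \<open>\<gamma>\<close>.\<close>

lemma good_word:
  assumes span: "span ((\<lambda>g. fst g *v v) ` semigroup) = UNIV"
  shows "\<exists>t\<in>semigroup. 0 < f \<bullet> (fst t *v v) \<and> f \<bullet> (act t p - p) \<noteq> 0"
proof -
  have "f \<noteq> 0" using fv by auto
  then obtain t1 where t1: "t1 \<in> semigroup" "f \<bullet> (act t1 p - p) \<noteq> 0"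
    using act_not_constant[OF p_ball] by blast
  obtain k where k: "\<forall>r\<in>semigroup.
      f \<bullet> (act (t1 \<odot> apow w k \<odot> r) p - p) \<noteq> 0"
    using inner_act_close[OF t1] by blast
  define u where "u = t1 \<odot> apow w k"
  have u: "u \<in> semigroup" using t1 pw_semigroup by (simp add: u_def semigroup_amult)
  have "\<exists>r\<in>semigroup. f \<bullet> (fst u *v (fst r *v v)) \<noteq> 0"
  proof (rule ccontr)
    assume "\<not> ?thesis"
    then have "(\<lambda>g. fst g *v v) ` semigroup \<subseteq> {x. (f v* fst u) \<bullet> x = 0}"
      by (auto simp: dot_lmul_matrix)
    then have "span ((\<lambda>g. fst g *v v) ` semigroup) \<subseteq> {x. (f v* fst u) \<bullet> x = 0}"
      by (rule span_minimal[OF _ subspace_hyperplane])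
    then have *: "f \<bullet> (fst u *v x) = 0" for x using span by (auto simp: dot_lmul_matrix)
    obtain A' where "fst u ** A' = mat 1" using invertible_semigroup[OF u] invertible_def by blast
    then have "fst u *v (A' *v f) = f" by (simp add: matrix_vector_mul_assoc)
    then show False using *[of "A' *v f"] \<open>f \<noteq> 0\<close> by simp
  qed
  then obtain r where r: "r \<in> semigroup" "f \<bullet> (fst u *v (fst r *v v)) \<noteq> 0" by blast
  define t2 where "t2 = u \<odot> r"
  have t2: "t2 \<in> semigroup" "f \<bullet> (act t2 p - p) \<noteq> 0" "f \<bullet> (fst t2 *v v) \<noteq> 0"
    using u r k by (auto simp: t2_def u_def semigroup_amult matrix_vector_mul_assoc)
  define \<gamma> where "\<gamma> = f \<bullet> (fst t2 *v v)"
  obtain k0 where k0: "\<forall>k\<ge>k0. f \<bullet> (act (t2 \<odot> apow w k \<odot> t2) p - p) \<noteq> 0"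
    using inner_act_close[OF t2(1,2)] t2(1) by blast
  define C where "C = norm f * norm (fst t2 *v v - \<gamma> *\<^sub>R v)"
  have "(\<lambda>k. (1/2) ^ k * C) \<longlonglongrightarrow> 0 * C"
    by (intro tendsto_mult tendsto_const LIMSEQ_power_zero) simp
  then have "\<forall>\<^sub>F k in sequentially. (1/2) ^ k * C < \<gamma>\<^sup>2"
    using t2(3) by (simp add: order_tendstoD \<gamma>_def)
  then obtain k1 where k1: "\<forall>k\<ge>k1. (1/2) ^ k * C < \<gamma>\<^sup>2"
      by (auto simp: eventually_sequentially)
  define k where "k = max k0 k1"
  define t where "t = t2 \<odot> apow w k \<odot> t2"
  have "f \<bullet> (act t p - p) \<noteq> 0" using k0 by (simp add: t_def k_def)
  moreover have "t \<in> semigroup" using t2 pw_semigroup by (simp add: t_def semigroup_amult)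
  moreover have "0 < f \<bullet> (fst t *v v)"
  proof -
    let ?x = "fst (apow w k) *v (fst t2 *v v)"
    have "norm (?x - (\<mu> ^ k * \<gamma>) *\<^sub>R v) \<le>
        (\<mu> / 2) ^ k * norm (fst t2 *v v - \<gamma> *\<^sub>R v)"
      using pw_remainder[of k "fst t2 *v v"] by (simp add: \<gamma>_def)
    then have "norm (fst t2 *v (?x - (\<mu> ^ k * \<gamma>) *\<^sub>R v)) \<le>
        (\<mu> / 2) ^ k * norm (fst t2 *v v - \<gamma> *\<^sub>R v)"
      using norm_semigroup[OF t2(1)] order_trans by blast
    then have "norm f * norm (fst t2 *v (?x - (\<mu> ^ k * \<gamma>) *\<^sub>R v)) \<le>
        norm f * ((\<mu> / 2) ^ k * norm (fst t2 *v v - \<gamma> *\<^sub>R v))"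
      by (rule mult_left_mono) simp
    then have "\<bar>f \<bullet> (fst t2 *v (?x - (\<mu> ^ k * \<gamma>) *\<^sub>R v))\<bar> \<le>
        norm f * ((\<mu> / 2) ^ k * norm (fst t2 *v v - \<gamma> *\<^sub>R v))"
      using Cauchy_Schwarz_ineq2 order_trans by blast
    also have "\<dots> = \<mu> ^ k * ((1/2) ^ k * C)" by (simp add: C_def power_divide)
    also have "\<dots> < \<mu> ^ k * \<gamma>\<^sup>2" using k1 \<mu>_pos by (simp add: k_def)
    finally have "\<bar>f \<bullet> (fst t2 *v (?x
        - (\<mu> ^ k * \<gamma>) *\<^sub>R v))\<bar> < \<mu> ^ k * \<gamma>\<^sup>2" .
    moreover have "f \<bullet> (fst t2 *v (?x - (\<mu> ^ k * \<gamma>) *\<^sub>R v)) =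
        f \<bullet> (fst t *v v) - \<mu> ^ k * \<gamma>\<^sup>2"
      by (simp add: t_def matrix_vector_mult_diff_distrib matrix_vector_mult_scaleR inner_diff_right
          matrix_vector_mul_assoc matrix_mul_assoc power2_eq_square \<gamma>_def)
    ultimately show ?thesis by linarith
  qed
  ultimately show ?thesis by blast
qed

text \<open>The word is \<open>t\<close> between two high powers of \<open>w\<close>. The power
  acting before \<open>t\<close> aligns a cone vector with \<open>v\<close>, so that
  \<open>t\<close> keeps its height positive; the power acting after it narrows the aperture and
  makes the height small. The latter power also aligns the displacement of \<open>p\<close>.\<close>

lemma excursion_word:
  assumes t: "t \<in> semigroup" "0 < f \<bullet> (fst t *v v)" "0 < f \<bullet> (act t p - p)"
    and \<epsilon>: "0 < \<epsilon>" "\<epsilon> \<le> 1"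
  shows "\<exists>s\<in>semigroup. \<exists>\<eta>>0.
      act s p - p \<in> eigen_cone f v (\<epsilon> / 4) \<and> 0 < f \<bullet> (act s p - p) \<and>
    (\<forall>x\<in>eigen_cone f v \<epsilon>. fst s *v x \<in> eigen_cone f v (\<epsilon> / 4) \<and>
        \<eta> * (f \<bullet> x) \<le> f \<bullet> (fst s *v x) \<and>
      f \<bullet> (fst s *v x) \<le> (f \<bullet> x) / 4)"
proof -
  define \<gamma> where "\<gamma> = f \<bullet> (fst t *v v)"
  define r where "r = act t p - p"
  define V where "V = norm v"
  define Q where "Q = 1 + norm f * V"
  have Vpos: "0 \<le> V" "0 < Q" by (auto simp: V_def Q_def intro!: add_pos_nonneg)
  have small: "\<forall>\<^sub>F k in sequentially. q ^ k * C < e"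
      if "0 < q" "q < 1" "0 < e" for q C e :: real
  proof -
    have "(\<lambda>k. q ^ k * C) \<longlonglongrightarrow> 0 * C"
      by (intro tendsto_mult tendsto_const LIMSEQ_power_zero) (use that in simp)
    then show ?thesis using that by (simp add: order_tendstoD)
  qed
  have "\<forall>\<^sub>F k in sequentially. (1/2) ^ k * (norm r * Q) < \<epsilon> / 4 * (f \<bullet> r)
    \<and> (1/2) ^ k * norm f < \<gamma> / 2 \<and>
        (1/2) ^ k * ((V + 1) * Q) < \<epsilon> / 4 * (\<gamma> / 2)
    \<and> \<mu> ^ k * (norm f * (V + 1)) < 1 / 4"
    by (intro eventually_conj small) (use t \<epsilon> \<mu>_pos \<mu>_less_1 in \<open>auto simp:
        r_def \<gamma>_def\<close>)
  \<comment> \<open>In this order the conditions serve the cone of the displacement, the positive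
    height after \<open>t\<close>, the aperture of the image, and the factor 1/4 of the
    heights.\<close>
  then obtain K where K: "(1/2) ^ K * (norm r * Q) < \<epsilon> / 4 * (f \<bullet> r)"
    "(1/2) ^ K * norm f < \<gamma> / 2" "(1/2) ^ K * ((V + 1) * Q) < \<epsilon> / 4 * (\<gamma> / 2)"
    "\<mu> ^ K * (norm f * (V + 1)) < 1 / 4"
    by (auto simp: eventually_sequentially)
  define u where "u = apow w K"
  define s where "s = u \<odot> t \<odot> u"
  define m where "m = \<mu> ^ K"
  have m: "0 < m" "m \<le> 1" using \<mu>_pos \<mu>_less_1 by (auto simp: m_def power_le_one)
  have half: "(\<mu> / 2) ^ K = m * (1/2) ^ K" by (simp add: m_def power_divide)
  have s: "s \<in> semigroup" using t pw_semigroup by (simp add: s_def u_def semigroup_amult)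
  have a1: "act s p - p = fst u *v r"
    using act_diff[of u "act t p" p] pw_fixes[of K] by (simp add: s_def u_def r_def)
  have fa1: "f \<bullet> (act s p - p) = m * (f \<bullet> r)" by (simp add: a1 u_def pw_left m_def)
  have "norm (fst u *v r - (m * (f \<bullet> r)) *\<^sub>R v) \<le>
      m * (1/2) ^ K * norm (r - (f \<bullet> r) *\<^sub>R v)"
    using pw_remainder[of K r] by (simp add: u_def m_def half[unfolded m_def])
  also have "\<dots> \<le> m * (1/2) ^ K * (Q * norm r)"
    using m norm_remainder[of r] by (intro mult_left_mono) (auto simp: Q_def V_def)
  also have "\<dots> = m * ((1/2) ^ K * (norm r * Q))" by simp
  also have "\<dots> \<le> m * (\<epsilon> / 4 * (f \<bullet> r))" using m K(1) by (intro mult_left_mono) auto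
  finally have a1_cone: "act s p - p \<in> eigen_cone f v (\<epsilon> / 4)"
    unfolding eigen_cone_def mem_Collect_eq fa1 by (simp add: a1 mult.left_commute)
  have img: "fst s *v x \<in> eigen_cone f v (\<epsilon> / 4) \<and>
      m\<^sup>2 * (\<gamma> / 2) * (f \<bullet> x) \<le> f \<bullet> (fst s *v x) \<and>
      f \<bullet> (fst s *v x) \<le> (f \<bullet> x) / 4" if x: "x \<in> eigen_cone f v \<epsilon>" for x
  proof -
    define \<phi> where "\<phi> = f \<bullet> x"
    have \<phi>: "0 \<le> \<phi>" using cone_inner_nonneg x \<epsilon> by (auto simp: \<phi>_def)
    define z where "z = fst u *v x"
    define y where "y = fst t *v z"
    have z_cone: "z \<in> eigen_cone f v \<epsilon>" using pw_cone x by (auto simp: z_def u_def)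
    have fz: "f \<bullet> z = m * \<phi>" by (simp add: z_def u_def pw_left m_def \<phi>_def)
    have nz: "norm z \<le> (V + 1) * (m * \<phi>)"
        using norm_cone[OF z_cone] \<epsilon> fz by (simp add: V_def)
    have ny: "norm y \<le> (V + 1) * (m * \<phi>)"
      using norm_semigroup[OF t(1), of z] nz by (simp add: y_def)
    have rem_z: "norm (z - (m * \<phi>) *\<^sub>R v) \<le> m * (1/2) ^ K * \<phi>"
    proof -
      have "norm (z - (m * \<phi>) *\<^sub>R v) \<le> m * (1/2) ^ K * norm (x - \<phi> *\<^sub>R v)"
        using pw_remainder[of K x] by (simp add: z_def u_def m_def \<phi>_def half[unfolded m_def])
      also have "\<dots> \<le> m * (1/2) ^ K * (1 * \<phi>)"
      proof (intro mult_left_mono)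
        have "norm (x - \<phi> *\<^sub>R v) \<le> \<epsilon> * \<phi>"
            using x by (simp add: eigen_cone_def \<phi>_def)
        also have "\<dots> \<le> 1 * \<phi>" using \<epsilon> \<phi> by (intro mult_right_mono) auto
        finally show "norm (x - \<phi> *\<^sub>R v) \<le> 1 * \<phi>" .
      qed (use m in auto)
      finally show ?thesis by simp
    qed
    have "f \<bullet> y = m * \<phi> * \<gamma> + f \<bullet> (fst t *v (z - (m * \<phi>) *\<^sub>R v))"
      by (simp add: y_def matrix_vector_mult_diff_distrib matrix_vector_mult_scaleR inner_diff_right
          \<gamma>_def)
    moreover have "\<bar>f \<bullet> (fst t *v (z - (m * \<phi>) *\<^sub>R v))\<bar> \<le>
        m * \<phi> * (\<gamma> / 2)"
    proof -
      have "\<bar>f \<bullet> (fst t *v (z - (m * \<phi>) *\<^sub>R v))\<bar> \<le>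
          norm f * norm (fst t *v (z - (m * \<phi>) *\<^sub>R v))"
        by (rule Cauchy_Schwarz_ineq2)
      also have "\<dots> \<le> norm f * (m * (1/2) ^ K * \<phi>)"
        using norm_semigroup[OF t(1)] rem_z order_trans by (intro mult_left_mono) (blast, simp)
      also have "\<dots> = m * \<phi> * ((1/2) ^ K * norm f)" by simp
      also have "\<dots> \<le> m * \<phi> * (\<gamma> / 2)" using m \<phi> K(2) by (intro mult_left_mono) auto
      finally show ?thesis .
    qed
    ultimately have fy: "m * \<phi> * (\<gamma> / 2) \<le> f \<bullet> y"
        by (simp add: field_simps abs_le_iff)
    have sx: "fst s *v x = fst u *v y"
      by (simp add: s_def y_def z_def matrix_vector_mul_assoc matrix_mul_assoc)
    have fs: "f \<bullet> (fst s *v x) = m * (f \<bullet> y)" by (simp add: sx u_def pw_left m_def)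
    have "norm (fst s *v x - (f \<bullet> (fst s *v x)) *\<^sub>R v) \<le>
        m * (1/2) ^ K * norm (y - (f \<bullet> y) *\<^sub>R v)"
      unfolding fs unfolding sx using pw_remainder[of K y] by (simp add: u_def m_def half[unfolded m_def])
    also have "\<dots> \<le> m * (1/2) ^ K * (Q * ((V + 1) * (m * \<phi>)))"
    proof (intro mult_left_mono)
      have "norm (y - (f \<bullet> y) *\<^sub>R v) \<le> Q * norm y"
          using norm_remainder[of y] by (simp add: Q_def V_def)
      also have "\<dots> \<le> Q * ((V + 1) * (m * \<phi>))" using ny Vpos by (intro mult_left_mono) auto
      finally show "norm (y - (f \<bullet> y) *\<^sub>R v) \<le> Q * ((V + 1) * (m * \<phi>))" .
    qed (use m in auto)
    also have "\<dots> = m * (m * \<phi>) * ((1/2) ^ K * ((V + 1) * Q))" by simp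
    also have "\<dots> \<le> m * (m * \<phi>) * (\<epsilon> / 4 * (\<gamma> / 2))"
        using K(3) m \<phi> by (intro mult_left_mono) auto
    also have "\<dots> = \<epsilon> / 4 * (m * (m * \<phi> * (\<gamma> / 2)))" by simp
    also have "\<dots> \<le> \<epsilon> / 4 * (f \<bullet> (fst s *v x))"
      unfolding fs using fy m \<epsilon> by (intro mult_left_mono) auto
    finally have c: "fst s *v x \<in> eigen_cone f v (\<epsilon> / 4)" by (simp add: eigen_cone_def)
    have lower: "m\<^sup>2 * (\<gamma> / 2) * \<phi> \<le> f \<bullet> (fst s *v x)"
      unfolding fs using mult_left_mono[OF fy, of m] m by (simp add: power2_eq_square mult_ac)
    have "f \<bullet> (fst s *v x) \<le> m * (norm f * norm y)"
      unfolding fs using m norm_cauchy_schwarz[of f y] by (intro mult_left_mono) auto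
    also have "\<dots> \<le> m * (norm f * ((V + 1) * (1 * \<phi>)))"
    proof (intro mult_left_mono)
      have "(V + 1) * (m * \<phi>) \<le> (V + 1) * (1 * \<phi>)"
        using m \<phi> Vpos by (intro mult_left_mono mult_right_mono) auto
      then show "norm y \<le> (V + 1) * (1 * \<phi>)" using ny by linarith
    qed (use m in auto)
    also have "\<dots> = m * (norm f * (V + 1)) * \<phi>" by simp
    also have "\<dots> \<le> 1 / 4 * \<phi>" using K(4) \<phi> by (intro mult_right_mono) (auto simp: m_def)
    finally show ?thesis using c lower by (simp add: \<phi>_def)
  qed
  have "0 < m\<^sup>2 * (\<gamma> / 2)" using m t by (simp add: \<gamma>_def)
  moreover have "0 < f \<bullet> (act s p - p)" unfolding fa1 using m t by (simp add: r_def)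
  ultimately show ?thesis using s a1_cone img by blast
qed

definition cone_word :: "real \<Rightarrow> (real^'n^'n) \<times> (real^'n) \<Rightarrow> bool" where
  "cone_word \<epsilon> g \<longleftrightarrow> g \<in> semigroup \<and>
      (\<forall>x\<in>eigen_cone f v \<epsilon>. fst g *v x \<in> eigen_cone f v \<epsilon>)"

lemma cone_word_amult: "cone_word \<epsilon> g \<Longrightarrow>
    cone_word \<epsilon> h \<Longrightarrow> cone_word \<epsilon> (g \<odot> h)"
  by (auto simp: cone_word_def semigroup_amult matrix_vector_mul_assoc[symmetric])

lemma cone_word_pw: "cone_word \<epsilon> (apow w k)"
  by (simp add: cone_word_def pw_semigroup pw_cone)

text \<open>
  The cone orders the space and its words act monotonically.  This compares \<open>f\<close> on the images of
  different cone vectors although no bound on the operator norm of the word is known.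
\<close>

lemma cone_word_mono:
  assumes "cone_word \<epsilon> g" "0 < \<epsilon>" "x - y \<in> eigen_cone f v \<epsilon>"
  shows "f \<bullet> (fst g *v y) \<le> f \<bullet> (fst g *v x)"
proof -
  have "fst g *v (x - y) \<in> eigen_cone f v \<epsilon>" using assms by (simp add: cone_word_def)
  then have "0 \<le> f \<bullet> (fst g *v (x - y))" by (rule cone_inner_nonneg) (rule assms)
  then show ?thesis by (simp add: matrix_vector_mult_diff_distrib inner_diff_right)
qed

text \<open>One more \<open>w\<close> costs at most the factor \<open>\<mu> / 4\<close>, although
  \<open>g\<close> is arbitrary: \<open>fst w *v x\<close> dominates
  \<open>(\<mu> / 4) *\<^sub>R x\<close> in the order of the cone, and cone words are
  monotone.\<close>

lemma calibrated_extension: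
  assumes g: "cone_word \<epsilon> g" and \<epsilon>: "0 < \<epsilon>"
      and x: "x \<in> eigen_cone f v (\<epsilon> / 4)"
    and t: "0 < t" "\<mu> / 4 * t \<le> f \<bullet> (fst g *v x)"
  shows "\<exists>m. \<mu> / 4 * t \<le> f \<bullet> (fst (g \<odot> apow w m) *v x) \<and>
      f \<bullet> (fst (g \<odot> apow w m) *v x) \<le> t"
proof (rule calibrate[OF t(1)])
  show "\<mu> / 4 * t \<le> f \<bullet> (fst (g \<odot> apow w 0) *v x)" using t(2) by simp
  show "0 < \<mu> / 4" using \<mu>_pos by simp
  have xnn: "0 \<le> f \<bullet> x" using cone_inner_nonneg[OF x] \<epsilon> by simp
  show "\<mu> / 4 * (f \<bullet> (fst (g \<odot> apow w m) *v x)) \<le>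
      f \<bullet> (fst (g \<odot> apow w (Suc m)) *v x)" for m
  proof -
    have wx: "fst w *v x \<in> eigen_cone f v (\<epsilon> / 4)" using pw_cone[OF x, of 1] by simp
    have "(\<mu> / 4) *\<^sub>R x \<in> eigen_cone f v (\<epsilon> / 4)"
        using x \<mu>_pos by (intro cone_scaleR) auto
    then have "fst w *v x - (\<mu> / 4) *\<^sub>R x \<in> eigen_cone f v \<epsilon>"
      using wx \<epsilon> xnn \<mu>_pos by (intro cone_diff) (auto simp: left)
    then have "f \<bullet> (fst (g \<odot> apow w m) *v ((\<mu> / 4) *\<^sub>R x)) \<le>
        f \<bullet> (fst (g \<odot> apow w m) *v (fst w *v x))"
      by (rule cone_word_mono[OF cone_word_amult[OF g cone_word_pw] \<epsilon>])
    then show ?thesis by (simp add: matrix_vector_mult_scaleR matrix_vector_mul_assoc matrix_mul_assoc)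
  qed
  show "(\<lambda>m. f \<bullet> (fst (g \<odot> apow w m) *v x)) \<longlonglongrightarrow> 0"
  proof (rule Lim_null_comparison)
    show "\<forall>\<^sub>F m in sequentially. norm (f \<bullet> (fst (g \<odot> apow w m) *v x)) \<le>
        ratio ^ m * (norm f * norm x)"
    proof (rule always_eventually, rule allI)
      fix m
      have "norm (fst (g \<odot> apow w m) *v x) \<le> norm (fst (apow w m) *v x)"
        using norm_semigroup[of g "fst (apow w m) *v x"] g
        by (simp add: cone_word_def matrix_vector_mul_assoc)
      also have "\<dots> \<le> ratio ^ m * norm x" by (rule pw_norm)
      finally have "norm f * norm (fst (g \<odot> apow w m) *v x) \<le> norm f * (ratio ^ m * norm x)"
        by (intro mult_left_mono) auto
      then show "norm (f \<bullet> (fst (g \<odot> apow w m) *v x)) \<le> ratio ^ m * (norm f * norm x)"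
        using Cauchy_Schwarz_ineq2[of f "fst (g \<odot> apow w m) *v x"] by (simp add: mult_ac)
    qed
    have "(\<lambda>m. ratio ^ m * (norm f * norm x)) \<longlonglongrightarrow> 0 * (norm f * norm x)"
      by (intro tendsto_mult tendsto_const LIMSEQ_power_zero) (use ratio in simp)
    then show "(\<lambda>m. ratio ^ m * (norm f * norm x)) \<longlonglongrightarrow> 0" by simp
  qed
qed

text \<open>The base point is the midpoint of \<open>p\<close> and \<open>act s p\<close>. Appending
  \<open>s\<close> and a power of \<open>w\<close> sends it towards \<open>act s p\<close>,
  appending powers of \<open>w\<close> alone sends it towards \<open>p\<close>; so moves of both
  signs exist, both close to the direction of \<open>v\<close>. The height
  \<open>f \<bullet> (fst g *v a1)\<close> serves as the size of \<open>g\<close>; further powers of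
  \<open>w\<close> bring it into the window of the next scale, with the same \<open>\<theta>\<close>
  for all \<open>g\<close>.\<close>

lemma copy_step:
  assumes s: "s \<in> semigroup" and \<epsilon>: "0 < \<epsilon>" "\<epsilon> \<le>
      1" and \<eta>: "0 < \<eta>"
    and a1: "a1 = act s p - p" "a1 \<in> eigen_cone f v (\<epsilon> / 4)" "0 < f \<bullet> a1"
    and img: "\<And>x. x \<in> eigen_cone f v \<epsilon> \<Longrightarrow>
        fst s *v x \<in> eigen_cone f v (\<epsilon> / 4) \<and>
      \<eta> * (f \<bullet> x) \<le> f \<bullet> (fst s *v x) \<and>
          f \<bullet> (fst s *v x) \<le> (f \<bullet> x) / 4"
    and b: "b = p + (1/2) *\<^sub>R a1"
  shows "\<exists>\<theta>>0. \<theta> < 1 \<and> (\<forall>g t. 0 < t \<and>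
      cone_word \<epsilon> g \<and> \<mu> / 4 * t \<le> f \<bullet> (fst g *v a1) \<and>
      f \<bullet> (fst g *v a1) \<le> t \<longrightarrow>
    (\<forall>\<sigma>\<in>{1, -1}. \<exists>h \<delta>. h \<in> semigroup \<and>
        cone_word \<epsilon> (g \<odot> h) \<and>
      \<mu> / 4 * (\<theta> * t) \<le> f \<bullet> (fst (g \<odot> h) *v a1) \<and>
          f \<bullet> (fst (g \<odot> h) *v a1) \<le> (\<theta> * t) \<and>
      \<delta> \<in> eigen_cone f v \<epsilon> \<and> \<mu> / 16 \<le> f \<bullet> \<delta> \<and>
          f \<bullet> \<delta> \<le> 1 \<and>
      act (g \<odot> h) b = act g b + (\<sigma> * t) *\<^sub>R \<delta>))"
proof -
  have e4: "0 < \<epsilon> / 4" "\<epsilon> / 4 \<le> \<epsilon>" using \<epsilon> by auto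
  have a1_cone: "a1 \<in> eigen_cone f v \<epsilon>" using cone_mono a1(2) e4 by blast
  have "(\<lambda>k. \<mu> ^ k) \<longlonglongrightarrow> 0"
      using \<mu>_pos \<mu>_less_1 by (intro LIMSEQ_power_zero) simp
  then have "\<forall>\<^sub>F k in sequentially. \<mu> ^ k < 1 / 4" by (rule order_tendstoD(2)) simp
  \<comment> \<open>This initial power shortens \<open>a1\<close> below a quarter of its height, so
    that the backward move, half of \<open>a1 - y\<close>, stays in the cone and keeps a quarter of
    the size of \<open>g\<close>, whatever power follows.\<close>
  then obtain n0 where n0: "\<mu> ^ n0 < 1 / 4" by (auto simp: eventually_sequentially)
  \<comment> \<open>The first two bounds ensure that either continuation leaves the size above the
    lower end of the next window, the starting condition for calibration.\<close>
  define \<theta> where "\<theta> = min (\<eta> / 2) (min (\<mu> ^ n0 / 2) (1 / 2))"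
  have \<theta>: "0 < \<theta>" "\<theta> < 1" "2 * \<theta> \<le> \<eta>" "2 * \<theta> \<le> \<mu> ^ n0"
    using \<eta> \<mu>_pos by (auto simp: \<theta>_def min_def)
  have sc: "cone_word \<epsilon> s"
    using s img cone_mono[OF _ e4(1,2)] by (auto simp: cone_word_def)
  have ext: "\<exists>m. \<mu> / 4 * (\<theta> * t) \<le>
      f \<bullet> (fst (g \<odot> h \<odot> apow w m) *v a1) \<and>
      f \<bullet> (fst (g \<odot> h \<odot> apow w m) *v a1) \<le> \<theta> * t"
    if g: "cone_word \<epsilon> g" "\<mu> / 4 * t \<le>
        f \<bullet> (fst g *v a1)" and h: "cone_word \<epsilon> h"
      "fst h *v a1 \<in> eigen_cone f v (\<epsilon> / 4)" "2 * \<theta> * (f \<bullet> a1) \<le>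
          f \<bullet> (fst h *v a1)" and t: "0 < t" for g h t
  proof (rule calibrated_extension[OF cone_word_amult[OF g(1) h(1)] \<epsilon>(1) a1(2)])
    show "0 < \<theta> * t" using \<theta> t by simp
    have "fst h *v a1 - \<theta> *\<^sub>R a1 \<in> eigen_cone f v \<epsilon>"
      using h \<epsilon> a1 \<theta> by (intro cone_diff cone_scaleR) auto
    then have "f \<bullet> (fst g *v (\<theta> *\<^sub>R a1)) \<le> f \<bullet> (fst g *v (fst h *v a1))"
      by (rule cone_word_mono[OF g(1) \<epsilon>(1)])
    moreover have "\<theta> * (\<mu> / 4 * t) \<le> \<theta> * (f \<bullet> (fst g *v a1))"
      using g(2) \<theta> by (intro mult_left_mono) auto
    ultimately show "\<mu> / 4 * (\<theta> * t) \<le> f \<bullet> (fst (g \<odot> h) *v a1)"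
      by (simp add: matrix_vector_mult_scaleR matrix_vector_mul_assoc mult_ac)
  qed
  have "\<exists>h \<delta>. h \<in> semigroup \<and> cone_word \<epsilon> (g \<odot> h) \<and>
      \<mu> / 4 * (\<theta> * t) \<le> f \<bullet> (fst (g \<odot> h) *v a1) \<and>
          f \<bullet> (fst (g \<odot> h) *v a1) \<le> (\<theta> * t) \<and>
      \<delta> \<in> eigen_cone f v \<epsilon> \<and> \<mu> / 16 \<le> f \<bullet> \<delta> \<and>
          f \<bullet> \<delta> \<le> 1 \<and> act (g \<odot> h) b =
          act g b + (\<sigma> * t) *\<^sub>R \<delta>"
    if g: "cone_word \<epsilon> g" "\<mu> / 4 * t \<le>
        f \<bullet> (fst g *v a1)" "f \<bullet> (fst g *v a1) \<le> t"
      and \<sigma>: "\<sigma> \<in> {1, -1}" and tk: "0 < t" for g t and \<sigma> :: real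
  proof -
    define N where "N = f \<bullet> (fst g *v a1)"
    have gsg: "g \<in> semigroup" using g(1) by (simp add: cone_word_def)
    have "\<exists>h d. h \<in> semigroup \<and> cone_word \<epsilon> (g \<odot> h) \<and>
      \<mu> / 4 * (\<theta> * t) \<le> f \<bullet> (fst (g \<odot> h) *v a1) \<and>
          f \<bullet> (fst (g \<odot> h) *v a1) \<le> (\<theta> * t) \<and>
      d \<in> eigen_cone f v \<epsilon> \<and> N / 4 \<le> f \<bullet> (fst g *v d) \<and>
          f \<bullet> (fst g *v d) \<le> N \<and>
      act h b = b + \<sigma> *\<^sub>R d"
    proof (cases "\<sigma> = 1")
      case True
      obtain m where m: "\<mu> / 4 * (\<theta> * t) \<le>
          f \<bullet> (fst (g \<odot> s \<odot> apow w m) *v a1)"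
        "f \<bullet> (fst (g \<odot> s \<odot> apow w m) *v a1) \<le> \<theta> * t"
        using ext[OF g(1,2) sc _ _ tk] img[OF a1_cone] \<theta>(3) a1(3)
        by (meson less_imp_le mult_right_mono order_trans)
      define h where "h = s \<odot> apow w m"
      define y where "y = fst h *v a1"
      have pa: "fst (apow w m) *v a1 \<in> eigen_cone f v \<epsilon>" by (rule pw_cone[OF a1_cone])
      have y4: "y \<in> eigen_cone f v (\<epsilon> / 4)"
          using img[OF pa] by (simp add: y_def h_def matrix_vector_mul_assoc)
      have "f \<bullet> y \<le> \<mu> ^ m * (f \<bullet> a1) / 4"
        using img[OF pa] by (simp add: y_def h_def pw_left matrix_vector_mul_assoc)
      also have "\<dots> \<le> 1 * (f \<bullet> a1) / 4"
        using \<mu>_pos \<mu>_less_1 a1(3) by (intro divide_right_mono mult_right_mono power_le_one) auto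
      finally have "2 * (f \<bullet> y) \<le> f \<bullet> a1" using a1(3) by simp
      then have "a1 - y \<in> eigen_cone f v \<epsilon>" using cone_diff[OF a1(2) y4 \<epsilon>(1)] by blast
      then have up: "f \<bullet> (fst g *v y) \<le> N" unfolding N_def
          by (rule cone_word_mono[OF g(1) \<epsilon>(1)])
      have y: "y \<in> eigen_cone f v \<epsilon>" using cone_mono[OF y4] e4 by blast
      then have low: "0 \<le> f \<bullet> (fst g *v y)"
        using g(1) \<epsilon>(1) by (auto simp: cone_word_def intro: cone_inner_nonneg)
      define d where "d = (1/2) *\<^sub>R (a1 + y)"
      have fd: "f \<bullet> (fst g *v d) = (N + f \<bullet> (fst g *v y)) / 2"
        by (simp add: d_def N_def matrix_vector_mult_scaleR matrix_vector_right_distrib inner_add_right)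
      have "act h b = act s (p + (1/2) *\<^sub>R (fst (apow w m) *v a1))"
        using act_diff[of "apow w m" b p] pw_fixes[of m]
        by (simp add: h_def b matrix_vector_mult_scaleR diff_eq_eq add.commute)
      also have "\<dots> = act s p + (1/2) *\<^sub>R y"
        using act_diff[of s "p + (1/2) *\<^sub>R (fst (apow w m) *v a1)" p]
        by (simp add: h_def y_def matrix_vector_mult_scaleR matrix_vector_mul_assoc diff_eq_eq add.commute)
      also have "\<dots> = b + \<sigma> *\<^sub>R d"
      proof -
        have "a1 = (1/2) *\<^sub>R a1 + (1/2) *\<^sub>R a1" by (simp flip: scaleR_add_left)
        then have "p + a1 = p + (1/2) *\<^sub>R a1 + (1/2) *\<^sub>R a1" by (simp add: add.assoc)
        moreover have "act s p = p + a1" by (simp add: a1(1))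
        ultimately show ?thesis by (simp add: True b d_def scaleR_add_right add.assoc)
      qed
      finally have "act h b = b + \<sigma> *\<^sub>R d" .
      moreover have "d \<in> eigen_cone f v \<epsilon>" unfolding d_def
          by (intro cone_scaleR cone_add a1_cone y) simp
      moreover have "0 \<le> N" using low up by linarith
      moreover have "h \<in> semigroup" "cone_word \<epsilon> (g \<odot> h)"
        using s pw_semigroup cone_word_amult[OF g(1) cone_word_amult[OF sc cone_word_pw]]
        by (auto simp: h_def semigroup_amult)
      ultimately show ?thesis using m fd up low
        by (intro exI[of _ h] exI[of _ d]) (auto simp: h_def amult_assoc matrix_mul_assoc)
    next
      case False
      then have \<sigma>1: "\<sigma> = -1" using \<sigma> by simp
      have p0: "fst (apow w n0) *v a1 \<in> eigen_cone f v (\<epsilon> / 4)" by (rule pw_cone[OF a1(2)])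
      obtain m where m: "\<mu> / 4 * (\<theta> * t) \<le>
          f \<bullet> (fst (g \<odot> apow w n0 \<odot> apow w m) *v a1)"
        "f \<bullet> (fst (g \<odot> apow w n0 \<odot> apow w m) *v a1) \<le> \<theta> * t"
        using ext[OF g(1,2) cone_word_pw p0 _ tk] \<theta>(4) a1(3)
        by (auto simp: pw_left mult_right_mono)
      define h where "h = apow w n0 \<odot> apow w m"
      define y where "y = fst h *v a1"
      have y4: "y \<in> eigen_cone f v (\<epsilon> / 4)"
        using pw_cone[OF pw_cone[OF a1(2)], of n0 m] by (simp add: y_def h_def matrix_vector_mul_assoc)
      have "f \<bullet> y = \<mu> ^ n0 * (\<mu> ^ m * (f \<bullet> a1))"
        by (simp add: y_def h_def pw_left matrix_vector_mul_assoc[symmetric])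
      also have "\<dots> \<le> 1 / 4 * (1 * (f \<bullet> a1))"
        using n0 \<mu>_pos \<mu>_less_1 a1(3) by (intro mult_mono power_le_one) auto
      finally have fy: "4 * (f \<bullet> y) \<le> f \<bullet> a1" by simp
      have "(1/2) *\<^sub>R a1 - y \<in> eigen_cone f v \<epsilon>"
        using a1 y4 \<epsilon> fy by (intro cone_diff cone_scaleR) auto
      then have up: "f \<bullet> (fst g *v y) \<le> N / 2"
        using cone_word_mono[OF g(1) \<epsilon>(1), of "(1/2) *\<^sub>R a1" y]
        by (simp add: N_def matrix_vector_mult_scaleR)
      have y: "y \<in> eigen_cone f v \<epsilon>" using cone_mono[OF y4] e4 by blast
      then have low: "0 \<le> f \<bullet> (fst g *v y)"
        using g(1) \<epsilon>(1) by (auto simp: cone_word_def intro: cone_inner_nonneg)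
      define d where "d = (1/2) *\<^sub>R (a1 - y)"
      have fd: "f \<bullet> (fst g *v d) = (N - f \<bullet> (fst g *v y)) / 2"
        by (simp add: d_def N_def matrix_vector_mult_scaleR matrix_vector_mult_diff_distrib inner_diff_right)
      have hp: "act h p = p" by (simp add: h_def pw_fixes)
      have "act h b = p + (1/2) *\<^sub>R y"
        using act_diff[of h b p] hp
        by (simp add: b y_def matrix_vector_mult_scaleR diff_eq_eq add.commute)
      also have "\<dots> = b + \<sigma> *\<^sub>R d" by (simp add: \<sigma>1 b d_def scaleR_diff_right)
      finally have "act h b = b + \<sigma> *\<^sub>R d" .
      moreover have "d \<in> eigen_cone f v \<epsilon>" unfolding d_def
        using cone_diff[OF a1(2) y4 \<epsilon>(1)] fy cone_inner_nonneg[OF y \<epsilon>(1)]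
            by (intro cone_scaleR) auto
      moreover have "0 \<le> N" using low up by linarith
      moreover have "h \<in> semigroup" "cone_word \<epsilon> (g \<odot> h)"
        using pw_semigroup cone_word_amult[OF g(1) cone_word_amult[OF cone_word_pw cone_word_pw]]
        by (auto simp: h_def semigroup_amult)
      ultimately show ?thesis using m fd up low
        by (intro exI[of _ h] exI[of _ d]) (auto simp: h_def amult_assoc matrix_mul_assoc)
    qed
    then obtain h d where hd: "h \<in> semigroup" "cone_word \<epsilon> (g \<odot> h)"
      "\<mu> / 4 * (\<theta> * t) \<le> f \<bullet> (fst (g \<odot> h) *v a1)"
          "f \<bullet> (fst (g \<odot> h) *v a1) \<le> \<theta> * t"
      "d \<in> eigen_cone f v \<epsilon>" "N / 4 \<le>
          f \<bullet> (fst g *v d)" "f \<bullet> (fst g *v d) \<le> N" "act h b = b + \<sigma> *\<^sub>R d"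
      by blast
    define \<delta> where "\<delta> = (1 / t) *\<^sub>R (fst g *v d)"
    have "fst g *v d \<in> eigen_cone f v \<epsilon>" using g(1) hd(5) by (simp add: cone_word_def)
    then have "\<delta> \<in> eigen_cone f v \<epsilon>" unfolding \<delta>_def
        by (rule cone_scaleR) (use tk in simp)
    moreover have "\<mu> / 16 * t \<le> f \<bullet> (fst g *v d)" "f \<bullet> (fst g *v d) \<le> t"
      using hd(6,7) g(2,3) by (auto simp: N_def)
    then have "\<mu> / 16 \<le> f \<bullet> \<delta>" "f \<bullet> \<delta> \<le> 1"
        using tk by (simp_all add: \<delta>_def field_simps)
    moreover have "act (g \<odot> h) b = act g b + (\<sigma> * t) *\<^sub>R \<delta>"
      using act_diff[of g "act h b" b] hd(8) tk
      by (simp add: \<delta>_def matrix_vector_mult_scaleR diff_eq_eq add.commute)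
    ultimately show ?thesis using hd(1-4) by (intro exI[of _ h] exI[of _ \<delta>]) auto
  qed
  then show ?thesis using \<theta>(1,2) by (intro exI[of _ \<theta>]) blast
qed

end

lemma matrix_vector_mult_uminus: "(A :: real^'n^'m) *v (- x) = - (A *v x)"
  using matrix_vector_mult_diff_distrib[of A 0 x] by simp

section \<open>From moves along one direction to thickness\<close>

context contracting_word
begin

text \<open>A single copy moves almost parallel to \<open>v\<close> only. So one copy is taken for
  each vector of a basis \<open>B\<close> from the orbit of \<open>v\<close>, with the prefix
  \<open>r \<beta>\<close> kept in front at all levels; its moves are nearly multiples of
  \<open>\<beta>\<close>, of freely chosen sign.\<close>

lemma thick_if_positive_word:
  assumes span: "span ((\<lambda>g. fst g *v v) ` semigroup) = UNIV"
    and t: "t \<in> semigroup" "0 < f \<bullet> (fst t *v v)" "0 < f \<bullet> (act t p - p)"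
  shows "arithmetically_thick E"
proof -
  obtain B where B: "B \<subseteq> (\<lambda>g. fst g *v v) ` semigroup" "independent B"
    "(\<lambda>g. fst g *v v) ` semigroup \<subseteq> span B"
    using maximal_independent_subset by blast
  have finB: "finite B" using B(2) independent_imp_finite by blast
  have spB: "span B = UNIV"
    using span_mono[OF B(3)] span unfolding span_span by blast
  have "\<forall>x\<in>B. \<exists>g. g \<in> semigroup \<and> fst g *v v = x" using B(1) by blast
  then obtain r where r: "\<And>x. x \<in> B \<Longrightarrow>
      r x \<in> semigroup" "\<And>x. x \<in> B \<Longrightarrow> fst (r x) *v v = x"
    by metis
  obtain c where c: "c > 0" "\<And>e. (\<Sum>x\<in>B. \<bar>e \<bullet> x\<bar>) \<ge> c * norm e"
    using spanning_sum_abs_inner_ge[OF finB spB] by blast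
  have Bne: "B \<noteq> {}"
  proof
    assume "B = {}"
    then have "v = 0" using spB by auto
    then show False using fv by simp
  qed
  then have cB: "card B \<ge> 1" using finB by (simp add: Suc_leI card_gt_0_iff)
  \<comment> \<open>Moves have height at least \<open>\<mu> / 16\<close>, which yields
    \<open>\<mu> * c / 16\<close> in total; with this aperture the deviations of all
    \<open>card B\<close> copies cost at most half of it.\<close>
  define \<epsilon> where "\<epsilon> = min 1 (\<mu> * c / (32 * card B))"
  have \<epsilon>: "0 < \<epsilon>" "\<epsilon> \<le> 1" "real (card B) * \<epsilon> \<le> \<mu> * c / 32"
  proof -
    show "0 < \<epsilon>" "\<epsilon> \<le> 1" using \<mu>_pos c(1) cB by (auto simp: \<epsilon>_def)
    have "\<epsilon> \<le> \<mu> * c / (32 * card B)" by (simp add: \<epsilon>_def)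
    then have "real (card B) * \<epsilon> \<le> real (card B) * (\<mu> * c / (32 * card B))"
      by (rule mult_left_mono) simp
    also have "\<dots> = \<mu> * c / 32" using cB by simp
    finally show "real (card B) * \<epsilon> \<le> \<mu> * c / 32" .
  qed
  obtain s \<eta> where s: "s \<in> semigroup" "0 < \<eta>"
      "act s p - p \<in> eigen_cone f v (\<epsilon> / 4)" "0 < f \<bullet> (act s p - p)"
    "\<And>x. x \<in> eigen_cone f v \<epsilon> \<Longrightarrow>
        fst s *v x \<in> eigen_cone f v (\<epsilon> / 4) \<and>
        \<eta> * (f \<bullet> x) \<le> f \<bullet> (fst s *v x) \<and>
      f \<bullet> (fst s *v x) \<le> (f \<bullet> x) / 4"
    using excursion_word[OF t \<epsilon>(1,2)] by blast
  define a1 where "a1 = act s p - p"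
  define b where "b = p + (1/2) *\<^sub>R a1"
  define N where "N g = f \<bullet> (fst g *v a1)" for g :: "(real^'n^'n) \<times> (real^'n)"
  define valid where "valid g \<tau> \<longleftrightarrow> cone_word \<epsilon> g \<and>
      \<mu> / 4 * \<tau> \<le> N g \<and> N g \<le> \<tau>" for g \<tau>
  obtain \<theta> where \<theta>: "0 < \<theta>" "\<theta> < 1" and step:
    "\<And>g \<tau> \<sigma>. 0 < \<tau> \<Longrightarrow> valid g \<tau> \<Longrightarrow>
        \<sigma> \<in> {1, -1} \<Longrightarrow> \<exists>h \<delta>. h \<in> semigroup \<and>
        valid (g \<odot> h) (\<theta> * \<tau>) \<and>
      \<delta> \<in> eigen_cone f v \<epsilon> \<and> \<mu> / 16 \<le> f \<bullet> \<delta> \<and>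
          f \<bullet> \<delta> \<le> 1 \<and> act (g \<odot> h) b =
          act g b + (\<sigma> * \<tau>) *\<^sub>R \<delta>"
    using copy_step[OF s(1) \<epsilon>(1,2) s(2) a1_def s(3,4)[folded a1_def] s(5) b_def]
    unfolding valid_def N_def by metis
  \<comment> \<open>The size of the empty word, so that level 0 starts inside its window.\<close>
  define \<kappa> where "\<kappa> = f \<bullet> a1"
  have \<kappa>: "0 < \<kappa>" using s(4) by (simp add: \<kappa>_def a1_def)
  define V where "V = norm v + 1"
  have V: "0 < V" by (simp add: V_def add_nonneg_pos)
  define G where "G k x = (\<kappa> * \<theta> ^ k) *\<^sub>R x" for k and x :: "real^'n"
  define P where "P k x \<longleftrightarrow> (\<exists>g. (\<forall>\<beta>\<in>B.
      valid (g \<beta>) (\<kappa> * \<theta> ^ k)) \<and>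
      x = (\<Sum>\<beta>\<in>B. act (r \<beta> \<odot> g \<beta>) b))" for k x
  have "\<exists>N\<ge>1. interior (sum_power N (sum_power (card B) E)) \<noteq> {}"
  proof (rule interior_sum_power_steered[where G = G and D = "(*\<^sub>R) \<theta>" and D' =
      "(*\<^sub>R) (1 / \<theta>)"
        and \<eta> = "\<lambda>k. \<kappa> * \<theta> ^ k" and P = P and h =
            "real (card B) * V" and c = "\<mu> * c / 32"])
    show "linear (G k)" for k unfolding G_def by (simp add: linear_iff algebra_simps)
    show "G (Suc k) x = G k (\<theta> *\<^sub>R x)" for k x by (simp add: G_def mult_ac)
    show "inj (G 0)" using \<kappa> by (simp add: G_def inj_on_def)
    show "linear ((*\<^sub>R) (1 / \<theta>) :: real^'n \<Rightarrow> real^'n)"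
        by (simp add: linear_iff algebra_simps)
    show "\<theta> *\<^sub>R (1 / \<theta>) *\<^sub>R x = x" for x :: "real^'n" using \<theta> by simp
    show "norm (G k x) \<le> \<kappa> * \<theta> ^ k * norm x" for k x
        using \<theta> \<kappa> by (simp add: G_def abs_mult)
    have "(\<lambda>k. \<kappa> * \<theta> ^ k) \<longlonglongrightarrow> \<kappa> * 0"
      by (intro tendsto_mult tendsto_const LIMSEQ_power_zero) (use \<theta> in simp)
    then show "(\<lambda>k. \<kappa> * \<theta> ^ k) \<longlonglongrightarrow> 0" by simp
    show "0 < \<mu> * c / 32" using \<mu>_pos c by simp
    show "compact (sum_power (card B) E)" by (rule compact_sum_power[OF compact_E])
    have "valid (mat 1, 0) (\<kappa> * \<theta> ^ 0)"
      using \<kappa> \<mu>_pos \<mu>_less_1 cone_word_pw[of \<epsilon> 0]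
          by (simp add: valid_def N_def \<kappa>_def)
    then show "P 0 (\<Sum>\<beta>\<in>B. act (r \<beta> \<odot> (mat 1, 0)) b)"
      unfolding P_def by (intro exI[of _ "\<lambda>_. (mat 1, 0)"]) simp
    show "\<exists>y\<in>sum_power (card B) E. norm (y - x) \<le>
        \<kappa> * \<theta> ^ k * (real (card B) * V)" if "P k x" for k x
    proof -
      obtain g where g: "\<And>\<beta>. \<beta> \<in> B \<Longrightarrow>
          valid (g \<beta>) (\<kappa> * \<theta> ^ k)" "x =
          (\<Sum>\<beta>\<in>B. act (r \<beta> \<odot> g \<beta>) b)"
        using \<open>P k x\<close> P_def by blast
      have gs: "g \<beta> \<in> semigroup" if "\<beta> \<in> B" for \<beta>
          using g(1)[OF that] by (simp add: valid_def cone_word_def)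
      have "(\<Sum>\<beta>\<in>B. act (r \<beta> \<odot> g \<beta>) p) \<in> sum_power (card B) E"
        by (rule sum_power_sum[OF finB]) (use r gs p act_E semigroup_amult in blast)
      moreover have "norm ((\<Sum>\<beta>\<in>B. act (r \<beta> \<odot> g \<beta>) p) - x) \<le>
          \<kappa> * \<theta> ^ k * (real (card B) * V)"
      proof -
        have "norm ((\<Sum>\<beta>\<in>B. act (r \<beta> \<odot> g \<beta>) p) - x) \<le>
            (\<Sum>\<beta>\<in>B. norm (act (r \<beta> \<odot> g \<beta>) p
                - act (r \<beta> \<odot> g \<beta>) b))"
          unfolding g(2) sum_subtractf[symmetric] by (rule norm_sum)
        also have "\<dots> \<le> (\<Sum>\<beta>\<in>B. V * (\<kappa> * \<theta> ^ k))"
        proof (rule sum_mono)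
          fix \<beta> assume \<beta>: "\<beta> \<in> B"
          have a1c: "a1 \<in> eigen_cone f v \<epsilon>"
              using cone_mono[OF s(3), of \<epsilon>] \<epsilon> by (simp add: a1_def)
          have "norm (act (r \<beta> \<odot> g \<beta>) p - act (r \<beta> \<odot> g \<beta>) b) \<le>
              norm (fst (g \<beta>) *v (p - b))"
            using norm_semigroup[OF r(1)[OF \<beta>], of "fst (g \<beta>) *v (p - b)"]
            by (simp only: act_diff fst_amult matrix_vector_mul_assoc)
          also have "p - b = (- 1/2) *\<^sub>R a1" by (simp add: b_def)
          also have "norm (fst (g \<beta>) *v ((- 1/2) *\<^sub>R a1)) \<le> norm (fst (g \<beta>) *v a1)"
            unfolding matrix_vector_mult_scaleR by simp
          also have "\<dots> \<le> V * N (g \<beta>)" unfolding V_def N_def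
            using g(1)[OF \<beta>] a1c \<epsilon> by (intro norm_cone) (auto simp: valid_def cone_word_def)
          also have "\<dots> \<le> V * (\<kappa> * \<theta> ^ k)"
              using g(1)[OF \<beta>] V by (intro mult_left_mono) (auto simp: valid_def)
          finally show "norm (act (r \<beta> \<odot> g \<beta>) p
              - act (r \<beta> \<odot> g \<beta>) b) \<le> V * (\<kappa> * \<theta> ^ k)" .
        qed
        also have "\<dots> = \<kappa> * \<theta> ^ k * (real (card B) * V)" by simp
        finally show ?thesis .
      qed
      ultimately show ?thesis by blast
    qed
    show "\<exists>m. P (Suc k) (x + G k m) \<and> norm m \<le> real (card B) * V \<and>
        \<mu> * c / 32 * norm e \<le> m \<bullet> e"
      if "P k x" for k x e
    proof -
      obtain g where g: "\<And>\<beta>. \<beta> \<in> B \<Longrightarrow>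
          valid (g \<beta>) (\<kappa> * \<theta> ^ k)" "x =
          (\<Sum>\<beta>\<in>B. act (r \<beta> \<odot> g \<beta>) b)"
        using \<open>P k x\<close> P_def by blast
      define \<sigma> where "\<sigma> \<beta> = (if 0 \<le>
          e \<bullet> \<beta> then 1 else -1 :: real)" for \<beta>
      have tk: "0 < \<kappa> * \<theta> ^ k" using \<kappa> \<theta> by simp
      have "\<forall>\<beta>\<in>B. \<exists>h \<delta>. h \<in> semigroup \<and>
          valid (g \<beta> \<odot> h) (\<theta> * (\<kappa> * \<theta> ^ k)) \<and>
        \<delta> \<in> eigen_cone f v \<epsilon> \<and> \<mu> / 16 \<le> f \<bullet> \<delta> \<and>
            f \<bullet> \<delta> \<le> 1 \<and>
        act (g \<beta> \<odot> h) b = act (g \<beta>) b +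
            (\<sigma> \<beta> * (\<kappa> * \<theta> ^ k)) *\<^sub>R \<delta>"
        by (intro ballI step[OF tk] g) (auto simp: \<sigma>_def)
      then obtain h \<delta> where h: "\<And>\<beta>. \<beta> \<in> B \<Longrightarrow>
          valid (g \<beta> \<odot> h \<beta>) (\<theta> * (\<kappa> * \<theta> ^ k))"
        "\<And>\<beta>. \<beta> \<in> B \<Longrightarrow>
            \<delta> \<beta> \<in> eigen_cone f v \<epsilon>" "\<And>\<beta>.
            \<beta> \<in> B \<Longrightarrow> \<mu> / 16 \<le>
            f \<bullet> \<delta> \<beta>" "\<And>\<beta>. \<beta> \<in> B \<Longrightarrow>
            f \<bullet> \<delta> \<beta> \<le> 1"
        "\<And>\<beta>. \<beta> \<in> B \<Longrightarrow>
            act (g \<beta> \<odot> h \<beta>) b =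
            act (g \<beta>) b + (\<sigma> \<beta> * (\<kappa> * \<theta> ^ k)) *\<^sub>R \<delta> \<beta>"
        by metis
      define m where "m = (\<Sum>\<beta>\<in>B.
          \<sigma> \<beta> *\<^sub>R (fst (r \<beta>) *v \<delta> \<beta>))"
      have "(\<Sum>\<beta>\<in>B. act (r \<beta> \<odot> (g \<beta> \<odot> h \<beta>)) b) = x + G k m"
      proof -
        have "act (r \<beta> \<odot> (g \<beta> \<odot> h \<beta>)) b =
            act (r \<beta> \<odot> g \<beta>) b +
                (\<kappa> * \<theta> ^ k) *\<^sub>R (\<sigma> \<beta> *\<^sub>R (fst (r \<beta>) *v
                \<delta> \<beta>))" if "\<beta> \<in> B" for \<beta>
          using act_diff[of "r \<beta>" "act (g \<beta> \<odot> h \<beta>) b"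
              "act (g \<beta>) b"] h(5)[OF that]
          by (simp add: matrix_vector_mult_scaleR diff_eq_eq mult_ac add.commute)
        then show ?thesis unfolding g(2) G_def m_def
          by (simp add: sum.distrib scaleR_sum_right del: scaleR_scaleR)
      qed
      then have "P (Suc k) (x + G k m)" unfolding P_def
        by (intro exI[of _ "\<lambda>\<beta>.
            g \<beta> \<odot> h \<beta>"]) (use h(1) in \<open>auto simp: mult_ac\<close>)
      moreover have "norm m \<le> real (card B) * V"
      proof -
        have "norm m \<le> (\<Sum>\<beta>\<in>B.
            norm (\<sigma> \<beta> *\<^sub>R (fst (r \<beta>) *v \<delta> \<beta>)))"
            unfolding m_def by (rule norm_sum)
        also have "\<dots> \<le> (\<Sum>\<beta>\<in>B. V)"
        proof (rule sum_mono)
          fix \<beta> assume \<beta>: "\<beta> \<in> B"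
          have "norm (\<sigma> \<beta> *\<^sub>R (fst (r \<beta>) *v \<delta> \<beta>)) \<le>
              norm (\<delta> \<beta>)"
            using norm_semigroup[OF r(1)[OF \<beta>]] by (simp add: \<sigma>_def)
          also have "\<dots> \<le> V * (f \<bullet> \<delta> \<beta>)" unfolding V_def
              by (rule norm_cone[OF h(2)[OF \<beta>] \<epsilon>(2,1)])
          also have "\<dots> \<le> V * 1" using h(4)[OF \<beta>] V by (intro mult_left_mono) auto
          finally show "norm (\<sigma> \<beta> *\<^sub>R (fst (r \<beta>) *v \<delta> \<beta>)) \<le>
              V" by simp
        qed
        finally show ?thesis by simp
      qed
      moreover have "\<mu> * c / 32 * norm e \<le> m \<bullet> e"
      proof -
        have "\<mu> / 16 * \<bar>e \<bullet> \<beta>\<bar> - \<epsilon> * norm e \<le>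
            (\<sigma> \<beta> *\<^sub>R (fst (r \<beta>) *v \<delta> \<beta>)) \<bullet> e"
            if \<beta>: "\<beta> \<in> B" for \<beta>
        proof -
          define \<rho> where "\<rho> = \<delta> \<beta> - (f \<bullet> \<delta> \<beta>) *\<^sub>R v"
          have "norm \<rho> \<le> \<epsilon> * (f \<bullet> \<delta> \<beta>)"
              using h(2)[OF \<beta>] by (simp add: eigen_cone_def \<rho>_def)
          also have "\<dots> \<le> \<epsilon> * 1"
              using h(4)[OF \<beta>] \<epsilon> by (intro mult_left_mono) auto
          finally have "norm (fst (r \<beta>) *v \<rho>) \<le> \<epsilon>"
              using norm_semigroup[OF r(1)[OF \<beta>], of \<rho>] by simp
          then have "norm (fst (r \<beta>) *v \<rho>) * norm e \<le> \<epsilon> * norm e"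
              by (rule mult_right_mono) simp
          then have *: "\<bar>(fst (r \<beta>) *v \<rho>) \<bullet> e\<bar> \<le> \<epsilon> * norm e"
            using Cauchy_Schwarz_ineq2[of "fst (r \<beta>) *v \<rho>" e] by linarith
          have "\<delta> \<beta> = (f \<bullet> \<delta> \<beta>) *\<^sub>R v + \<rho>"
              by (simp add: \<rho>_def)
          then have "fst (r \<beta>) *v \<delta> \<beta> =
              (f \<bullet> \<delta> \<beta>) *\<^sub>R \<beta> + fst (r \<beta>) *v \<rho>"
            using r(2)[OF \<beta>] by (metis matrix_vector_mult_scaleR matrix_vector_right_distrib)
          then have "(\<sigma> \<beta> *\<^sub>R (fst (r \<beta>) *v \<delta> \<beta>)) \<bullet> e =
              (f \<bullet> \<delta> \<beta>) * \<bar>e \<bullet> \<beta>\<bar> +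
                  \<sigma> \<beta> * ((fst (r \<beta>) *v \<rho>) \<bullet> e)"
            by (simp add: inner_add_left \<sigma>_def inner_commute algebra_simps)
          moreover have "\<mu> / 16 * \<bar>e \<bullet> \<beta>\<bar> \<le>
              (f \<bullet> \<delta> \<beta>) * \<bar>e \<bullet> \<beta>\<bar>"
            using h(3)[OF \<beta>] by (intro mult_right_mono) auto
          moreover have "- (\<epsilon> * norm e) \<le>
              \<sigma> \<beta> * ((fst (r \<beta>) *v \<rho>) \<bullet> e)"
            using * by (auto simp: \<sigma>_def abs_le_iff)
          ultimately show ?thesis by linarith
        qed
        then have "(\<Sum>\<beta>\<in>B.
            \<mu> / 16 * \<bar>e \<bullet> \<beta>\<bar> - \<epsilon> * norm e) \<le> m \<bullet> e"
          unfolding m_def inner_sum_left by (intro sum_mono)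
        moreover have "(\<Sum>\<beta>\<in>B.
            \<mu> / 16 * \<bar>e \<bullet> \<beta>\<bar> - \<epsilon> * norm e) =
            \<mu> / 16 * (\<Sum>\<beta>\<in>B.
                \<bar>e \<bullet> \<beta>\<bar>) - real (card B) * \<epsilon> * norm e"
          by (simp add: sum_subtractf sum_distrib_left)
        moreover have "\<mu> / 16 * (c * norm e) \<le>
            \<mu> / 16 * (\<Sum>\<beta>\<in>B. \<bar>e \<bullet> \<beta>\<bar>)"
          using c(2) \<mu>_pos by (intro mult_left_mono) auto
        moreover have "real (card B) * \<epsilon> * norm e \<le> \<mu> * c / 32 * norm e"
          using \<epsilon>(3) by (rule mult_right_mono) simp
        ultimately show ?thesis by (simp add: field_simps)
      qed
      ultimately show ?thesis by blast
    qed
  qed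
  then show ?thesis by (rule interior_sum_power_thick[OF compact_E cB])
qed

text \<open>If the displacement is negative, \<open>(v, f)\<close> is replaced by
  \<open>(- v, - f)\<close>: all assumptions and the sign of \<open>f \<bullet> (fst t *v v)\<close>
  survive, while the displacement of \<open>p\<close> changes sign.\<close>

theorem thick_if_span:
  assumes span: "span ((\<lambda>g. fst g *v v) ` semigroup) = UNIV"
  shows "arithmetically_thick E"
proof -
  obtain t where t: "t \<in> semigroup" "0 < f \<bullet> (fst t *v v)" "f \<bullet> (act t p - p) \<noteq> 0"
    using good_word[OF span] by blast
  show ?thesis
  proof (cases "0 < f \<bullet> (act t p - p)")
    case True
    then show ?thesis using thick_if_positive_word[OF span] t by blast
  next
    case False
    interpret neg: contracting_word l T a E w n \<mu> "- v" "- f" p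
      by unfold_locales (use w \<mu>_pos right left fv contract p in
        \<open>simp_all add: matrix_vector_mult_uminus del: words.simps\<close>)
    have eq: "(\<lambda>g. fst g *v (- v)) ` semigroup = uminus ` (\<lambda>g. fst g *v v) ` semigroup"
      unfolding image_image by (simp only: matrix_vector_mult_uminus)
    have "x \<in> span (uminus ` (\<lambda>g. fst g *v v) ` semigroup)" for x
    proof -
      have "linear (uminus :: real^'n \<Rightarrow> real^'n)" by (simp add: linear_iff)
      then have "span (uminus ` (\<lambda>g. fst g *v v) ` semigroup) = uminus ` (UNIV :: (real^'n) set)"
        using linear_span_image[of uminus "(\<lambda>g. fst g *v v) ` semigroup"] span by simp
      then show ?thesis by (metis UNIV_I image_eqI minus_minus)
    qed
    then have "span ((\<lambda>g. fst g *v (- v)) ` semigroup) = UNIV" unfolding eq by blast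
    then show ?thesis using t False
        by (intro neg.thick_if_positive_word[of t]) (auto simp: matrix_vector_mult_uminus)
  qed
qed

end

text \<open>The normalised powers converge to the projection onto the line of \<open>v\<close> along
  the kernel of \<open>f\<close>. In this form the notion follows both from a complex spectral gap
  and from two real eigenvectors in the plane.\<close>

definition proximal :: "real^'n^'n \<Rightarrow> real \<Rightarrow> real^'n \<Rightarrow> real^'n
    \<Rightarrow> bool" where
  "proximal M \<mu> v f \<longleftrightarrow> \<mu> \<noteq> 0 \<and> M *v v = \<mu> *\<^sub>R v \<and>
      f \<bullet> v = 1 \<and>
    (\<forall>x. (\<lambda>k. (1 / \<mu> ^ k) *\<^sub>R ((*v) M ^^ k) x) \<longlonglongrightarrow> (f
        \<bullet> x) *\<^sub>R v)"

lemma linear_funpow_matrix: "linear ((*v) (M :: real^'n^'n) ^^ k)"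
proof (induction k)
  case 0
  show ?case by (simp add: linear_iff)
next
  case (Suc k)
  then show ?case using linear_compose[of "(*v) M ^^ k" "(*v) M"] by (simp add: o_def)
qed

text \<open>Starting at \<open>M *v x\<close> shifts the sequence of iterates by one index, so both
  sides come from limits of the same sequence.\<close>

lemma proximal_left:
  assumes "proximal M \<mu> v f"
  shows "f \<bullet> (M *v x) = \<mu> * (f \<bullet> x)"
proof -
  have l0: "\<mu> \<noteq> 0" and v0: "v \<noteq> 0" using assms by (auto simp: proximal_def)
  have 1: "(\<lambda>k. (1 / \<mu> ^ k) *\<^sub>R ((*v) M ^^ k) (M *v x)) \<longlonglongrightarrow> (f
      \<bullet> (M *v x)) *\<^sub>R v"
    using assms by (simp add: proximal_def)
  have 2: "(\<lambda>k. (1 / \<mu> ^ k) *\<^sub>R ((*v) M ^^ k) (M *v x)) =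
      (\<lambda>k. \<mu> *\<^sub>R ((1 / \<mu> ^ Suc k) *\<^sub>R ((*v) M ^^ Suc k) x))"
    using l0 by (simp add: funpow_Suc_right del: funpow.simps)
  have 3: "(\<lambda>k. \<mu> *\<^sub>R ((1 / \<mu> ^ Suc k) *\<^sub>R ((*v) M ^^ Suc k) x))
      \<longlonglongrightarrow> \<mu> *\<^sub>R ((f \<bullet> x) *\<^sub>R v)"
    using assms unfolding proximal_def
    by (intro tendsto_scaleR[OF tendsto_const] LIMSEQ_Suc[of "\<lambda>k.
        (1 / \<mu> ^ k) *\<^sub>R ((*v) M ^^ k) x"]) blast
  have "(f \<bullet> (M *v x)) *\<^sub>R v = \<mu> *\<^sub>R ((f \<bullet> x) *\<^sub>R v)"
    using LIMSEQ_unique[OF 1[unfolded 2] 3] .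
  then show ?thesis using v0 by simp
qed

text \<open>Convergence on the finite basis is uniform on bounded sets, so a high normalised power
  has norm at most 1/2 on the kernel of \<open>f\<close>. An even exponent makes
  \<open>\<mu> ^ k\<close> positive even for negative \<mu>.\<close>

lemma proximal_power_contracts:
  assumes "proximal M \<mu> v f"
  shows "\<exists>k>0. even k \<and> (\<forall>x. f \<bullet> x = 0 \<longrightarrow>
      norm (((*v) M ^^ k) x) \<le> \<mu> ^ k / 2 * norm x)"
proof -
  have l0: "\<mu> \<noteq> 0" using assms by (simp add: proximal_def)
  define N where "N k x = (1 / \<mu> ^ k) *\<^sub>R ((*v) M ^^ k) x" for k x
  have linN: "linear (N k)" for k
    unfolding N_def by (rule linear_compose_scale_right[OF linear_funpow_matrix])
  have lim: "(\<lambda>k. N k x) \<longlonglongrightarrow> (f \<bullet> x) *\<^sub>R v" for x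
    using assms by (simp add: proximal_def N_def)
  have "(\<lambda>k. \<Sum>i\<in>Basis.
      norm (N k i - (f \<bullet> i) *\<^sub>R v)) \<longlonglongrightarrow> (\<Sum>i\<in>Basis.
      norm ((f \<bullet> i) *\<^sub>R v - (f \<bullet> i) *\<^sub>R v))"
    by (intro tendsto_sum tendsto_norm tendsto_diff lim tendsto_const)
  then have "\<forall>\<^sub>F k in sequentially. (\<Sum>i\<in>Basis.
      norm (N k i - (f \<bullet> i) *\<^sub>R v)) < 1 / 2"
    by (intro order_tendstoD(2)) auto
  then obtain k0 where k0: "\<And>k. k \<ge> k0 \<Longrightarrow>
      (\<Sum>i\<in>Basis. norm (N k i - (f \<bullet> i) *\<^sub>R v)) < 1 / 2"
    by (auto simp: eventually_sequentially)
  define k where "k = 2 * Suc k0"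
  have "norm (((*v) M ^^ k) x) \<le> \<mu> ^ k / 2 * norm x" if "f \<bullet> x = 0" for x
  proof -
    have "N k x = N k (\<Sum>i\<in>Basis. (x \<bullet> i) *\<^sub>R i)"
        by (simp add: euclidean_representation)
    also have "\<dots> = (\<Sum>i\<in>Basis. (x \<bullet> i) *\<^sub>R N k i)"
      by (simp add: linear_sum[OF linN] linear_scale[OF linN])
    also have "\<dots> = (\<Sum>i\<in>Basis.
        (x \<bullet> i) *\<^sub>R (N k i - (f \<bullet> i) *\<^sub>R v)) +
        (\<Sum>i\<in>Basis. (f \<bullet> i) * (x \<bullet> i)) *\<^sub>R v"
      by (simp add: scaleR_diff_right sum_subtractf scaleR_sum_left mult.commute)
    also have "(\<Sum>i\<in>Basis. (f \<bullet> i) * (x \<bullet> i)) = 0"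
        using that by (simp flip: euclidean_inner)
    finally have "norm (N k x) \<le> (\<Sum>i\<in>Basis.
        norm ((x \<bullet> i) *\<^sub>R (N k i - (f \<bullet> i) *\<^sub>R v)))"
      using norm_sum[of "\<lambda>i. (x \<bullet> i) *\<^sub>R (N k i - (f \<bullet> i) *\<^sub>R v)"
          Basis] by simp
    also have "\<dots> \<le> (\<Sum>i\<in>Basis. norm x * norm (N k i - (f \<bullet> i) *\<^sub>R v))"
      by (intro sum_mono) (simp add: Basis_le_norm mult_right_mono)
    also have "\<dots> \<le> norm x * (1 / 2)"
      unfolding sum_distrib_left[symmetric] using k0[of k] by (intro mult_left_mono) (auto simp: k_def)
    finally have "norm (N k x) \<le> norm x * (1 / 2)" .
    moreover have "0 < \<mu> ^ k" using l0 zero_less_power_eq[of \<mu> k] by (auto simp: k_def)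
    moreover have "((*v) M ^^ k) x = \<mu> ^ k *\<^sub>R N k x" using l0 by (simp add: N_def)
    ultimately show ?thesis by (simp add: field_simps)
  qed
  then show ?thesis by (intro exI[of _ k]) (auto simp: k_def)
qed

lemma fst_apow: "fst (apow w k) *v x = ((*v) (fst w) ^^ k) x"
  by (induction k arbitrary: x) (auto simp: matrix_vector_mul_assoc[symmetric] funpow_swap1)

context self_affine
begin

lemma apow_words: "w \<in> words (Suc n) \<Longrightarrow> 0 < k \<Longrightarrow>
    \<exists>m. apow w k \<in> words (Suc m)"
proof (induction k)
  case (Suc k)
  show ?case
  proof (cases "k = 0")
    case True
    have "apow w (Suc k) = w" using True by (cases w) (simp add: amult_def)
    then show ?thesis using Suc.prems by auto
  next
    case False
    then obtain m where "apow w k \<in> words (Suc m)" using Suc by auto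
    then have "apow w (Suc k) \<in> words (Suc (m + Suc n))"
      using words_add[of "apow w k" "Suc m" w "Suc n"] Suc.prems by simp
    then show ?thesis by blast
  qed
qed simp

theorem thick_if_proximal:
  assumes w: "w \<in> words (Suc n)" and prox: "proximal (fst w) \<mu> v f"
    and span: "span ((\<lambda>g. fst g *v v) ` semigroup) = UNIV"
  shows "arithmetically_thick E"
proof -
  obtain k where k: "k > 0" "even k" "\<And>x. f \<bullet> x = 0 \<Longrightarrow>
      norm (((*v) (fst w) ^^ k) x) \<le> \<mu> ^ k / 2 * norm x"
    using proximal_power_contracts[OF prox] by blast
  obtain m where m: "apow w k \<in> words (Suc m)" using apow_words w k(1) by blast
  obtain p where p: "p \<in> E" "act (apow w k) p = p" using fixed_point[OF m] by blast
  have l: "f \<bullet> (((*v) (fst w) ^^ j) x) = \<mu> ^ j * (f \<bullet> x)" for j x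
    by (induction j) (auto simp: proximal_left[OF prox])
  have r: "((*v) (fst w) ^^ j) v = \<mu> ^ j *\<^sub>R v" for j
    by (induction j) (use prox in \<open>auto simp: proximal_def matrix_vector_mult_scaleR\<close>)
  interpret contracting_word l T a E "apow w k" m "\<mu> ^ k" v f p
  proof unfold_locales
    show "apow w k \<in> words (Suc m)" by (rule m)
    show "0 < \<mu> ^ k" using prox k(2) by (simp add: proximal_def zero_less_power_eq)
    show "fst (apow w k) *v v = \<mu> ^ k *\<^sub>R v" by (simp add: fst_apow r)
    show "f \<bullet> (fst (apow w k) *v x) = \<mu> ^ k * (f \<bullet> x)" for x by (simp add: fst_apow l)
    show "f \<bullet> v = 1" using prox by (simp add: proximal_def)
    show "norm (fst (apow w k) *v x) \<le> \<mu> ^ k / 2 * norm x" if "f \<bullet> x = 0" for x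
      using k(3)[OF that] by (simp add: fst_apow)
    show "p \<in> E" "act (apow w k) p = p" by (rule p)+
  qed
  show ?thesis by (rule thick_if_span[OF span])
qed

end

section \<open>Simple dominant eigenvalues\<close>

text \<open>The factor \<open>c\<close> is first pulled out of row \<open>i\<close>, then the
  multiple of \<open>u\<close> is subtracted from row \<open>j\<close>, then \<open>c\<close> is
  pulled out there. The order matters: \<open>c\<close> is later a polynomial and cannot be divided
  by.\<close>

lemma det_two_rows:
  fixes u w :: "'a::comm_ring_1^'n" and b :: "'n \<Rightarrow> 'a^'n"
  assumes "i \<noteq> j"
  shows "det (\<chi> k. if k = i then c *s u else if k = j then c *s w + d *s u else b k) =
    c * c * det (\<chi> k. if k = i then u else if k = j then w else b k)"
proof -
  define A where "A = (\<chi> k. if k = i then u else if k = j then c *s w else b k)"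
  have rows: "row j A = c *s w" "row i A = u" "\<And>k. k \<noteq> i \<Longrightarrow>
      k \<noteq> j \<Longrightarrow> row k A = b k"
    using assms by (simp_all add: A_def row_def vec_eq_iff)
  have "(\<chi> k. if k = i then u else if k = j then c *s w + d *s u else b k) =
      (\<chi> k. if k = j then row j A + d *s row i A else row k A)"
    using assms rows by (auto simp: vec_eq_iff)
  then have 1: "det (\<chi> k. if k = i then u else if k = j then c *s w + d *s u else b k) = det A"
    using det_row_operation[of j i A d] assms by simp
  have "A = (\<chi> k. if k = j then c *s w else if k = i then u else b k)"
    using assms by (auto simp: A_def vec_eq_iff)
  then have "det A = c * det (\<chi> k. if k = j then w else if k = i then u else b k)"
    using det_row_mul[of j c "\<lambda>_. w" "\<lambda>k. if k = i then u else b k"] by simp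
  also have "(\<chi> k. if k = j then w else if k = i then u else b k) =
      (\<chi> k. if k = i then u else if k = j then w else b k)"
    using assms by (auto simp: vec_eq_iff)
  finally have 2: "det A = c * det (\<chi> k. if k = i then u else if k = j then w else b k)" .
  show ?thesis
    using det_row_mul[of i c "\<lambda>_. u" "\<lambda>k. if k = j then c *s w + d *s u else b k"] 1 2
    by (simp add: mult.assoc)
qed

lemma poly_charpoly: "poly (charpoly A) x = det (mat x - A)"
  by (simp add: charpoly_def det_def poly_sum poly_prod mat_def if_distrib[of "\<lambda>p.
      poly p x"] cong: if_cong)

lemma det_eq_0_kernel:
  fixes A :: "'a::field^'n^'n"
  shows "det A = 0 \<Longrightarrow> \<exists>x. x \<noteq> 0 \<and> A *v x = 0"
  using invertible_det_nz[of A] invertible_left_inverse[of A] matrix_left_invertible_ker[of A] by auto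

lemma mat_vector_mult: "(mat c :: 'a::comm_ring_1^'n^'n) *v x = c *s x"
  by (simp add: mat_def matrix_vector_mult_def vec_eq_iff if_distrib[of "\<lambda>c. c * _"] cong: if_cong)

lemma poly_char_root: "poly (charpoly A) x = 0 \<Longrightarrow> eigenvalue A x"
proof -
  assume "poly (charpoly A) x = 0"
  then obtain v where v: "v \<noteq> 0" "(mat x - A) *v v = 0"
    unfolding poly_charpoly using det_eq_0_kernel by blast
  then have "A *v v = x *s v" by (simp add: matrix_vector_mult_diff_rdistrib mat_vector_mult)
  then show ?thesis using v(1) by (auto simp: eigenvalue_def)
qed

text \<open>Two independent vectors spanning a generalized eigenspace give a factor
  \<open>(X - z)\<^sup>2\<close> of the characteristic polynomial: complete them to a basis
  by unit vectors and clear the two corresponding columns.\<close>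

lemma order_charpoly_ne_1:
  fixes A :: "complex^'n^'n"
  assumes nz: "charpoly A \<noteq> 0" and x1: "x1 \<noteq> 0" "A *v x1 = z *s x1"
    and x2: "\<And>k. x2 \<noteq> k *s x1" "A *v x2 = z *s x2 + c *s x1"
  shows "order z (charpoly A) \<noteq> 1"
proof -
  obtain i where i: "x1 $ i \<noteq> 0" using x1(1) by (auto simp: vec_eq_iff)
  \<comment> \<open>Coordinate \<open>i\<close> of \<open>y\<close> vanishes while that of
    \<open>x1\<close> does not; this makes \<open>S\<close> invertible by solving for coordinate
    \<open>i\<close>, then \<open>j\<close>, then the rest.\<close>
  define y where "y = x2 - (x2 $ i / x1 $ i) *s x1"
  have "y \<noteq> 0" using x2(1)[of "x2 $ i / x1 $ i"] by (simp add: y_def)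
  then obtain j where j: "y $ j \<noteq> 0" by (auto simp: vec_eq_iff)
  have yi: "y $ i = 0" using i by (simp add: y_def)
  then have ij: "i \<noteq> j" using j by auto
  have Ay: "A *v y = z *s y + c *s x1"
    using x1(2) x2(2)
    by (simp add: y_def matrix_vector_mult_diff_distrib vec.scale vec_eq_iff algebra_simps)
  define C where "C u = (\<chi> r. [:u $ r:])" for u :: "complex^'n"
  define S where "S = (\<chi> r k. if k = i then x1 $ r else if k = j then y $ r else if r = k then 1 else 0)"
  have S_inv: "det S \<noteq> 0"
  proof
    assume "det S = 0"
    then obtain v where v: "v \<noteq> 0" "S *v v = 0" using det_eq_0_kernel by blast
    have row: "(\<Sum>k\<in>UNIV. S $ r $ k * v $ k) = 0" for r
      using v(2) by (simp add: matrix_vector_mult_def vec_eq_iff)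
    have expand: "(\<Sum>k\<in>UNIV. S $ r $ k * v $ k) =
        x1 $ r * v $ i + y $ r * v $ j + (if r = i \<or> r = j then 0 else v $ r)" for r
    proof -
      have "(\<Sum>k\<in>UNIV. S $ r $ k * v $ k) =
          S $ r $ i * v $ i + S $ r $ j * v $ j + (\<Sum>k\<in>UNIV - {i, j}. S $ r $ k * v $ k)"
        using ij by (simp add: sum.remove[of UNIV i] sum.remove[of "UNIV - {i}"
            j] Diff_insert2[symmetric] insert_commute add.assoc)
      moreover have "(\<Sum>k\<in>UNIV - {i, j}. S $ r $ k * v $ k) =
          (\<Sum>k\<in>UNIV - {i, j}. if r = k then v $ k else 0)"
        by (rule sum.cong) (auto simp: S_def)
      ultimately show ?thesis using ij by (simp add: S_def)
    qed
    have "v $ i = 0" using row[of i] expand[of i] i yi by simp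
    then have "v $ j = 0" using row[of j] expand[of j] j by simp
    then have "v $ r = 0" for r using row[of r] expand[of r] \<open>v $ i = 0\<close>
        by (cases "r = i \<or> r = j") auto
    then show False using v(1) by (simp add: vec_eq_iff)
  qed
  define CA where "CA = (\<chi> r k. [:A $ r $ k:])"
  define CS where "CS = (\<chi> r k. [:S $ r $ k:])"
  have Csum: "(\<Sum>k\<in>UNIV. [:f k:]) = [:\<Sum>k\<in>UNIV. f k:]" for f :: "'n \<Rightarrow> complex"
    by (induction rule: infinite_finite_induct) auto
  have CAC: "CA *v C u = C (A *v u)" for u
    by (simp add: CA_def C_def matrix_vector_mult_def vec_eq_iff Csum mult.commute)
  have detCS: "det CS = [:det S:]"
  proof -
    have "poly (det CS) x = det S" for x by (simp add: CS_def det_def poly_sum poly_prod)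
    then show ?thesis by (intro poly_eqI_degree_lead_coeff poly_ext) (auto simp:
        poly_eq_poly_eq_iff[symmetric] fun_eq_iff)
  qed
  \<comment> \<open>Transposing turns the two columns into rows, where \<open>det_two_rows\<close>
    acts; \<open>det R\<close> is the characteristic polynomial times the nonzero constant
    \<open>[:det S:]\<close>.\<close>
  define R where "R = transpose ((mat [:0, 1:] - CA) ** CS)"
  define X where "X = [:- z, 1:]"
  have colS: "column k CS = C (column k S)" for k
    by (simp add: CS_def C_def column_def)
  have rowR: "R $ k = (mat [:0, 1:] - CA) *v C (column k S)" for k
    by (simp add: R_def transpose_def matrix_matrix_mult_def matrix_vector_mult_def vec_eq_iff
        flip: colS) (simp add: column_def)
  have Ri: "R $ i = X *s C x1"
  proof -
    have "column i S = x1" by (simp add: column_def S_def)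
    then have "R $ i = [:0, 1:] *s C x1 - C (z *s x1)"
      by (simp only: rowR matrix_vector_mult_diff_rdistrib mat_vector_mult CAC x1)
    then show ?thesis by (simp add: vec_eq_iff C_def X_def algebra_simps)
  qed
  have Rj: "R $ j = X *s C y + [:- c:] *s C x1"
  proof -
    have "column j S = y" using ij by (simp add: column_def S_def)
    then have "R $ j = [:0, 1:] *s C y - C (z *s y + c *s x1)"
      by (simp only: rowR matrix_vector_mult_diff_rdistrib mat_vector_mult CAC Ay)
    then show ?thesis by (simp add: vec_eq_iff C_def X_def algebra_simps)
  qed
  have "R = (\<chi> k. if k = i then X *s C x1 else if k = j then X *s C y + [:- c:] *s C x1 else R $ k)"
    using Ri Rj by (simp add: vec_eq_iff)
  then have "det R = X * X * det (\<chi> k. if k = i then C x1 else if k = j then C y else R $ k)"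
    using det_two_rows[OF ij, of X "C x1" "C y" "[:- c:]" "\<lambda>k. R $ k"] by simp
  moreover have "det R = charpoly A * [:det S:]"
    by (simp add: R_def det_mul charpoly_def CA_def flip: detCS)
  ultimately have "X ^ 2 dvd [:det S:] * charpoly A"
    by (simp add: power2_eq_square mult.commute)
  then have "X ^ 2 dvd smult (det S) (charpoly A)" by simp
  then have "X ^ 2 dvd charpoly A" using S_inv dvd_smult_cancel by blast
  then have "2 \<le> order z (charpoly A)" using nz by (simp add: X_def order_divides)
  then show ?thesis by simp
qed

text \<open>The product of the factors \<open>A - r\<close>, applied to a vector. Keeping the
  factors as a list allows those of one eigenvalue to be filtered out.\<close>

definition killers :: "complex^'n^'n \<Rightarrow> complex list \<Rightarrow> complex^'n \<Rightarrow>
    complex^'n" where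
  "killers A rs = foldr (\<lambda>r y. A *v y - r *s y) rs"

lemma killers_simps [simp]:
  "killers A [] x = x" "killers A (r # rs) x = A *v killers A rs x - r *s killers A rs x"
  by (simp_all add: killers_def)

lemma killers_mult: "killers A rs (A *v x) = A *v killers A rs x"
  by (induction rs) (simp_all add: matrix_vector_mult_diff_distrib vec.scale)

lemma killers_scale: "killers A rs (c *s x) = c *s killers A rs x"
  by (induction rs) (simp_all add: vec.scale mult.commute)

lemma killers_diff: "killers A rs (x - y) = killers A rs x - killers A rs y"
  by (induction rs) (simp_all add: matrix_vector_mult_diff_distrib vec.scale)

lemma killers_step: "killers A (r # rs) x = killers A rs (A *v x - r *s x)"
  by (simp add: killers_mult killers_scale killers_diff)

text \<open>This is \<open>p(A) x\<close>, evaluated by Horner's scheme.\<close>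

definition poly_action :: "complex^'n^'n \<Rightarrow> complex^'n \<Rightarrow> complex poly
    \<Rightarrow> complex^'n" where
  "poly_action A x p = fold_coeffs (\<lambda>c y. c *s x + A *v y) p 0"

lemma poly_action_0 [simp]: "poly_action A x 0 = 0"
  by (simp add: poly_action_def)

lemma poly_action_pCons [simp]: "poly_action A x (pCons c p) = c *s x + A *v poly_action A x p"
  by (cases "c = 0 \<and> p = 0") (auto simp: poly_action_def)

lemma poly_action_add: "poly_action A x (p + q) = poly_action A x p + poly_action A x q"
proof (induction p q rule: poly_induct2)
  case (pCons a p b q)
  then show ?case by (simp add: matrix_vector_right_distrib vec.scale)
qed simp

lemma poly_action_smult: "poly_action A x (smult c p) = c *s poly_action A x p"
  by (induction p) (simp_all add: vec.scale mult.commute)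

lemma poly_action_diff: "poly_action A x (p - q) = poly_action A x p - poly_action A x q"
  using poly_action_add[of A x p "smult (-1) q"] poly_action_smult[of A x "-1" q] by simp

lemma poly_action_arg: "poly_action A (A *v x - r *s x) p = A *v poly_action A x p - r *s poly_action A x p"
  by (induction p) (simp_all add: matrix_vector_mult_diff_distrib matrix_vector_right_distrib
      vec.scale mult.commute)

lemma poly_action_linear_factor: 
  "poly_action A x ([:- r, 1:] * p) = poly_action A (A *v x - r *s x) p"
  by (simp add: poly_action_diff poly_action_smult poly_action_arg)

lemma poly_action_sum: "poly_action A x (sum p I) = (\<Sum>i\<in>I. poly_action A x (p i))"
  by (induction I rule: infinite_finite_induct) (simp_all add: poly_action_add)

lemma poly_action_monom: "poly_action A x (monom c k) = c *s ((*v) A ^^ k) x"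
  by (induction k) (simp_all add: monom_0 monom_Suc vec.scale)

text \<open>The polynomial is split into linear factors. If the other factors already kill the
  vector, the factor of the root \<open>r\<close> is omitted; otherwise what they leave is an
  eigenvector for \<open>r\<close>.\<close>

lemma eigenvalue_killers_if_poly:
  "p \<noteq> 0 \<Longrightarrow> poly_action A x p = 0 \<Longrightarrow>
      \<exists>rs. (\<forall>r\<in>set rs. eigenvalue A r) \<and> killers A rs x = 0"
proof (induction "degree p" arbitrary: p x)
  case 0
  then obtain c where "p = [:c:]" using degree_eq_zeroE by metis
  then have "x = 0" using 0 by simp
  then show ?case by (intro exI[of _ "[]"]) simp
next
  case (Suc n)
  have "\<not> constant (poly p)" using Suc.hyps(2) by (simp add: constant_degree)
  then obtain r where "poly p r = 0" using fundamental_theorem_of_algebra by blast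
  then obtain q where q: "p = [:- r, 1:] * q" by (auto simp: poly_eq_0_iff_dvd elim: dvdE)
  have "q \<noteq> 0" using q Suc.prems by auto
  then have "degree p = degree [:- r, 1:] + degree q" unfolding q by (intro degree_mult_eq) auto
  then have "degree q = n" using Suc.hyps(2) by simp
  moreover have "poly_action A (A *v x - r *s x) q = 0"
    using Suc.prems(2) unfolding q poly_action_linear_factor .
  ultimately obtain rs where rs: "\<forall>r\<in>set rs. eigenvalue A r" "killers A rs (A *v x - r *s x) = 0"
    using Suc.hyps(1)[of q "A *v x - r *s x"] \<open>q \<noteq> 0\<close> by auto
  have e: "A *v killers A rs x = r *s killers A rs x"
    using rs(2) killers_step[of A r rs x] by simp
  show ?case
  proof (cases "killers A rs x = 0")
    case True
    then show ?thesis using rs(1) by blast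
  next
    case False
    then have "eigenvalue A r" using e by (auto simp: eigenvalue_def)
    then show ?thesis using rs(1) e by (intro exI[of _ "r # rs"]) simp
  qed
qed

text \<open>One iterate of \<open>x\<close> more than the real dimension forces a linear relation,
  even with real coefficients, and the relation is a polynomial that annihilates \<open>x\<close>.
  Dependence concerns the set of iterates, so coinciding iterates need a relation of their
  own.\<close>

lemma eigenvalue_killers:
  fixes A :: "complex^'n^'n"
  shows "\<exists>rs. (\<forall>r\<in>set rs. eigenvalue A r) \<and> killers A rs x = 0"
proof -
  define y where "y k = ((*v) A ^^ k) x" for k
  define m where "m = DIM(complex^'n)"
  have "\<exists>p. p \<noteq> 0 \<and> poly_action A x p = 0"
  proof (cases "inj_on y {..m}")
    case True
    have "DIM(complex^'n) < card (y ` {..m})"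
      using card_image[OF True] unfolding m_def[symmetric] by simp
    then have "dependent (y ` {..m})" by (intro dependent_biggerset) auto
    then obtain c where c: "\<exists>v\<in>y ` {..m}. c v \<noteq> 0" "(\<Sum>v\<in>y ` {..m}.
        c v *\<^sub>R v) = 0"
      unfolding dependent_finite[OF finite_imageI[OF finite_atMost]] by blast
    define p where "p = (\<Sum>k\<le>m. monom (of_real (c (y k)) :: complex) k)"
    obtain k where "k \<le> m" "c (y k) \<noteq> 0" using c(1) by auto
    then have "coeff p k \<noteq> 0" by (simp add: p_def coeff_sum)
    then have "p \<noteq> 0" by auto
    moreover have "poly_action A x p = (\<Sum>k\<le>m. c (y k) *\<^sub>R y k)"
      unfolding p_def poly_action_sum poly_action_monom y_def[symmetric]
      by (intro sum.cong) (simp_all add: vec_eq_iff scaleR_conv_of_real[where 'a = complex])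
    moreover have "\<dots> = 0" using c(2) by (simp add: sum.reindex[OF True])
    ultimately show ?thesis by auto
  next
    case False
    then obtain i j where ij: "i \<noteq> j" "y i = y j" by (auto simp: inj_on_def)
    define p where "p = monom (1::complex) i + smult (-1) (monom 1 j)"
    have "coeff p i \<noteq> 0" using ij by (simp add: p_def)
    then have "p \<noteq> 0" by auto
    moreover have "poly_action A x p = y i - y j"
      unfolding p_def poly_action_add poly_action_smult poly_action_monom y_def[symmetric]
      by (simp add: vec_eq_iff)
    ultimately show ?thesis using ij by auto
  qed
  then show ?thesis using eigenvalue_killers_if_poly by blast
qed

text \<open>Once the perturbation is below \<open>(1 - q) * (r / 2)\<close>, the recursion
  reproduces the bound \<open>r / 2\<close>, and the initial value is forgotten
  geometrically.\<close>

lemma tendsto_0_contracting_recursion: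
  fixes u \<epsilon> :: "nat \<Rightarrow> real"
  assumes "\<And>k. 0 \<le> u k" "\<And>k. u (Suc k) \<le> q * u k + \<epsilon> k" "0 \<le>
      q" "q < 1" "\<epsilon> \<longlonglongrightarrow> 0"
  shows "u \<longlonglongrightarrow> 0"
proof (rule LIMSEQ_I)
  fix r :: real assume r: "0 < r"
  define s where "s = (1 - q) * (r / 2)"
  have s: "0 < s" using r assms by (simp add: s_def)
  obtain N where N: "\<forall>k\<ge>N. \<epsilon> k < s"
    using order_tendstoD(2)[OF assms(5) s] by (auto simp: eventually_sequentially)
  have bound: "u (N + k) \<le> q ^ k * u N + r / 2" for k
  proof (induction k)
    case (Suc k)
    have "u (N + Suc k) \<le> q * u (N + k) + s"
        using assms(2)[of "N + k"] N by (simp add: add_increasing2 less_imp_le order_trans)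
    also have "\<dots> \<le> q * (q ^ k * u N + r / 2) + s"
        using Suc assms(3) by (intro add_right_mono mult_left_mono) auto
    also have "\<dots> = q ^ Suc k * u N + r / 2" by (simp add: s_def field_simps)
    finally show ?case .
  qed (use r in simp)
  have "(\<lambda>k. q ^ k * u N) \<longlonglongrightarrow> 0 * u N"
    by (intro tendsto_mult tendsto_const LIMSEQ_power_zero) (use assms in simp)
  then have "\<forall>\<^sub>F k in sequentially. q ^ k * u N < r / 2"
      using r by (intro order_tendstoD(2)) auto
  then obtain K where K: "\<forall>k\<ge>K. q ^ k * u N < r / 2" by (auto simp: eventually_sequentially)
  show "\<exists>no. \<forall>n\<ge>no. norm (u n - 0) < r"
  proof (intro exI[of _ "N + K"] allI impI)
    fix n assume "N + K \<le> n"
    then have "u n \<le> q ^ (n - N) * u N + r / 2" "q ^ (n - N) * u N < r / 2"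
      using bound[of "n - N"] K by auto
    then show "norm (u n - 0) < r" using assms(1)[of n] by simp
  qed
qed

text \<open>By induction on the list: \<open>A *v x - r *s x\<close> is killed by the shorter list,
  and the normalised iterates of \<open>x\<close> satisfy a recursion of ratio \<open>r / z\<close>,
  driven by those of this vector.\<close>

lemma killed_powers_tendsto_0:
  fixes A :: "complex^'n^'n"
  assumes "\<And>r. r \<in> set rs \<Longrightarrow> cmod r < cmod z" "killers A rs x = 0"
  shows "(\<lambda>k. (1 / z ^ k) *s ((*v) A ^^ k) x) \<longlonglongrightarrow> 0"
  using assms
proof (induction rs arbitrary: x)
  case Nil
  have "((*v) A ^^ k) 0 = 0" for k by (induction k) auto
  then show ?case using Nil by simp
next
  case (Cons r rs)
  have rz: "cmod r < cmod z" using Cons.prems by simp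
  then have z: "z \<noteq> 0" by auto
  define N where "N k x = (1 / z ^ k) *s ((*v) A ^^ k) x" for k and x :: "complex^'n"
  define y where "y = A *v x - r *s x"
  have y: "(\<lambda>k. N k y) \<longlonglongrightarrow> 0"
    unfolding N_def y_def by (rule Cons.IH) (use Cons.prems[unfolded killers_step] in auto)
  have lin: "((*v) A ^^ k) (u - c *s v) = ((*v) A ^^ k) u - c *s ((*v) A ^^ k) v" for k c u v
    by (induction k) (simp_all add: matrix_vector_mult_diff_distrib vec.scale)
  have Nsuc: "N (Suc k) x = (r / z) *s N k x + (1 / z) *s N k y" for k
  proof -
    have "((*v) A ^^ k) y = ((*v) A ^^ Suc k) x - r *s ((*v) A ^^ k) x"
      by (simp add: y_def lin funpow_Suc_right del: funpow.simps)
    then show ?thesis using z by (simp add: N_def vec_eq_iff field_simps del: funpow.simps)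
  qed
  have ns: "norm (c *s v) = cmod c * norm v" for c and v :: "complex^'n"
    by (simp add: norm_vec_def L2_set_right_distrib[symmetric] norm_mult)
  have "(\<lambda>k. norm (N k x)) \<longlonglongrightarrow> 0"
  proof (rule tendsto_0_contracting_recursion)
    show "norm (N (Suc k) x) \<le> cmod (r / z) * norm (N k x) + cmod (1 / z) * norm (N k y)" for k
      unfolding Nsuc using norm_triangle_ineq[of "(r / z) *s N k x" "(1 / z) *s N k y"] by (simp add: ns)
    show "cmod (r / z) < 1" using rz z by (simp add: norm_divide)
    have "(\<lambda>k. cmod (1 / z) * norm (N k y)) \<longlonglongrightarrow> cmod (1 / z) * 0"
      by (intro tendsto_mult tendsto_const tendsto_norm_zero y)
    then show "(\<lambda>k. cmod (1 / z) * norm (N k y)) \<longlonglongrightarrow> 0" by simp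
  qed simp_all
  then show ?case unfolding N_def by (rule tendsto_norm_zero_cancel)
qed

text \<open>\<open>x\<close> is split into a multiple of \<open>v\<close> and a vector killed by
  eigenvalues of modulus below that of \<open>z\<close>. Simplicity enters twice: the eigenspace is
  the line of \<open>v\<close>, and a vector killed by \<open>A - z\<close> twice is killed by it
  once, so after removing all factors \<open>A - z\<close> from an annihilating list only a multiple
  of \<open>v\<close> is left.\<close>

lemma dominant_powers_converge:
  fixes A :: "complex^'n^'n"
  assumes simple: "order z (charpoly A) = 1"
    and dom: "\<And>w. eigenvalue A w \<Longrightarrow> w \<noteq> z \<Longrightarrow> cmod w < cmod z"
    and v: "v \<noteq> 0" "A *v v = z *s v"
  shows "\<exists>\<phi>. (\<lambda>k. (1 / z ^ k) *s ((*v) A ^^ k) x) \<longlonglongrightarrow> \<phi> *s v"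
proof (cases "z = 0")
  case True
  \<comment> \<open>Division by zero is 0, so for \<open>z = 0\<close> the sequence vanishes from
    index 1 on.\<close>
  have "(\<lambda>k. (1 / z ^ k) *s ((*v) A ^^ k) x) \<longlonglongrightarrow> 0 *s v"
  proof (rule tendsto_eventually)
    show "\<forall>\<^sub>F k in sequentially. (1 / z ^ k) *s ((*v) A ^^ k) x = 0 *s v"
      using True by (intro eventually_sequentiallyI[of 1]) auto
  qed
  then show ?thesis by blast
next
  case z: False
  \<comment> \<open>Otherwise every number would be an eigenvalue, also one of modulus larger than
    that of \<open>z\<close>.\<close>
  have nz: "charpoly A \<noteq> 0"
  proof
    assume "charpoly A = 0"
    then have "eigenvalue A (of_real (cmod z + 1))" by (intro poly_char_root) simp
    then have "of_real (cmod z + 1) = z \<or> cmod (of_real (cmod z + 1)) < cmod z" using dom by blast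
    moreover have "cmod (of_real (cmod z + 1)) = cmod z + 1"
      unfolding norm_of_real by simp
    ultimately show False by (metis add_cancel_left_right less_add_one order_less_asym zero_neq_one
        add.commute)
  qed
  \<comment> \<open>A second independent eigenvector is the case \<open>c = 0\<close> of
    \<open>order_charpoly_ne_1\<close>; \<open>square\<close> below excludes a Jordan chain, the
    case \<open>c = 1\<close>.\<close>
  have line: "\<exists>k. u = k *s v" if "A *v u = z *s u" for u
  proof (rule ccontr)
    assume "\<nexists>k. u = k *s v"
    then show False using order_charpoly_ne_1[OF nz v, of u 0] that simple by simp
  qed
  have square: "A *v u = z *s u" if "A *v (A *v u - z *s u) = z *s (A *v u - z *s u)" for u
  proof (rule ccontr)
    assume "A *v u \<noteq> z *s u"
    then have x1: "A *v u - z *s u \<noteq> 0" by simp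
    have "u \<noteq> k *s (A *v u - z *s u)" for k
    proof
      assume u: "u = k *s (A *v u - z *s u)"
      have "A *v u = A *v (k *s (A *v u - z *s u))" using u by simp
      also have "\<dots> = k *s (z *s (A *v u - z *s u))" using that by (simp only: vec.scale)
      also have "\<dots> = z *s (k *s (A *v u - z *s u))" by (simp add: vec_eq_iff)
      also have "\<dots> = z *s u" using u by simp
      finally show False using x1 by simp
    qed
    then show False using order_charpoly_ne_1[OF nz x1 that, of u 1] simple by simp
  qed
  have reduce: "A *v killers A (filter (\<lambda>r. r \<noteq> z) rs) x =
      z *s killers A (filter (\<lambda>r. r \<noteq> z) rs) x"
    if "killers A rs x = 0" for rs x
    using that
  proof (induction rs arbitrary: x)
    case (Cons r rs)
    have IH: "A *v killers A (filter (\<lambda>r. r \<noteq> z) rs) (A *v x - r *s x) =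
        z *s killers A (filter (\<lambda>r. r \<noteq> z) rs) (A *v x - r *s x)"
      using Cons killers_step by metis
    show ?case
    proof (cases "r = z")
      case True
      then show ?thesis using IH square by (simp add: killers_mult killers_scale killers_diff)
    next
      case False
      then show ?thesis using IH by (simp add: killers_mult killers_scale killers_diff)
    qed
  qed simp
  obtain rs where rs: "\<forall>r\<in>set rs. eigenvalue A r" "killers A rs x = 0"
      using eigenvalue_killers by blast
  define qs where "qs = filter (\<lambda>r. r \<noteq> z) rs"
  obtain c where c: "killers A qs x = c *s v" using line reduce[OF rs(2)] by (auto simp: qs_def)
  \<comment> \<open>The scalar by which the remaining factors act on \<open>v\<close>; it is nonzero
    because no factor with root \<open>z\<close> is left.\<close>
  define \<rho> where "\<rho> = prod_list (map (\<lambda>r. z - r) qs)"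
  have kv: "killers A ps v = prod_list (map (\<lambda>r. z - r) ps) *s v" for ps
    by (induction ps) (simp_all add: vec.scale v mult.commute left_diff_distrib)
  have "\<rho> \<noteq> 0" by (auto simp: \<rho>_def qs_def prod_list_zero_iff)
  define x0 where "x0 = x - (c / \<rho>) *s v"
  have "killers A qs x0 = 0"
    using c kv[of qs] \<open>\<rho> \<noteq> 0\<close>
        by (simp add: x0_def killers_diff killers_scale flip: \<rho>_def)
  then have lim: "(\<lambda>k. (1 / z ^ k) *s ((*v) A ^^ k) x0) \<longlonglongrightarrow> 0"
    by (rule killed_powers_tendsto_0[rotated]) (use rs dom in \<open>auto simp: qs_def\<close>)
  have "((*v) A ^^ k) x = ((*v) A ^^ k) x0 + (c / \<rho>) *s (z ^ k *s v)" for k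
  proof -
    have "((*v) A ^^ k) (u - d *s w) = ((*v) A ^^ k) u - d *s ((*v) A ^^ k) w" for d u w
      by (induction k) (simp_all add: matrix_vector_mult_diff_distrib vec.scale)
    moreover have "((*v) A ^^ k) v = z ^ k *s v"
      by (induction k) (simp_all add: vec.scale v mult.commute left_diff_distrib)
    ultimately show ?thesis by (simp add: x0_def)
  qed
  moreover have "1 / z ^ k * (c / \<rho> * z ^ k) = c / \<rho>" for k using z by simp
  ultimately have "(1 / z ^ k) *s ((*v) A ^^ k) x = (1 / z ^ k) *s ((*v) A ^^ k) x0 + (c / \<rho>) *s v" for k
    by (simp only: vector_add_ldistrib vector_smult_assoc)
  then have "(\<lambda>k. (1 / z ^ k) *s ((*v) A ^^ k) x) \<longlonglongrightarrow> 0 + (c / \<rho>) *s v"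
    by (simp only:) (intro tendsto_add lim tendsto_const)
  then show ?thesis by auto
qed

section \<open>Returning to real matrices\<close>

definition complex_vec :: "real^'n \<Rightarrow> complex^'n" where
  "complex_vec x = (\<chi> i. complex_of_real (x $ i))"

lemma complex_matrix_vec: "complex_matrix M *v complex_vec x = complex_vec (M *v x)"
  by (simp add: complex_matrix_def complex_vec_def matrix_vector_mult_def vec_eq_iff)

lemma complex_matrix_mult: "complex_matrix (A ** B) = complex_matrix A ** complex_matrix B"
  by (simp add: complex_matrix_def matrix_matrix_mult_def vec_eq_iff)

lemma complex_matrix_mat_1: "complex_matrix (mat 1) = mat 1"
  by (simp add: complex_matrix_def mat_def vec_eq_iff)

lemma real_linear_functional:
  fixes F :: "'a::euclidean_space \<Rightarrow> real"
  assumes "linear F"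
  shows "\<exists>f. \<forall>x. F x = f \<bullet> x"
proof (intro exI allI)
  fix x
  have "F x = F (\<Sum>b\<in>Basis. (x \<bullet> b) *\<^sub>R b)" by (simp add: euclidean_representation)
  also have "\<dots> = (\<Sum>b\<in>Basis. F b *\<^sub>R b) \<bullet> x"
    by (simp add: linear_sum[OF assms] linear_scale[OF assms] inner_sum_left inner_commute[of x] mult.commute)
  finally show "F x = (\<Sum>b\<in>Basis. F b *\<^sub>R b) \<bullet> x" .
qed

text \<open>As \<open>v\<close> is nonzero, the coefficients of the limits are unique, hence linear
  in the starting vector, and a linear functional is the inner product with some
  \<open>f\<close>.\<close>

lemma proximal_if_limits:
  fixes M :: "real^'n^'n"
  assumes "\<mu> \<noteq> 0" "v \<noteq> 0" "M *v v = \<mu> *\<^sub>R v"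
    and lim: "\<And>x. \<exists>s. (\<lambda>k.
        (1 / \<mu> ^ k) *\<^sub>R ((*v) M ^^ k) x) \<longlonglongrightarrow> s *\<^sub>R v"
  shows "\<exists>f. proximal M \<mu> v f"
proof -
  obtain F where F: "\<And>x. (\<lambda>k.
      (1 / \<mu> ^ k) *\<^sub>R ((*v) M ^^ k) x) \<longlonglongrightarrow> F x *\<^sub>R v"
    using lim by metis
  have uniq: "F x = s" if "(\<lambda>k.
      (1 / \<mu> ^ k) *\<^sub>R ((*v) M ^^ k) x) \<longlonglongrightarrow> s *\<^sub>R v" for x s
    using LIMSEQ_unique[OF F that] assms(2) by simp
  have "linear F"
  proof (rule linearI)
    fix x y
    have "(\<lambda>k. (1 / \<mu> ^ k) *\<^sub>R ((*v) M ^^ k) x +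
        (1 / \<mu> ^ k) *\<^sub>R ((*v) M ^^ k) y) \<longlonglongrightarrow> F x *\<^sub>R v +
        F y *\<^sub>R v"
      by (intro tendsto_add F)
    then show "F (x + y) = F x + F y"
      by (intro uniq) (simp add: linear_add[OF linear_funpow_matrix] scaleR_add_right scaleR_add_left)
  next
    fix c x
    have "(\<lambda>k. c *\<^sub>R ((1 / \<mu> ^ k) *\<^sub>R ((*v) M ^^ k) x))
        \<longlonglongrightarrow> c *\<^sub>R (F x *\<^sub>R v)"
      by (intro tendsto_scaleR tendsto_const F)
    then show "F (c *\<^sub>R x) = c *\<^sub>R F x"
      by (intro uniq) (simp add: linear_scale[OF linear_funpow_matrix] mult.commute)
  qed
  then obtain f where f: "\<And>x. F x = f \<bullet> x" using real_linear_functional by blast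
  have pow: "((*v) M ^^ k) v = \<mu> ^ k *\<^sub>R v" for k
    by (induction k) (simp_all add: assms(3) matrix_vector_mult_scaleR mult.commute)
  have "F v = 1" by (rule uniq) (use assms(1) in \<open>simp add: pow\<close>)
  then show ?thesis using assms F unfolding proximal_def f by auto
qed

text \<open>A nonreal \<open>z\<close> would be matched in modulus by its conjugate, so
  \<open>z\<close> is real. Then the real or the imaginary part of an eigenvector is a real
  eigenvector, and real parts of the complex limits are the required ones. Invertibility excludes
  \<open>z = 0\<close>.\<close>

lemma proximal_if_simple_dominant:
  fixes M :: "real^'n^'n"
  assumes "has_simple_dominant_eigenvalue M" "invertible M"
  shows "\<exists>\<mu> v f. proximal M \<mu> v f"
proof -
  let ?A = "complex_matrix M"
  obtain z where z: "eigenvalue ?A z" "order z (charpoly ?A) = 1"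
    "\<And>w. eigenvalue ?A w \<Longrightarrow> w \<noteq> z \<Longrightarrow> cmod w < cmod z"
    using assms(1) unfolding has_simple_dominant_eigenvalue_def by blast
  obtain u where u: "u \<noteq> 0" "?A *v u = z *s u" using z(1) by (auto simp: eigenvalue_def)
  have row: "(\<Sum>j\<in>UNIV. complex_of_real (M $ i $ j) * u $ j) = z * u $ i" for i
    using u(2) by (simp add: complex_matrix_def matrix_vector_mult_def vec_eq_iff)
  have z0: "z \<noteq> 0"
  proof
    assume "z = 0"
    obtain M' where "M' ** M = mat 1" using assms(2) invertible_def by blast
    then have "complex_matrix M' ** ?A = mat 1"
      by (simp only: complex_matrix_mult[symmetric] complex_matrix_mat_1)
    then have "u = complex_matrix M' *v (?A *v u)" by (simp add: matrix_vector_mul_assoc)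
    then show False using u \<open>z = 0\<close> by simp
  qed
  have "cnj z = z"
  proof (rule ccontr)
    assume ne: "cnj z \<noteq> z"
    define u' where "u' = (\<chi> i. cnj (u $ i))"
    have "?A *v u' = cnj z *s u'"
    proof -
      have "(\<Sum>j\<in>UNIV. complex_of_real (M $ i $ j) * cnj (u $ j)) = cnj z * cnj (u $ i)" for i
        using arg_cong[OF row[of i], of cnj] by simp
      then show ?thesis by (simp add: u'_def complex_matrix_def matrix_vector_mult_def vec_eq_iff)
    qed
    moreover have "u' \<noteq> 0" using u(1) by (auto simp: u'_def vec_eq_iff)
    ultimately have "eigenvalue ?A (cnj z)" by (auto simp: eigenvalue_def)
    then show False using z(3) ne by fastforce
  qed
  then obtain \<mu> where \<mu>: "z = complex_of_real \<mu>" by (metis Reals_cases Reals_cnj_iff)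
  have \<mu>0: "\<mu> \<noteq> 0" using z0 \<mu> by simp
  have "\<exists>v. v \<noteq> 0 \<and> M *v v = \<mu> *\<^sub>R v"
  proof -
    define x where "x = (\<chi> i. Re (u $ i))"
    define y where "y = (\<chi> i. Im (u $ i))"
    have "M *v x = \<mu> *\<^sub>R x"
    proof -
      have "(\<Sum>j\<in>UNIV. M $ i $ j * Re (u $ j)) = \<mu> * Re (u $ i)" for i
        using arg_cong[OF row[of i], of Re] by (simp add: \<mu>)
      then show ?thesis by (simp add: x_def matrix_vector_mult_def vec_eq_iff)
    qed
    moreover have "M *v y = \<mu> *\<^sub>R y"
    proof -
      have "(\<Sum>j\<in>UNIV. M $ i $ j * Im (u $ j)) = \<mu> * Im (u $ i)" for i
        using arg_cong[OF row[of i], of Im] by (simp add: \<mu>)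
      then show ?thesis by (simp add: y_def matrix_vector_mult_def vec_eq_iff)
    qed
    moreover have "x \<noteq> 0 \<or> y \<noteq> 0"
      using u(1) by (auto simp: x_def y_def vec_eq_iff complex_eq_iff)
    ultimately show ?thesis by blast
  qed
  then obtain v where v: "v \<noteq> 0" "M *v v = \<mu> *\<^sub>R v" by blast
  have cv: "complex_vec v \<noteq> 0" "?A *v complex_vec v = z *s complex_vec v"
    using v(1) by (auto simp: complex_matrix_vec v(2) \<mu>) (auto simp: complex_vec_def vec_eq_iff)
  have pow: "((*v) ?A ^^ k) (complex_vec x) = complex_vec (((*v) M ^^ k) x)" for k x
    by (induction k) (simp_all add: complex_matrix_vec)
  have "\<exists>s. (\<lambda>k. (1 / \<mu> ^ k) *\<^sub>R ((*v) M ^^ k) x) \<longlonglongrightarrow> s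
      *\<^sub>R v" for x
  proof -
    obtain \<phi> where \<phi>: "(\<lambda>k.
        (1 / z ^ k) *s complex_vec (((*v) M ^^ k) x)) \<longlonglongrightarrow> \<phi> *s complex_vec v"
      using dominant_powers_converge[OF z(2,3) cv, of "complex_vec x"] by (auto simp: pow)
    have "(\<lambda>k. (1 / \<mu> ^ k) *\<^sub>R ((*v) M ^^ k) x) \<longlonglongrightarrow> Re \<phi>
        *\<^sub>R v"
    proof (rule vec_tendstoI)
      fix i
      have "(\<lambda>k. Re (((1 / z ^ k) *s complex_vec (((*v) M ^^ k) x)) $ i))
          \<longlonglongrightarrow> Re ((\<phi> *s complex_vec v) $ i)"
        by (intro tendsto_Re tendsto_vec_nth \<phi>)
      moreover have "Re (((1 / z ^ k) *s complex_vec (((*v) M ^^ k) x)) $ i) =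
          ((1 / \<mu> ^ k) *\<^sub>R ((*v) M ^^ k) x) $ i" for k
      proof -
        have "((1 / z ^ k) *s complex_vec (((*v) M ^^ k) x)) $ i =
            of_real (((1 / \<mu> ^ k) *\<^sub>R ((*v) M ^^ k) x) $ i)"
          by (simp add: complex_vec_def \<mu>)
        then show ?thesis by simp
      qed
      ultimately show "(\<lambda>k. ((1 / \<mu> ^ k) *\<^sub>R ((*v) M ^^ k) x) $ i)
          \<longlonglongrightarrow> (Re \<phi> *\<^sub>R v) $ i"
        by (simp add: complex_vec_def)
    qed
    then show ?thesis by blast
  qed
  then show ?thesis using proximal_if_limits[OF \<mu>0 v] by blast
qed

section \<open>Commuting systems and irreducible systems with a proximal word\<close>

context self_affine
begin

theorem thick_if_all_commute:
  assumes "\<And>i j. i \<in> {1..l} \<Longrightarrow> j \<in> {1..l} \<Longrightarrow>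
      T i ** T j = T j ** T i"
  shows "arithmetically_thick E"
proof -
  have comm1: "fst g ** T i = T i ** fst g" if "g \<in> semigroup" "i \<in> {1..l}" for g i
    using that
  proof (induction rule: words_induct)
    case (Snoc g j)
    have "fst g ** T j ** T i = fst g ** (T i ** T j)"
      using assms Snoc by (simp flip: matrix_mul_assoc)
    then show ?case using Snoc by (simp add: matrix_mul_assoc)
  qed simp
  have comm: "fst g ** fst h = fst h ** fst g" if "g \<in> semigroup" "h \<in> semigroup" for g h
    using that(2,1)
  proof (induction rule: words_induct)
    case (Snoc h j)
    then show ?case using comm1[of g j] by (simp add: matrix_mul_assoc) (simp flip: matrix_mul_assoc)
  qed simp
  obtain b c n0 where b: "b \<in> cball 0 radius" "0 < c"
    and steer: "\<And>n e. n \<ge> n0 \<Longrightarrow>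
        \<exists>u\<in>words n. \<forall>x\<in>cball 0 radius. (act u x - b) \<bullet> e \<ge> c * norm e"
    using steering_words by blast
  show ?thesis
    by (rule thick_if_commuting[of "words (Suc n0)" b c])
      (use finite_words comm words_semigroup b steer[of "Suc n0"] in auto)
qed

text \<open>The index \<open>Suc n\<close> records that a product of generators is a nonempty word,
  hence a strict contraction with a fixed point in \<open>E\<close>.\<close>

lemma mult_semigroup_words:
  "M \<in> mult_semigroup (T ` {1..l}) \<Longrightarrow> \<exists>n. \<exists>g\<in>words (Suc n). fst g = M"
proof (induction rule: mult_semigroup.induct)
  case (generator A)
  then obtain i where "i \<in> {1..l}" "A = T i" by blast
  then show ?case using letter_words[of i] by (intro exI[of _ 0] bexI[of _ "(T i, a i)"]) auto
next
  case (product A B)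
  then obtain m g n h where "g \<in> words (Suc m)" "fst g = A" "h \<in> words (Suc n)" "fst h = B" by blast
  then show ?case
    using words_add[of g "Suc m" h "Suc n"] by (intro exI[of _ "m + Suc n"] bexI[of _ "g \<odot> h"]) auto
qed

lemma orbit_span_invariant:
  assumes "i \<in> {1..l}"
  shows "(*v) (T i) ` span ((\<lambda>g. fst g *v v) ` semigroup) \<subseteq> span ((\<lambda>g.
      fst g *v v) ` semigroup)"
proof -
  let ?S = "(\<lambda>g. fst g *v v) ` semigroup"
  have "(*v) (T i) ` ?S \<subseteq> ?S"
  proof
    fix x assume "x \<in> (*v) (T i) ` ?S"
    then obtain g where g: "g \<in> semigroup" "x = T i *v (fst g *v v)" by blast
    then have "x = fst ((T i, a i) \<odot> g) *v v" by (simp add: matrix_vector_mul_assoc)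
    moreover have "(T i, a i) \<odot> g \<in> semigroup"
      using words_semigroup[OF letter_words[OF assms]] g(1) by (rule semigroup_amult)
    ultimately show "x \<in> ?S" by blast
  qed
  then have "span ((*v) (T i) ` ?S) \<subseteq> span ?S" by (rule span_mono)
  then show ?thesis using linear_span_image[of "(*v) (T i)" ?S] by simp
qed

lemma orbit_span_self: "v \<in> span ((\<lambda>g. fst g *v v) ` semigroup)"
proof -
  have "fst (mat 1, 0) *v v \<in> (\<lambda>g. fst g *v v) ` semigroup"
    by (rule image_eqI[of _ _ "(mat 1, 0)"]) (simp_all add: words_semigroup[of _ 0])
  from span_base[OF this] show ?thesis by simp
qed

lemma orbit_span_irreducible:
  assumes "irreducible_tuple l T" "v \<noteq> 0"
  shows "span ((\<lambda>g. fst g *v v) ` semigroup) = UNIV"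
  using assms orbit_span_invariant orbit_span_self[of v] subspace_span
  unfolding irreducible_tuple_def by blast

theorem thick_if_irreducible_proximal:
  assumes "irreducible_tuple l T" "w \<in> words (Suc n)" "proximal (fst w) \<mu> v f"
  shows "arithmetically_thick E"
  using assms orbit_span_irreducible[of v] thick_if_proximal[of w n \<mu> v f]
  by (force simp: proximal_def)

end

section \<open>Irreducible systems in the plane\<close>

lemma norm_matrix_vector_le: "norm ((A :: real^'n^'m) *v x) \<le> norm A * norm x"
proof -
  have "norm (A *v x) = L2_set (\<lambda>i. \<bar>A $ i \<bullet> x\<bar>) UNIV"
    by (simp add: norm_vec_def matrix_vector_mul_component)
  also have "\<dots> \<le> L2_set (\<lambda>i. norm (A $ i) * norm x) UNIV"
    by (intro L2_set_mono Cauchy_Schwarz_ineq2) simp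
  also have "\<dots> = norm A * norm x"
    by (simp add: norm_vec_def[of A] L2_set_left_distrib)
  finally show ?thesis .
qed

text \<open>Pairing \<open>x v* A\<close> with itself moves \<open>A\<close> to the other side,
  which reduces the transposed action to the bound for \<open>A\<close>.\<close>

lemma norm_vector_matrix_le: "norm (x v* (A :: real^'n^'n)) \<le> norm A * norm x"
proof (cases "x v* A = 0")
  case False
  have "norm (x v* A) * norm (x v* A) = x \<bullet> (A *v (x v* A))"
    by (simp add: dot_lmul_matrix[symmetric] power2_norm_eq_inner[symmetric] power2_eq_square)
  also have "\<dots> \<le> norm x * (norm A * norm (x v* A))"
    using norm_cauchy_schwarz[of x] norm_matrix_vector_le[of A "x v* A"]
    by (meson mult_left_mono norm_ge_zero order_trans)
  finally have "norm (x v* A) * norm (x v* A) \<le> (norm A * norm x) * norm (x v* A)"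
    by (simp only: mult_ac)
  then show ?thesis using False by simp
qed simp

text \<open>Dimension two is expressed by naming the two indices, so that sums over the index type
  become sums of two terms.\<close>

locale two_indices =
  fixes i j :: "'n::finite"
  assumes UNIV_ij: "UNIV = {i, j}" and ij: "i \<noteq> j"
begin

lemma sum_ij: "sum h (UNIV :: 'n set) = h i + h j"
  by (simp add: UNIV_ij ij)

lemma all_ij: "(\<forall>k::'n. Q k) \<longleftrightarrow> Q i \<and> Q j"
  using UNIV_ij by (metis UNIV_I insertE singletonD)

definition det2 :: "real^'n^'n \<Rightarrow> real" where
  "det2 A = A $ i $ i * A $ j $ j - A $ i $ j * A $ j $ i"

definition tr2 :: "real^'n^'n \<Rightarrow> real" where
  "tr2 A = A $ i $ i + A $ j $ j"

definition cross :: "real^'n \<Rightarrow> real^'n \<Rightarrow> real" where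
  "cross u v = u $ i * v $ j - u $ j * v $ i"

definition rot :: "real^'n \<Rightarrow> real^'n" where
  "rot u = (\<chi> k. if k = i then - u $ j else u $ i)"

lemma det2_mult: "det2 (A ** B) = det2 A * det2 B"
  by (simp add: det2_def matrix_matrix_mult_def sum_ij algebra_simps)

lemma det2_mat_1: "det2 (mat 1) = 1"
  using ij by (simp add: det2_def mat_def)

lemma det2_nonzero: "invertible A \<Longrightarrow> det2 A \<noteq> 0"
  using det2_mult det2_mat_1 unfolding invertible_def by (metis mult_zero_left zero_neq_one)

lemma norm_sq: "(norm u)\<^sup>2 = (u $ i)\<^sup>2 + (u $ j)\<^sup>2"
  unfolding power2_norm_eq_inner inner_vec_def sum_ij by (simp add: power2_eq_square)

lemma norm_rot: "norm (rot u) = norm u"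
proof -
  have "(norm (rot u))\<^sup>2 = (norm u)\<^sup>2" using ij by (simp add: norm_sq rot_def)
  then show ?thesis by simp
qed

lemma inner_rot: "u \<bullet> rot u = 0"
  using ij by (simp add: inner_vec_def sum_ij rot_def)

lemma cross_rot: "cross u (rot u) = (norm u)\<^sup>2"
  using ij norm_sq[of u] by (simp add: cross_def rot_def power2_eq_square)

lemma cross_inner: "cross u v = rot u \<bullet> v"
  using ij by (simp add: cross_def rot_def inner_vec_def sum_ij)

lemma abs_cross_le: "\<bar>cross u v\<bar> \<le> norm u * norm v"
  using Cauchy_Schwarz_ineq2[of "rot u" v] by (simp add: cross_inner norm_rot)

lemma cross_zero_parallel:
  assumes "cross u v = 0" "u \<noteq> 0"
  shows "\<exists>s. v = s *\<^sub>R u"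
proof -
  have "v = ((u \<bullet> v) / (u \<bullet> u)) *\<^sub>R u"
  proof -
    have "(u \<bullet> u) *\<^sub>R v = (u \<bullet> v) *\<^sub>R u"
      using assms(1) by (simp add: vec_eq_iff all_ij inner_vec_def sum_ij cross_def algebra_simps)
    then show ?thesis using assms(2)
      by (metis inner_eq_zero_iff scaleR_left_imp_eq divide_inverse_commute scaleR_scaleR
          right_inverse scaleR_one)
  qed
  then show ?thesis by blast
qed

lemma cross_basis:
  assumes "cross u v \<noteq> 0"
  shows "\<exists>s t. x = s *\<^sub>R u + t *\<^sub>R v"
proof -
  have "cross u v *\<^sub>R x = cross x v *\<^sub>R u + cross u x *\<^sub>R v"
    by (simp add: vec_eq_iff all_ij cross_def algebra_simps)
  then have "(1 / cross u v) *\<^sub>R (cross u v *\<^sub>R x) =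
      (1 / cross u v) *\<^sub>R (cross x v *\<^sub>R u + cross u x *\<^sub>R v)"
    by simp
  then have "x = (cross x v / cross u v) *\<^sub>R u + (cross u x / cross u v) *\<^sub>R v"
    using assms by (simp add: scaleR_add_right)
  then show ?thesis by blast
qed

lemma cross_left_mult: "cross (u v* A) (v v* A) = det2 A * cross u v"
  by (simp add: cross_def det2_def vector_matrix_mult_def sum_ij algebra_simps)

text \<open>The rows are proportional, so the rotation of a nonzero row is orthogonal to
  both.\<close>

lemma singular_kernel:
  assumes "det2 A = 0"
  shows "\<exists>v. v \<noteq> 0 \<and> A *v v = 0"
proof -
  have sol: "A *v rot (A $ k) = 0" for k
  proof -
    have "k = i \<or> k = j" using UNIV_ij by blast
    then show ?thesis
      using assms ij by (auto simp: vec_eq_iff all_ij matrix_vector_mult_def sum_ij rot_def det2_def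
          algebra_simps)
  qed
  show ?thesis
  proof (cases "A = 0")
    case True
    then show ?thesis by (intro exI[of _ "axis i 1"]) (simp add: axis_eq_0_iff)
  next
    case False
    then obtain k where "A $ k \<noteq> 0" by (auto simp: vec_eq_iff)
    then have "rot (A $ k) \<noteq> 0" using norm_rot by (metis norm_eq_zero)
    then show ?thesis using sol by blast
  qed
qed

text \<open>The eigenvectors form a basis, in which the second coordinate of the normalised iterates
  decays like \<open>(\<kappa> / \<mu>) ^ k\<close>.\<close>

lemma proximal_if_two_eigenvectors:
  fixes M :: "real^'n^'n"
  assumes "v \<noteq> 0" "M *v v = \<mu> *\<^sub>R v" "u \<noteq> 0" "M *v u =
      \<kappa> *\<^sub>R u" "\<bar>\<kappa>\<bar> < \<bar>\<mu>\<bar>"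
  shows "\<exists>f. proximal M \<mu> v f"
proof (rule proximal_if_limits)
  show m0: "\<mu> \<noteq> 0" using assms(5) by auto
  show "v \<noteq> 0" "M *v v = \<mu> *\<^sub>R v" by fact+
  have "cross v u \<noteq> 0"
  proof
    assume "cross v u = 0"
    then obtain s where s: "u = s *\<^sub>R v" using cross_zero_parallel assms(1) by blast
    then have "\<kappa> *\<^sub>R u = \<mu> *\<^sub>R u"
        using assms(2,4) by (auto simp: matrix_vector_mult_scaleR mult.commute)
    then show False using assms(3,5) by simp
  qed
  fix x :: "real^'n"
  obtain s t where x: "x = s *\<^sub>R v + t *\<^sub>R u"
      using cross_basis[OF \<open>cross v u \<noteq> 0\<close>] by blast
  have pow: "((*v) M ^^ k) v = \<mu> ^ k *\<^sub>R v" "((*v) M ^^ k) u = \<kappa> ^ k *\<^sub>R u" for k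
    by (induction k) (simp_all add: assms(2,4) matrix_vector_mult_scaleR mult.commute)
  have "((*v) M ^^ k) x = (s * \<mu> ^ k) *\<^sub>R v + (t * \<kappa> ^ k) *\<^sub>R u" for k
    unfolding x by (simp add: linear_add[OF linear_funpow_matrix] linear_scale[OF linear_funpow_matrix] pow)
  then have eq: "(1 / \<mu> ^ k) *\<^sub>R ((*v) M ^^ k) x =
      s *\<^sub>R v + ((\<kappa> / \<mu>) ^ k * t) *\<^sub>R u" for k
    using m0 by (simp add: scaleR_add_right power_divide mult.commute)
  have "(\<lambda>k. s *\<^sub>R v +
      ((\<kappa> / \<mu>) ^ k * t) *\<^sub>R u) \<longlonglongrightarrow> s *\<^sub>R v + (0 * t) *\<^sub>R u"
    using assms(5) m0 by (intro tendsto_intros LIMSEQ_power_zero) simp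
  then show "\<exists>s. (\<lambda>k.
      (1 / \<mu> ^ k) *\<^sub>R ((*v) M ^^ k) x) \<longlonglongrightarrow> s *\<^sub>R v"
    unfolding eq by auto
qed

text \<open>Were the inequality violated, the discriminant would be positive and the trace nonzero;
  then the two eigenvalues are real and, being placed symmetrically about half the trace, differ in
  modulus.\<close>

lemma trace_le_if_not_proximal:
  assumes "\<nexists>\<mu> v f. proximal M \<mu> v f"
  shows "(tr2 M)\<^sup>2 \<le> 4 * \<bar>det2 M\<bar>"
proof (rule ccontr)
  assume neg: "\<not> ?thesis"
  define d where "d = sqrt ((tr2 M)\<^sup>2 - 4 * det2 M)"
  have pos: "0 < (tr2 M)\<^sup>2 - 4 * det2 M" using neg by linarith
  have d: "0 < d" "d\<^sup>2 = (tr2 M)\<^sup>2 - 4 * det2 M"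
    using pos by (simp_all add: d_def)
  have t0: "tr2 M \<noteq> 0" using neg by auto
  have ev: "\<exists>v. v \<noteq> 0 \<and>
      M *v v = r *\<^sub>R v" if "r = (tr2 M + d) / 2 \<or> r = (tr2 M - d) / 2" for r
  proof -
    have "2 * r - tr2 M = d \<or> 2 * r - tr2 M = - d" using that by auto
    then have "(2 * r - tr2 M)\<^sup>2 = d\<^sup>2" by (metis power2_minus)
    moreover have "4 * (r\<^sup>2 - tr2 M * r + det2 M) =
        (2 * r - tr2 M)\<^sup>2 - ((tr2 M)\<^sup>2 - 4 * det2 M)"
      by (simp add: power2_eq_square algebra_simps)
    ultimately have "4 * (r\<^sup>2 - tr2 M * r + det2 M) = 0" using d(2) by simp
    moreover have "det2 (M - r *\<^sub>R mat 1) = r\<^sup>2 - tr2 M * r + det2 M"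
      using ij by (simp add: det2_def tr2_def mat_def power2_eq_square algebra_simps)
    ultimately have "det2 (M - r *\<^sub>R mat 1) = 0" by simp
    then obtain v where "v \<noteq> 0" "(M - r *\<^sub>R mat 1) *v v = 0" using singular_kernel by blast
    then show ?thesis
      by (auto simp: matrix_vector_mult_diff_rdistrib scaleR_matrix_vector_assoc[symmetric])
  qed
  have "\<exists>\<mu> \<kappa>. \<bar>\<kappa>\<bar> < \<bar>\<mu>\<bar> \<and>
      {\<mu>, \<kappa>} = {(tr2 M + d) / 2, (tr2 M - d) / 2}"
  proof (cases "0 < tr2 M")
    case True
    then show ?thesis using d(1)
      by (intro exI[of _ "(tr2 M + d) / 2"] exI[of _ "(tr2 M - d) / 2"]) auto
  next
    case False
    then show ?thesis using d(1) t0
      by (intro exI[of _ "(tr2 M - d) / 2"] exI[of _ "(tr2 M + d) / 2"]) auto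
  qed
  then obtain \<mu> \<kappa> where mk: "\<bar>\<kappa>\<bar> < \<bar>\<mu>\<bar>" "{\<mu>, \<kappa>} =
      {(tr2 M + d) / 2, (tr2 M - d) / 2}" by blast
  then obtain v u where "v \<noteq> 0" "M *v v = \<mu> *\<^sub>R v" "u \<noteq> 0" "M *v u =
      \<kappa> *\<^sub>R u"
    using ev[of \<mu>] ev[of \<kappa>] by blast
  then show False using proximal_if_two_eigenvectors mk(1) assms by blast
qed

text \<open>Such a matrix is a column \<open>u\<close> times a row \<open>c\<close>, and the trace
  of a rank-one matrix times \<open>R\<close> is a pairing. The case split picks a nonzero row as
  \<open>c\<close>.\<close>

lemma singular_rank_one:
  assumes "det2 Q = 0" "Q \<noteq> 0"
  shows "\<exists>u c. u \<noteq> 0 \<and> c \<noteq> 0 \<and>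
      (\<forall>R. tr2 (Q ** R) = c \<bullet> (R *v u))"
proof (cases "Q $ i = 0")
  case True
  then have "Q $ j \<noteq> 0" using assms(2) by (auto simp: vec_eq_iff[of Q] all_ij)
  moreover have "tr2 (Q ** R) = Q $ j \<bullet> (R *v axis j 1)" for R
    using True ij by (simp add: tr2_def matrix_matrix_mult_def matrix_vector_mult_def inner_vec_def
        sum_ij axis_def)
  ultimately show ?thesis by (intro exI[of _ "axis j 1"] exI[of _ "Q $ j"]) (simp add: axis_eq_0_iff)
next
  case False
  have "cross (Q $ i) (Q $ j) = 0" using assms(1) by (simp add: cross_def det2_def)
  then obtain s where s: "Q $ j = s *\<^sub>R Q $ i" using cross_zero_parallel False by blast
  define u where "u = (\<chi> k. if k = i then 1 else s)"
  have "tr2 (Q ** R) = Q $ i \<bullet> (R *v u)" for R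
    using s ij by (simp add: tr2_def matrix_matrix_mult_def matrix_vector_mult_def inner_vec_def
        sum_ij u_def algebra_simps)
  moreover have "u \<noteq> 0" by (auto simp: u_def vec_eq_iff)
  ultimately show ?thesis using False by blast
qed

end

section \<open>Irreducible planar systems\<close>

locale planar_affine = self_affine l T a E + two_indices i j
  for l :: nat and T :: "nat \<Rightarrow> real^'n^'n" and a :: "nat \<Rightarrow> real^'n"
      and E :: "(real^'n) set"
    and i j :: 'n
begin

text \<open>
  A limit of normalised linear parts of unbounded distortion has rank one, and the trace bound
  forces its kernel functional to vanish on the whole orbit of its image.
\<close>

lemma quasiconformal:
  assumes irr: "irreducible_tuple l T"
    and tr: "\<And>g. g \<in> semigroup \<Longrightarrow>
        (tr2 (fst g))\<^sup>2 \<le> 4 * \<bar>det2 (fst g)\<bar>"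
  shows "\<exists>c>0. \<forall>g\<in>semigroup. c * (norm (fst g))\<^sup>2 \<le> \<bar>det2 (fst g)\<bar>"
proof (rule ccontr)
  assume neg: "\<not> ?thesis"
  have "\<exists>g\<in>semigroup.
      \<bar>det2 (fst g)\<bar> < inverse (real (Suc n)) * (norm (fst g))\<^sup>2" for n
    using neg inverse_positive_iff_positive[of "real (Suc n)"]
        by (meson not_le of_nat_0_less_iff zero_less_Suc)
  then obtain g where g: "\<And>n. g n \<in> semigroup"
    "\<And>n. \<bar>det2 (fst (g n))\<bar> < inverse (real (Suc n)) * (norm (fst (g n)))\<^sup>2" by metis
  have pos: "0 < norm (fst (g n))" for n
  proof (rule ccontr)
    assume "\<not> 0 < norm (fst (g n))"
    then have "norm (fst (g n)) = 0" by simp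
    then show False using g(2)[of n] by simp
  qed
  define B where "B n = (1 / norm (fst (g n))) *\<^sub>R fst (g n)" for n
  have det_scale: "det2 (s *\<^sub>R A) = s\<^sup>2 * det2 A" for s A
    by (simp add: det2_def power2_eq_square algebra_simps)
  have detB: "\<bar>det2 (B n)\<bar> \<le> inverse (real (Suc n))" for n
    using g(2)[of n] pos[of n]
    by (simp add: B_def det_scale abs_mult power_divide divide_simps mult.commute)
  have "B n \<in> sphere 0 1" for n using pos[of n] by (simp add: B_def)
  then obtain Q r where Q: "Q \<in> sphere 0 1" "strict_mono r" "(B \<circ> r) \<longlonglongrightarrow> Q"
    using compact_sphere[of "0 :: real^'n^'n" 1] unfolding compact_def by blast
  have lim_nth: "(\<lambda>n. (B (r n) ** R) $ k $ m) \<longlonglongrightarrow> (Q ** R) $ k $ m"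
      for R :: "real^'n^'n" and k m
    unfolding matrix_matrix_mult_def using Q(3) by (auto simp: o_def intro!: tendsto_intros)
  have det_lim: "(\<lambda>n. det2 (B (r n) ** mat 1)) \<longlonglongrightarrow> det2 (Q ** mat 1)"
    unfolding det2_def by (intro tendsto_intros lim_nth)
  have inv_lim: "(\<lambda>n. inverse (real (Suc (r n)))) \<longlonglongrightarrow> 0"
    using LIMSEQ_subseq_LIMSEQ[OF LIMSEQ_inverse_real_of_nat Q(2)] by (simp add: o_def)
  have det_lim0: "(\<lambda>n. det2 (B (r n))) \<longlonglongrightarrow> 0"
    by (rule Lim_null_comparison[OF _ inv_lim]) (use detB in simp)
  then have detQ: "det2 Q = 0" using LIMSEQ_unique[OF det_lim0, of "det2 Q"] det_lim by simp
  have trQ: "tr2 (Q ** fst h) = 0" if h: "h \<in> semigroup" for h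
  proof -
    have l1: "(\<lambda>n. (tr2 (B (r n) ** fst h))\<^sup>2) \<longlonglongrightarrow> (tr2 (Q ** fst
        h))\<^sup>2"
      unfolding tr2_def by (intro tendsto_intros lim_nth)
    have l2: "(\<lambda>n. 4 * (\<bar>det2 (B (r n))\<bar>
        * \<bar>det2 (fst h)\<bar>)) \<longlonglongrightarrow> 4 * (\<bar>0\<bar> * \<bar>det2 (fst h)\<bar>)"
      by (intro tendsto_intros det_lim0)
    \<comment> \<open>The trace bound is homogeneous of degree two and thus passes to normalised
      products; along the subsequence its right-hand side tends to 0.\<close>
    have le: "(tr2 (B n ** fst h))\<^sup>2 \<le>
        4 * (\<bar>det2 (B n)\<bar> * \<bar>det2 (fst h)\<bar>)" for n
    proof -
      define s where "s = 1 / norm (fst (g n))"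
      have "B n ** fst h = s *\<^sub>R fst (g n \<odot> h)"
        by (simp add: B_def s_def scalar_matrix_assoc)
      then have "(tr2 (B n ** fst h))\<^sup>2 = s\<^sup>2 * (tr2 (fst (g n \<odot> h)))\<^sup>2"
        by (simp add: tr2_def power_mult_distrib flip: distrib_left)
      also have "\<dots> \<le> s\<^sup>2 * (4 * \<bar>det2 (fst (g n \<odot> h))\<bar>)"
        using tr[OF semigroup_amult[OF g(1) h]] by (intro mult_left_mono) auto
      also have "\<dots> = 4 * (\<bar>det2 (B n)\<bar> * \<bar>det2 (fst h)\<bar>)"
        by (simp add: B_def s_def[symmetric] det_scale det2_mult abs_mult)
      finally show ?thesis .
    qed
    have "(tr2 (Q ** fst h))\<^sup>2 \<le> 4 * (\<bar>0\<bar> * \<bar>det2 (fst h)\<bar>)"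
      by (rule LIMSEQ_le[OF l1 l2]) (use le in blast)
    then show ?thesis by simp
  qed
  have "Q \<noteq> 0" using Q(1) by auto
  then obtain u c where uc: "u \<noteq> 0" "c \<noteq> 0" "\<And>R. tr2 (Q ** R) = c \<bullet> (R *v u)"
    using singular_rank_one[OF detQ] by blast
  have "(\<lambda>g. fst g *v u) ` semigroup \<subseteq> {x. c \<bullet> x = 0}" using trQ uc(3) by auto
  then have "span ((\<lambda>g. fst g *v u) ` semigroup) \<subseteq> {x. c \<bullet> x = 0}"
    by (rule span_minimal[OF _ subspace_hyperplane])
  then have "c \<bullet> c = 0" using orbit_span_irreducible[OF irr uc(1)] by blast
  then show False using uc(2) by simp
qed

text \<open>The root \<open>N\<close> of the modulus of the determinant is multiplicative, and by
  the hypothesis it controls the linear part from both sides: each is a similarity up to the factor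
  \<open>C\<close>. The wanted direction is pulled back by the current linear part and steered for
  there; powers of one letter bring \<open>N\<close> into the next window.\<close>

lemma thick_if_quasiconformal:
  assumes c0: "0 < c0" "\<And>g. g \<in> semigroup \<Longrightarrow>
      c0 * (norm (fst g))\<^sup>2 \<le> \<bar>det2 (fst g)\<bar>"
  shows "arithmetically_thick E"
proof -
  define N where "N g = sqrt \<bar>det2 (fst g)\<bar>" for g :: "(real^'n^'n) \<times> (real^'n)"
  have N_mult: "N (g \<odot> h) = N g * N h" for g h
    by (simp add: N_def det2_mult abs_mult real_sqrt_mult)
  have N_pos: "0 < N g" if "g \<in> semigroup" for g
    using det2_nonzero[OF invertible_semigroup[OF that]] by (simp add: N_def)
  have N_sq: "(N g)\<^sup>2 = \<bar>det2 (fst g)\<bar>" for g by (simp add: N_def)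
  define C where "C = 1 / sqrt c0"
  have C: "0 < C" using c0 by (simp add: C_def)
  have norm_le: "norm (fst g) \<le> C * N g" if "g \<in> semigroup" for g
  proof -
    have "(norm (fst g))\<^sup>2 \<le> (C * N g)\<^sup>2"
      using c0(2)[OF that] c0(1) by (simp add: C_def N_sq field_simps)
    moreover have "0 \<le> C * N g" using C N_pos[OF that] by simp
    ultimately show ?thesis by (rule power2_le_imp_le)
  qed
  have lower: "N g / C * norm e \<le> norm (e v* fst g)" if g: "g \<in> semigroup" for g e
  proof (cases "e = 0")
    case False
    \<comment> \<open>The square on \<open>e\<close> and \<open>rot e\<close> has its area
      multiplied by the determinant; one side of the image is at most
      \<open>C * N g * norm e\<close> long, so the other cannot be short.\<close>
    have "(N g)\<^sup>2 * (norm e)\<^sup>2 = \<bar>cross (e v* fst g) (rot e v* fst g)\<bar>"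
      by (simp add: cross_left_mult cross_rot N_sq abs_mult)
    also have "\<dots> \<le> norm (e v* fst g) * norm (rot e v* fst g)" by (rule abs_cross_le)
    also have "\<dots> \<le> norm (e v* fst g) * (C * N g * norm e)"
      using norm_vector_matrix_le[of "rot e" "fst g"] mult_right_mono[OF norm_le[OF g], of "norm e"]
      by (intro mult_left_mono) (auto simp: norm_rot)
    finally have "(N g * norm e) * (N g * norm e) \<le> (C * norm (e v* fst g)) * (N g * norm e)"
      by (simp add: power2_eq_square mult_ac)
    then have "N g * norm e \<le> C * norm (e v* fst g)" using N_pos[OF g] False by simp
    then show ?thesis using C by (simp add: field_simps)
  qed simp
  obtain b c n0 where b: "b \<in> cball 0 radius" "0 < c"
    and steer: "\<And>n e. n \<ge> n0 \<Longrightarrow>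
        \<exists>u\<in>words n. \<forall>x\<in>cball 0 radius. (act u x - b) \<bullet> e \<ge> c * norm e"
    using steering_words by blast
  define \<nu> where "\<nu> = Min (N ` words n0)"
  have wne: "words n0 \<noteq> {}" using steer[of n0] by blast
  have \<nu>: "0 < \<nu>" "\<And>u. u \<in> words n0 \<Longrightarrow> \<nu> \<le> N u"
    using finite_words[of n0] wne N_pos words_semigroup by (auto simp: \<nu>_def)
  \<comment> \<open>At most the smallest \<open>N\<close> of the steering words, so that appending
    one never falls below the lower end of the next window.\<close>
  define \<theta> where "\<theta> = min \<nu> (1 / 2)"
  have \<theta>: "0 < \<theta>" "\<theta> < 1" "\<theta> \<le> \<nu>" using \<nu> by (auto simp: \<theta>_def)
  define w where "w = (T 1, a 1)"
  have w: "w \<in> words 1" "w \<in> semigroup"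
    using letter_words[OF letter_exists] words_semigroup by (auto simp: w_def)
  define \<tau> where "\<tau> = N w"
  have \<tau>: "0 < \<tau>" "\<tau> < 1"
  proof -
    show "0 < \<tau>" using N_pos w by (simp add: \<tau>_def)
    \<comment> \<open>Hadamard's inequality: each column of the matrix has length at most
      \<open>ratio\<close>.\<close>
    have "\<bar>det2 (fst w)\<bar> = \<bar>cross (fst w *v axis i 1) (fst w *v axis j 1)\<bar>"
      using ij by (simp add: cross_def det2_def matrix_vector_mult_def sum_ij axis_def algebra_simps)
    also have "\<dots> \<le> norm (fst w *v axis i 1) * norm (fst w *v axis j 1)" by (rule abs_cross_le)
    also have "\<dots> \<le> ratio * ratio"
      using norm_words[OF w(1), of "axis i 1"] norm_words[OF w(1), of "axis j 1"] ratio
      by (intro mult_mono) auto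
    also have "\<dots> < 1 * 1" using ratio by (intro mult_strict_mono') auto
    finally show "\<tau> < 1" by (simp add: \<tau>_def N_def)
  qed
  have pw: "apow w m \<in> semigroup" "N (apow w m) = \<tau> ^ m" for m
    by (induction m) (auto simp: w semigroup_amult N_mult \<tau>_def words_semigroup[of _ 0] N_def[of
        "(mat 1, 0)"] det2_mat_1)
  define P where "P k x \<longleftrightarrow> (\<exists>g\<in>semigroup. x = act g b \<and>
      \<tau> * \<theta> ^ k \<le> N g \<and> N g \<le> \<theta> ^ k)" for k x
  define h where "h = C * (2 * radius)"
  have "\<exists>N\<ge>1. interior (sum_power N E) \<noteq> {}"
  proof (rule interior_sum_power_steered[where G = "\<lambda>k x. \<theta> ^ k *\<^sub>R x" and D =
      "(*\<^sub>R) \<theta>" and D' = "(*\<^sub>R) (1 / \<theta>)"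
        and \<eta> = "\<lambda>k. \<theta> ^ k" and P = P and h = h and c = "c * \<tau> / C"])
    show "linear (\<lambda>x :: real^'n. \<theta> ^ k *\<^sub>R x)" for k
        by (simp add: linear_iff algebra_simps)
    show "\<theta> ^ Suc k *\<^sub>R x =
        \<theta> ^ k *\<^sub>R \<theta> *\<^sub>R x" for k and x :: "real^'n" by (simp add: mult_ac)
    show "inj (\<lambda>x :: real^'n. \<theta> ^ 0 *\<^sub>R x)" by (simp add: inj_on_def)
    show "linear ((*\<^sub>R) (1 / \<theta>) :: real^'n \<Rightarrow> real^'n)"
        by (simp add: linear_iff algebra_simps)
    show "\<theta> *\<^sub>R (1 / \<theta>) *\<^sub>R x = x" for x :: "real^'n" using \<theta> by simp
    show "norm (\<theta> ^ k *\<^sub>R x) \<le> \<theta> ^ k * norm x" for k and x :: "real^'n"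
        using \<theta> by simp
    show "(\<lambda>k. \<theta> ^ k) \<longlonglongrightarrow> 0"
        using \<theta> by (intro LIMSEQ_power_zero) simp
    show "0 < c * \<tau> / C" using b \<tau> C by simp
    show "compact E" by (rule compact_E)
    show "P 0 b" unfolding P_def
      by (intro bexI[of _ "(mat 1, 0)"]) (use \<tau> in \<open>auto simp: act_def words_semigroup[of _
          0] N_def det2_mat_1\<close>)
    show "\<exists>y\<in>E. norm (y - x) \<le> \<theta> ^ k * h" if "P k x" for k x
    proof -
      obtain g where g: "g \<in> semigroup" "x = act g b" "N g \<le> \<theta> ^ k"
          using \<open>P k x\<close> P_def by blast
      obtain p where p: "p \<in> E" using E_nonempty by blast
      have "norm (p - b) \<le> 2 * radius"
        using norm_triangle_ineq4[of p b] b(1) p radius(2) by fastforce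
      then have "norm (fst g) * norm (p - b) \<le> C * \<theta> ^ k * (2 * radius)"
        using order_trans[OF norm_le[OF g(1)] mult_left_mono[OF g(3) less_imp_le[OF C]]] C \<theta>
            by (intro mult_mono) auto
      then have "norm (act g p - x) \<le> \<theta> ^ k * h"
        using norm_matrix_vector_le[of "fst g" "p - b"] g(2) by (simp add: act_diff h_def mult_ac)
      then show ?thesis using act_E[OF g(1) p] by blast
    qed
    show "\<exists>m. P (Suc k) (x + \<theta> ^ k *\<^sub>R m) \<and> norm m \<le> h \<and>
        c * \<tau> / C * norm e \<le> m \<bullet> e"
      if "P k x" for k x e
    proof -
      obtain g where g: "g \<in> semigroup" "x = act g b" "\<tau> * \<theta> ^ k \<le> N g" "N g \<le>
          \<theta> ^ k"
        using \<open>P k x\<close> P_def by blast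
      have tk: "0 < \<theta> ^ k" using \<theta> by simp
      obtain u where u: "u \<in> words n0"
        "\<And>x. x \<in> cball 0 radius \<Longrightarrow>
            (act u x - b) \<bullet> (e v* fst g) \<ge> c * norm (e v* fst g)"
        using steer[of n0 "e v* fst g"] by blast
      have usg: "u \<in> semigroup" using u(1) words_semigroup by blast
      have "\<exists>m. \<tau> * (\<theta> * \<theta> ^ k) \<le> N (g \<odot> u) * \<tau> ^ m \<and>
          N (g \<odot> u) * \<tau> ^ m \<le> \<theta> * \<theta> ^ k"
      proof (rule calibrate)
        have "(\<tau> * \<theta> ^ k) * \<theta> \<le> N g * N u"
          using g(3) \<nu>(2)[OF u(1)] \<theta> tk \<tau> N_pos[OF g(1)] by (intro mult_mono) auto
        then show "\<tau> * (\<theta> * \<theta> ^ k) \<le> N (g \<odot> u) * \<tau> ^ 0"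
            by (simp add: N_mult mult_ac)
        have "(\<lambda>m. N (g \<odot> u) * \<tau> ^ m) \<longlonglongrightarrow> N (g \<odot> u) * 0"
          using \<tau> by (intro tendsto_intros LIMSEQ_power_zero) simp
        then show "(\<lambda>m. N (g \<odot> u) * \<tau> ^ m) \<longlonglongrightarrow> 0" by simp
      qed (use \<theta> tk \<tau> in auto)
      then obtain m where m: "\<tau> * (\<theta> * \<theta> ^ k) \<le>
          N (g \<odot> u) * \<tau> ^ m" "N (g \<odot> u) * \<tau> ^ m \<le> \<theta> * \<theta> ^ k"
        by blast
      define v where "v = u \<odot> apow w m"
      have v: "v \<in> semigroup" using usg pw by (simp add: v_def semigroup_amult)
      have Nv: "N (g \<odot> v) = N (g \<odot> u) * \<tau> ^ m" by (simp add: v_def N_mult pw)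
      define y where "y = act v b - b"
      define z where "z = (1 / \<theta> ^ k) *\<^sub>R (fst g *v y)"
      have "act (g \<odot> v) b = x + \<theta> ^ k *\<^sub>R z"
        using act_diff[of g "act v b" b] g(2) \<theta>(1) by (simp add: z_def y_def diff_eq_eq add.commute)
      then have "P (Suc k) (x + \<theta> ^ k *\<^sub>R z)"
        unfolding P_def using m Nv semigroup_amult[OF g(1) v]
        by (intro bexI[of _ "g \<odot> v"]) auto
      moreover have "norm z \<le> h"
      proof -
        have "norm y \<le> 2 * radius"
          using norm_triangle_ineq4[of "act v b" b] act_ball[OF v b(1)] b(1) by (simp add: y_def)
        then have "norm (fst g) * norm y \<le> C * \<theta> ^ k * (2 * radius)"
          using order_trans[OF norm_le[OF g(1)] mult_left_mono[OF g(4) less_imp_le[OF C]]] C \<theta>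
              by (intro mult_mono) auto
        then have "norm (fst g *v y) \<le> \<theta> ^ k * h"
          using norm_matrix_vector_le[of "fst g" y] by (simp add: h_def mult_ac)
        then show ?thesis using \<theta>(1) by (simp add: z_def field_simps)
      qed
      moreover have "c * \<tau> / C * norm e \<le> z \<bullet> e"
      proof -
        have "act v b - b = act u (act (apow w m) b) - b" by (simp add: v_def)
        then have "c * norm (e v* fst g) \<le> y \<bullet> (e v* fst g)"
          using u(2)[OF act_ball[OF pw(1) b(1)], of m] by (simp add: y_def)
        moreover have "c * ((\<tau> * \<theta> ^ k) / C * norm e) \<le> c * norm (e v* fst g)"
        proof (rule mult_left_mono)
          have "(\<tau> * \<theta> ^ k) / C * norm e \<le> N g / C * norm e"
            using g(3) C by (intro mult_right_mono divide_right_mono) auto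
          then show "(\<tau> * \<theta> ^ k) / C * norm e \<le> norm (e v* fst g)"
              using lower[OF g(1), of e] by linarith
        qed (use b in auto)
        moreover have "y \<bullet> (e v* fst g) = (fst g *v y) \<bullet> e"
          by (simp only: inner_commute[of y] inner_commute[of _ e] dot_lmul_matrix)
        ultimately have "c * ((\<tau> * \<theta> ^ k) / C * norm e) \<le> (fst g *v y) \<bullet> e" by simp
        then have "(1 / \<theta> ^ k) * (c * ((\<tau> * \<theta> ^ k) / C * norm e)) \<le>
            (1 / \<theta> ^ k) * ((fst g *v y) \<bullet> e)"
          using tk by (intro mult_left_mono) auto
        then show ?thesis using \<theta>(1) by (simp add: z_def)
      qed
      ultimately show ?thesis by blast
    qed
  qed
  then show ?thesis by (intro interior_sum_power_thick[OF compact_E, of 1]) (simp_all only: sum_power_1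
      order_refl)
qed

theorem thick_if_irreducible:
  assumes irr: "irreducible_tuple l T"
  shows "arithmetically_thick E"
proof (cases "\<exists>n w \<mu> v f. w \<in> words (Suc n) \<and> proximal (fst w) \<mu> v f")
  case True
  then show ?thesis using thick_if_irreducible_proximal[OF irr] by blast
next
  case False
  have "(tr2 (fst g))\<^sup>2 \<le> 4 * \<bar>det2 (fst g)\<bar>" if "g \<in> semigroup" for g
  proof -
    obtain n where n: "g \<in> words n" using semigroup_words \<open>g \<in> semigroup\<close> by blast
    show ?thesis
    proof (cases n)
      case 0
      \<comment> \<open>The empty word is the identity, for which the bound is an equality.\<close>
      then show ?thesis using n ij by (simp add: tr2_def det2_mat_1) (simp add: mat_def)
    next
      case (Suc m)
      then show ?thesis using False n by (intro trace_le_if_not_proximal) blast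
    qed
  qed
  then show ?thesis using quasiconformal[OF irr] thick_if_quasiconformal by blast
qed

end

section \<open>Triangular systems in the plane\<close>

locale triangular_affine = planar_affine l T a E i j
  for l :: nat and T :: "nat \<Rightarrow> real^'n^'n" and a :: "nat \<Rightarrow> real^'n"
      and E :: "(real^'n) set"
    and i j :: 'n +
  fixes e f :: "real^'n"
  assumes ee: "e \<bullet> e = 1" and ff: "f \<bullet> f = 1" and ef: "e \<bullet> f = 0"
    and decomp: "x = (e \<bullet> x) *\<^sub>R e + (f \<bullet> x) *\<^sub>R f"
    and eigen: "k \<in> {1..l} \<Longrightarrow> \<exists>s. T k *v e = s *\<^sub>R e"
begin

text \<open>In the basis \<open>e\<close>, \<open>f\<close> the linear part is upper triangular with
  diagonal \<open>ca\<close>, \<open>cd\<close> and shear \<open>cb\<close>. The projection to the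
  axis of \<open>f\<close> is the affine map of slope \<open>cd\<close> and translation
  \<open>cy\<close>.\<close>

definition ca :: "(real^'n^'n) \<times> (real^'n) \<Rightarrow> real" where "ca g = e \<bullet> (fst g *v e)"
definition cb :: "(real^'n^'n) \<times> (real^'n) \<Rightarrow> real" where "cb g = e \<bullet> (fst g *v f)"
definition cd :: "(real^'n^'n) \<times> (real^'n) \<Rightarrow> real" where "cd g = f \<bullet> (fst g *v f)"
definition cy :: "(real^'n^'n) \<times> (real^'n) \<Rightarrow> real" where "cy g = f \<bullet> snd g"

lemma fe: "f \<bullet> e = 0"
  using ef by (simp add: inner_commute)

lemma norms: "norm e = 1" "norm f = 1"
  using ee ff by (simp_all add: norm_eq_sqrt_inner)

lemma eigen_semigroup: "g \<in> semigroup \<Longrightarrow> fst g *v e = ca g *\<^sub>R e"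
proof -
  assume "g \<in> semigroup"
  then have "\<exists>s. fst g *v e = s *\<^sub>R e"
  proof (induction rule: words_induct)
    case Nil
    then show ?case by (intro exI[of _ 1]) simp
  next
    case (Snoc g k)
    then obtain s t where "fst g *v e = s *\<^sub>R e" "T k *v e = t *\<^sub>R e" using eigen by blast
    then show ?case
      by (intro exI[of _ "t * s"]) (simp add: matrix_vector_mul_assoc[symmetric] matrix_vector_mult_scaleR)
  qed
  then show ?thesis by (auto simp: ca_def ee)
qed

lemma f_image: "fst g *v f = cb g *\<^sub>R e + cd g *\<^sub>R f"
  using decomp[of "fst g *v f"] by (simp add: cb_def cd_def)

lemma image_coords: "g \<in> semigroup \<Longrightarrow>
  fst g *v x = (ca g * (e \<bullet> x) + cb g * (f \<bullet> x)) *\<^sub>R e +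
      (cd g * (f \<bullet> x)) *\<^sub>R f"
proof -
  assume g: "g \<in> semigroup"
  have "fst g *v x = fst g *v ((e \<bullet> x) *\<^sub>R e + (f \<bullet> x) *\<^sub>R f)"
      using decomp[of x] by simp
  then show ?thesis
    by (simp add: matrix_vector_right_distrib matrix_vector_mult_scaleR eigen_semigroup[OF g] f_image
        algebra_simps)
qed

lemma ca_mult: "g \<in> semigroup \<Longrightarrow> h \<in> semigroup \<Longrightarrow>
    ca (g \<odot> h) = ca g * ca h"
  by (simp add: ca_def[of "g \<odot> h"] matrix_vector_mul_assoc[symmetric] eigen_semigroup
      matrix_vector_mult_scaleR ee)

lemma cd_mult: "g \<in> semigroup \<Longrightarrow> h \<in> semigroup \<Longrightarrow>
    cd (g \<odot> h) = cd g * cd h"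
  by (simp add: cd_def[of "g \<odot> h"] matrix_vector_mul_assoc[symmetric] f_image image_coords
      inner_add_right ee ef fe ff)

lemma cb_mult: "g \<in> semigroup \<Longrightarrow> h \<in> semigroup \<Longrightarrow>
    cb (g \<odot> h) = ca g * cb h + cb g * cd h"
  by (simp add: cb_def[of "g \<odot> h"] matrix_vector_mul_assoc[symmetric] f_image image_coords
      inner_add_right ee ef fe ff)

lemma f_act: "g \<in> semigroup \<Longrightarrow> f \<bullet> act g x = cd g * (f \<bullet> x) + cy g"
  by (simp add: act_def inner_add_right image_coords fe ff cy_def)

lemma cy_mult: "g \<in> semigroup \<Longrightarrow> h \<in> semigroup \<Longrightarrow>
    cy (g \<odot> h) = cd g * cy h + cy g"
  by (simp add: cy_def amult_def inner_add_right image_coords fe ff)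

lemma ca_nonzero: "g \<in> semigroup \<Longrightarrow> ca g \<noteq> 0"
proof
  assume g: "g \<in> semigroup" "ca g = 0"
  obtain A' where "A' ** fst g = mat 1" using invertible_semigroup[OF g(1)] invertible_def by blast
  then have "e = A' *v (fst g *v e)" by (simp add: matrix_vector_mul_assoc)
  then have "e = 0" using eigen_semigroup[OF g(1)] g(2) by simp
  then show False using ee by simp
qed

lemma cd_nonzero: "g \<in> semigroup \<Longrightarrow> cd g \<noteq> 0"
proof
  assume g: "g \<in> semigroup" "cd g = 0"
  define x where "x = f - (cb g / ca g) *\<^sub>R e"
  obtain A' where "A' ** fst g = mat 1" using invertible_semigroup[OF g(1)] invertible_def by blast
  then have "x = A' *v (fst g *v x)" by (simp add: matrix_vector_mul_assoc)
  moreover have "fst g *v x = 0"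
    using ca_nonzero[OF g(1)] g(2)
    by (simp add: x_def image_coords[OF g(1)] inner_diff_right ee ef fe ff)
  ultimately have "x = 0" by simp
  then have "f \<bullet> x = 0" by simp
  then show False by (simp add: x_def inner_diff_right fe ff)
qed

lemma abs_ca_less_1: "g \<in> words (Suc n) \<Longrightarrow> \<bar>ca g\<bar> < 1"
proof -
  assume g: "g \<in> words (Suc n)"
  have "\<bar>ca g\<bar> = norm (fst g *v e)" using eigen_semigroup[OF words_semigroup[OF g]] norms by simp
  also have "\<dots> \<le> ratio ^ Suc n" using norm_words[OF g, of e] norms by simp
  also have "\<dots> \<le> ratio ^ 1" by (rule power_decreasing) (use ratio in auto)
  finally show ?thesis using ratio(2) by simp
qed

lemma abs_cd_letter: "k \<in> {1..l} \<Longrightarrow> \<bar>cd (T k, a k)\<bar> \<le> ratio"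
proof -
  assume k: "k \<in> {1..l}"
  have "\<bar>cd (T k, a k)\<bar> \<le> norm (T k *v f)"
    using Cauchy_Schwarz_ineq2[of f "T k *v f"] norms by (simp add: cd_def)
  then show ?thesis using norm_T_le[OF k, of f] norms by simp
qed

lemma letter_semigroup: "k \<in> {1..l} \<Longrightarrow> (T k, a k) \<in> semigroup"
  using words_semigroup letter_words by blast

text \<open>The diagonals of the two products agree in any case, so only the shear can tell the
  products apart.\<close>

lemma commute_iff_cb:
  assumes "g \<in> semigroup" "h \<in> semigroup"
  shows "fst g ** fst h = fst h ** fst g \<longleftrightarrow> cb (g \<odot> h) = cb (h \<odot> g)"
proof
  assume "fst g ** fst h = fst h ** fst g"
  then show "cb (g \<odot> h) = cb (h \<odot> g)" by (simp add: cb_def)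
next
  assume eq: "cb (g \<odot> h) = cb (h \<odot> g)"
  have "fst (g \<odot> h) *v x = fst (h \<odot> g) *v x" for x
    using eq assms
    by (simp only: image_coords[OF semigroup_amult[OF assms]] image_coords[OF semigroup_amult[OF assms(2,1)]]
        ca_mult cd_mult mult.commute)
  then show "fst g ** fst h = fst h ** fst g" by (simp add: matrix_eq)
qed

text \<open>The dominant eigenvector \<open>v\<close> of \<open>w\<close> is transverse to the
  invariant line. If all letters preserved the line of \<open>v\<close> as well, they would be
  diagonal in \<open>v\<close>, \<open>e\<close> and commute; hence the orbit of \<open>v\<close>
  spans although the system is reducible.\<close>

lemma thick_if_lower_dominates:
  assumes w: "w \<in> words (Suc n)" "\<bar>ca w\<bar> < \<bar>cd w\<bar>"
    and nc: "k \<in> {1..l}" "m \<in> {1..l}" "T k ** T m \<noteq> T m ** T k"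
  shows "arithmetically_thick E"
proof -
  have wsg: "w \<in> semigroup" using words_semigroup w(1) by blast
  \<comment> \<open>The coefficient solves the eigenvector equation for \<open>cd w\<close> among
    vectors whose coordinate along \<open>f\<close> is 1.\<close>
  define v where "v = f + (cb w / (cd w - ca w)) *\<^sub>R e"
  have ne: "cd w - ca w \<noteq> 0" using w(2) by auto
  have v0: "v \<noteq> 0"
  proof
    assume "v = 0"
    then have "f \<bullet> v = 0" by simp
    then show False by (simp add: v_def inner_add_right fe ff)
  qed
  have Mv: "fst w *v v = cd w *\<^sub>R v"
  proof -
    have "ca w * (cb w / (cd w - ca w)) + cb w = cd w * (cb w / (cd w - ca w))"
      using ne by (simp add: field_simps)
    then show ?thesis
      by (simp add: v_def image_coords[OF wsg] inner_add_right ee ef fe ff scaleR_add_right)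
  qed
  have e0: "e \<noteq> 0" using ee by auto
  obtain f' where prox: "proximal (fst w) (cd w) v f'"
    using proximal_if_two_eigenvectors[OF v0 Mv e0 eigen_semigroup[OF wsg] w(2)] by blast
  have "\<exists>q\<in>{1..l}. cross v (T q *v v) \<noteq> 0"
  proof (rule ccontr)
    assume "\<not> ?thesis"
    then have "\<exists>s. T q *v v = s *\<^sub>R v" if "q \<in> {1..l}" for q
      using cross_zero_parallel v0 that by blast
    then obtain s t where s: "T k *v v = s *\<^sub>R v" "T m *v v = t *\<^sub>R v" using nc by blast
    obtain s' t' where s': "T k *v e = s' *\<^sub>R e" "T m *v e = t' *\<^sub>R e" using nc eigen by blast
    have "cross v e \<noteq> 0"
    proof
      assume "cross v e = 0"
      then obtain r where "e = r *\<^sub>R v" using cross_zero_parallel v0 by blast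
      then have "f \<bullet> e = r * (f \<bullet> v)" "e \<bullet> e = r * (e \<bullet> v)"
          by (metis inner_scaleR_right)+
      then show False using fe ee by (simp add: v_def inner_add_right fe ff)
    qed
    have "(T k ** T m) *v x = (T m ** T k) *v x" for x
    proof -
      obtain p q where "x = p *\<^sub>R v + q *\<^sub>R e"
          using cross_basis[OF \<open>cross v e \<noteq> 0\<close>] by blast
      then show ?thesis
        by (simp add: matrix_vector_mul_assoc[symmetric] matrix_vector_right_distrib
            matrix_vector_mult_scaleR s s' mult.commute)
    qed
    then show False using nc(3) by (simp add: matrix_eq)
  qed
  then obtain q where q: "q \<in> {1..l}" "cross v (T q *v v) \<noteq> 0" by blast
  let ?S = "span ((\<lambda>g. fst g *v v) ` semigroup)"
  have "x \<in> ?S" for x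
  proof -
    obtain s t where x: "x = s *\<^sub>R v + t *\<^sub>R (T q *v v)" using cross_basis[OF q(2)] by blast
    have "T q *v v \<in> ?S" using orbit_span_invariant[OF q(1)] orbit_span_self by blast
    then show ?thesis unfolding x by (intro span_add span_scale orbit_span_self)
  qed
  then have "?S = UNIV" by blast
  then show ?thesis using thick_if_proximal[OF w(1) prox] by blast
qed

text \<open>Linear parts with \<open>ca = cd\<close> are scalar plus a multiple of one nilpotent
  map, so they commute. A steering word with opposite diagonal entries is repaired by appending one
  letter of the same kind, which the estimate on the ball tolerates; hence two consecutive lengths
  in \<open>U\<close>.\<close>

lemma thick_if_diagonals_equal_modulus:
  assumes eq: "\<And>k. k \<in> {1..l} \<Longrightarrow>
      \<bar>cd (T k, a k)\<bar> = \<bar>ca (T k, a k)\<bar>"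
  shows "arithmetically_thick E"
proof -
  have eqs: "\<bar>cd g\<bar> = \<bar>ca g\<bar>" if "g \<in> semigroup" for g
    using that
  proof (induction rule: words_induct)
    case Nil
    show ?case by (simp add: cd_def ca_def ee ff)
  next
    case (Snoc g k)
    then show ?case using eq[of k] letter_semigroup by (simp add: cd_mult ca_mult abs_mult)
  qed
  obtain b c n0 where b: "b \<in> cball 0 radius" "0 < c"
    and steer: "\<And>n e. n \<ge> n0 \<Longrightarrow>
        \<exists>u\<in>words n. \<forall>x\<in>cball 0 radius. (act u x - b) \<bullet> e \<ge> c * norm e"
    using steering_words by blast
  define U where "U = {g \<in> words (Suc n0) \<union> words (Suc (Suc n0)). ca g = cd g}"
  have Usg: "g \<in> semigroup" if "g \<in> U" for g using that words_semigroup[of g] by (auto simp: U_def)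
  show ?thesis
  proof (rule thick_if_commuting[of U b c])
    show "finite U" using finite_words by (simp add: U_def)
    show "\<exists>n. u \<in> words (Suc n)" if "u \<in> U" for u using that by (auto simp: U_def)
    show "fst u ** fst v = fst v ** fst u" if "u \<in> U" "v \<in> U" for u v
    proof -
      have "ca u = cd u" "ca v = cd v" using that by (auto simp: U_def)
      then show ?thesis
        using that Usg by (subst commute_iff_cb) (auto simp: cb_mult mult.commute)
    qed
    show "\<exists>u\<in>U. \<forall>x\<in>cball 0 radius. c * norm v \<le> (act u x - b) \<bullet> v" for v
    proof -
      obtain u where u: "u \<in> words (Suc n0)" "\<And>x. x \<in> cball 0 radius \<Longrightarrow>
          c * norm v \<le> (act u x - b) \<bullet> v"
        using steer[of "Suc n0" v] by auto
      have usg: "u \<in> semigroup" using words_semigroup u(1) by blast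
      show ?thesis
      proof (cases "ca u = cd u")
        case True
        then have "u \<in> U" using u(1) by (simp add: U_def)
        then show ?thesis using u(2) by blast
      next
        case False
        have "\<exists>k\<in>{1..l}. ca (T k, a k) \<noteq> cd (T k, a k)"
        proof (rule ccontr)
          assume neg: "\<not> ?thesis"
          have "ca g = cd g" if "g \<in> semigroup" for g
            using that
          proof (induction rule: words_induct)
            case Nil
            show ?case by (simp add: cd_def ca_def ee ff)
          next
            case (Snoc g k)
            then show ?case using neg letter_semigroup by (simp add: cd_mult ca_mult)
          qed
          then show False using False usg by blast
        qed
        then obtain k where k: "k \<in> {1..l}" "ca (T k, a k) \<noteq> cd (T k, a k)" by blast
        have "ca u = - cd u" "ca (T k, a k) = - cd (T k, a k)"
          using eqs[OF usg] eqs[OF letter_semigroup[OF k(1)]] False k(2)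
              by (auto simp: abs_if split: if_splits)
        then have "ca (u \<odot> (T k, a k)) = cd (u \<odot> (T k, a k))"
          by (simp add: ca_mult cd_mult usg letter_semigroup[OF k(1)])
        then have "u \<odot> (T k, a k) \<in> U" using words_SucI[OF u(1) k(1)] by (simp add: U_def)
        moreover have "\<forall>x\<in>cball 0 radius. c * norm v \<le>
            (act (u \<odot> (T k, a k)) x - b) \<bullet> v"
          using u(2) act_ball[OF letter_semigroup[OF k(1)]] by simp
        ultimately show ?thesis by blast
      qed
    qed
  qed (use b in auto)
qed

text \<open>If all letters commuted after projection to the axis of \<open>f\<close>, they would
  share a fixed point \<open>h\<close> there. A point of \<open>E\<close> farthest from the level
  \<open>h\<close> is the image of a point of \<open>E\<close> under a letter shrinking this
  distance, so the distance is 0 and \<open>E\<close> is flat.\<close>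

lemma distinct_heights:
  shows "\<exists>k\<in>{1..l}. \<exists>m\<in>{1..l}.
      cy ((T k, a k) \<odot> (T m, a m)) \<noteq> cy ((T m, a m) \<odot> (T k, a k))"
proof (rule ccontr)
  assume neg: "\<not> ?thesis"
  define D where "D k = cd (T k, a k)" for k
  define Y where "Y k = cy (T k, a k)" for k
  have comm: "D k * Y m + Y k = D m * Y k + Y m" if "k \<in> {1..l}" "m \<in> {1..l}" for k m
    using neg that by (simp add: cy_mult letter_semigroup D_def Y_def)
  have D1: "1 - D 1 \<noteq> 0" using abs_cd_letter[OF letter_exists] ratio by (auto simp: D_def)
  define h where "h = Y 1 / (1 - D 1)"
  have Yh: "Y k = (1 - D k) * h" if "k \<in> {1..l}" for k
  proof -
    have "Y k * (1 - D 1) = Y 1 * (1 - D k)" using comm[OF letter_exists that] by (simp add: algebra_simps)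
    then show ?thesis using D1 by (simp add: h_def field_simps)
  qed
  have "continuous_on E (\<lambda>x. \<bar>f \<bullet> x - h\<bar>)" by (intro continuous_intros)
  then obtain x0 where x0: "x0 \<in> E" "\<forall>x\<in>E. \<bar>f \<bullet> x - h\<bar> \<le>
      \<bar>f \<bullet> x0 - h\<bar>"
    using continuous_attains_sup[OF compact_E E_nonempty] by blast
  obtain k z where k: "k \<in> {1..l}" "z \<in> E" "x0 = act (T k, a k) z" using x0(1) letter_E by blast
  have "f \<bullet> x0 - h = D k * (f \<bullet> z - h)"
    using f_act[OF letter_semigroup[OF k(1)], of z] Yh[OF k(1)] k(3)
    by (simp add: D_def Y_def algebra_simps)
  then have "\<bar>f \<bullet> x0 - h\<bar> = \<bar>D k\<bar> * \<bar>f \<bullet> z - h\<bar>"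
      by (simp add: abs_mult)
  also have "\<dots> \<le> ratio * \<bar>f \<bullet> x0 - h\<bar>"
    using abs_cd_letter[OF k(1)] x0(2) k(2) ratio by (intro mult_mono) (auto simp: D_def)
  finally have "(1 - ratio) * \<bar>f \<bullet> x0 - h\<bar> \<le> 0" by (simp add: algebra_simps)
  then have "f \<bullet> x0 - h = 0" using ratio by (simp add: mult_le_0_iff)
  then have "\<forall>x\<in>E. f \<bullet> x = h" using x0(2) by force
  moreover have "f \<noteq> 0" using ff by auto
  ultimately show False using not_flat by blast
qed

text \<open>Exchanging two letters changes neither diagonal entry. Some exchange alters the shear,
  by noncommutativity, and some alters the height, by \<open>distinct_heights\<close>; if neither
  does both, their concatenation does, because diagonal entries are nonzero. A common prefix, a
  power of \<open>w\<close>, preserves both differences and creates the factor 1/4.\<close>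

lemma shear_pair:
  assumes w: "w \<in> words (Suc n)" "\<bar>cd w\<bar> < \<bar>ca w\<bar>"
    and le: "\<And>g. g \<in> semigroup \<Longrightarrow> \<bar>cd g\<bar> \<le> \<bar>ca g\<bar>"
    and nc: "k \<in> {1..l}" "m \<in> {1..l}" "T k ** T m \<noteq> T m ** T k"
  shows "\<exists>N g1 g2. g1 \<in> words (Suc N) \<and> g2 \<in> words (Suc N) \<and>
      ca g1 = ca g2 \<and> cd g1 = cd g2 \<and>
    cb g1 \<noteq> cb g2 \<and> cy g1 \<noteq> cy g2 \<and> \<bar>cd g1\<bar> \<le> \<bar>ca g1\<bar> / 4"
proof -
  have wsg: "w \<in> semigroup" using words_semigroup w(1) by blast
  define L where "L q = (T q, a q)" for q
  have pair: "L p \<odot> L q \<in> words 2" if "p \<in> {1..l}" "q \<in> {1..l}" for p q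
    using words_add[OF letter_words[OF that(1)] letter_words[OF that(2)]] by (simp add: L_def numeral_2_eq_2)
  define X where "X = L k \<odot> L m"
  define Y where "Y = L m \<odot> L k"
  have sgL: "L q \<in> semigroup" if "q \<in> {1..l}" for q using letter_semigroup that by (simp add: L_def)
  have diag: "ca (L p \<odot> L q) = ca (L q \<odot> L p)" "cd (L p \<odot> L q) = cd (L q \<odot> L p)"
    if "p \<in> {1..l}" "q \<in> {1..l}" for p q
    using that by (simp_all add: ca_mult cd_mult sgL mult.commute)
  have XY: "X \<in> words 2" "Y \<in> words 2" "ca X = ca Y" "cd X = cd Y" "cb X \<noteq> cb Y"
    using pair nc diag commute_iff_cb[of "L k" "L m"] sgL by (auto simp: X_def Y_def L_def)
  obtain p q where pq: "p \<in> {1..l}" "q \<in> {1..l}" "cy (L p \<odot> L q) \<noteq> cy (L q \<odot> L p)"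
    using distinct_heights by (auto simp: L_def)
  define X' where "X' = L p \<odot> L q"
  define Y' where "Y' = L q \<odot> L p"
  have XY': "X' \<in> words 2" "Y' \<in> words 2" "ca X' = ca Y'" "cd X' = cd Y'" "cy X' \<noteq> cy Y'"
    using pair[OF pq(1,2)] pair[OF pq(2,1)] pq diag[OF pq(1,2)] by (simp_all add: X'_def Y'_def)
  have sg: "X \<in> semigroup" "Y \<in> semigroup" "X' \<in> semigroup" "Y' \<in> semigroup"
    using XY XY' words_semigroup by blast+
  have "\<exists>N h1 h2. h1 \<in> words N \<and> h2 \<in> words N \<and> ca h1 = ca h2 \<and>
      cd h1 = cd h2 \<and>
    cb h1 \<noteq> cb h2 \<and> cy h1 \<noteq> cy h2"
  proof (cases "cy X \<noteq> cy Y")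
    case True
    then show ?thesis using XY by blast
  next
    case cyeq: False
    show ?thesis
    proof (cases "cb X' \<noteq> cb Y'")
      case True
      then show ?thesis using XY' by blast
    next
      case False
      have "cb (X \<odot> X') \<noteq> cb (Y \<odot> Y')"
        using False XY(3-5) XY'(4) cd_nonzero[OF sg(4)] by (simp add: cb_mult sg)
      moreover have "cy (X \<odot> X') \<noteq> cy (Y \<odot> Y')"
        using cyeq XY(4) XY'(5) cd_nonzero[OF sg(2)] by (simp add: cy_mult sg)
      moreover have "ca (X \<odot> X') = ca (Y \<odot> Y')" "cd (X \<odot> X') = cd (Y \<odot> Y')"
        using XY XY' by (simp_all add: ca_mult cd_mult sg)
      ultimately show ?thesis
        using words_add[OF XY(1) XY'(1)] words_add[OF XY(2) XY'(2)] by blast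
    qed
  qed
  then obtain N h1 h2 where h: "h1 \<in> words N" "h2 \<in> words N" "ca h1 = ca h2" "cd h1 = cd h2"
    "cb h1 \<noteq> cb h2" "cy h1 \<noteq> cy h2" by blast
  have hsg: "h1 \<in> semigroup" "h2 \<in> semigroup" using h words_semigroup by blast+
  have asg: "apow w r \<in> semigroup" for r
    by (induction r) (auto simp: wsg semigroup_amult words_semigroup[of _ 0])
  have pow: "ca (apow w r) = ca w ^ r" "cd (apow w r) = cd w ^ r" for r
  proof (induction r)
    case 0
    show "ca (apow w 0) = ca w ^ 0" "cd (apow w 0) = cd w ^ 0" by (simp_all add: ca_def cd_def ee ff)
  next
    case (Suc r)
    then show "ca (apow w (Suc r)) = ca w ^ Suc r" "cd (apow w (Suc r)) = cd w ^ Suc r"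
      by (simp_all add: ca_mult cd_mult asg wsg)
  qed
  have caw: "0 < \<bar>ca w\<bar>" using ca_nonzero[OF wsg] by simp
  have "(\<lambda>r. (\<bar>cd w\<bar> / \<bar>ca w\<bar>) ^ Suc r) \<longlonglongrightarrow> 0"
    using w(2) caw by (intro LIMSEQ_Suc LIMSEQ_power_zero) simp
  then have "\<forall>\<^sub>F r in sequentially. (\<bar>cd w\<bar> / \<bar>ca w\<bar>) ^ Suc r < 1 / 4"
    by (rule order_tendstoD(2)) simp
  then obtain r where r: "(\<bar>cd w\<bar> / \<bar>ca w\<bar>) ^ Suc r < 1 / 4"
      by (auto simp: eventually_sequentially)
  define v where "v = apow w (Suc r)"
  have v: "v \<in> semigroup" unfolding v_def by (rule asg)
  have "\<bar>cd v\<bar> / \<bar>ca v\<bar> < 1 / 4"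
      using r by (simp add: v_def pow power_abs power_divide del: apow.simps power_Suc)
  then have v4: "\<bar>cd v\<bar> \<le> \<bar>ca v\<bar> / 4"
      using ca_nonzero[OF v] by (simp add: field_simps)
  obtain M where M: "v \<in> words (Suc M)" using apow_words[OF w(1), of "Suc r"] unfolding v_def by blast
  have "v \<odot> h1 \<in> words (Suc (M + N))" "v \<odot> h2 \<in> words (Suc (M + N))"
    using words_add[OF M h(1)] words_add[OF M h(2)] by simp_all
  moreover have "ca (v \<odot> h1) = ca (v \<odot> h2)" "cd (v \<odot> h1) = cd (v \<odot> h2)"
    using h by (simp_all add: ca_mult cd_mult v hsg)
  moreover have "cb (v \<odot> h1) \<noteq> cb (v \<odot> h2)" "cy (v \<odot> h1) \<noteq> cy (v \<odot> h2)"
    using h ca_nonzero[OF v] cd_nonzero[OF v] by (simp_all add: cb_mult cy_mult v hsg)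
  moreover have "\<bar>cd (v \<odot> h1)\<bar> \<le> \<bar>ca (v \<odot> h1)\<bar> / 4"
  proof -
    have "\<bar>cd v\<bar> * \<bar>cd h1\<bar> \<le> (\<bar>ca v\<bar> / 4) * \<bar>ca h1\<bar>"
      using v4 le[OF hsg(1)] by (intro mult_mono) auto
    then show ?thesis by (simp add: ca_mult cd_mult v hsg abs_mult)
  qed
  ultimately show ?thesis by blast
qed

end

text \<open>The second term is weighted by so small an \<open>r\<close> that its part
  \<open>q * s\<close> is absorbed by half of the first term. One constant serves all admissible
  \<open>\<kappa>\<close> and \<open>q\<close>, hence all levels.\<close>

lemma sum_abs_shear_ge:
  fixes p z P :: real
  assumes "0 < p" "z \<noteq> 0" "0 \<le> P"
  shows "\<exists>c>0. \<forall>\<kappa> q s t. p \<le> \<bar>\<kappa>\<bar> \<longrightarrow>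
      \<bar>q\<bar> \<le> P \<longrightarrow> c * (\<bar>s\<bar> + \<bar>t\<bar>) \<le>
      \<bar>\<kappa> * s\<bar> + \<bar>q * s + z * t\<bar>"
proof -
  define r where "r = min 1 (p / (2 * P + 1))"
  have r: "0 < r" "r \<le> 1" "r * P \<le> p / 2"
  proof -
    show "0 < r" "r \<le> 1" using assms by (auto simp: r_def)
    have "r * P \<le> p / (2 * P + 1) * P" using assms by (intro mult_right_mono) (auto simp: r_def)
    also have "\<dots> \<le> p / 2" using assms by (simp add: field_simps)
    finally show "r * P \<le> p / 2" .
  qed
  define c where "c = min (p / 2) (r * \<bar>z\<bar>)"
  have "c * (\<bar>s\<bar> + \<bar>t\<bar>) \<le> \<bar>\<kappa> * s\<bar> + \<bar>q * s + z * t\<bar>"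
    if "p \<le> \<bar>\<kappa>\<bar>" "\<bar>q\<bar> \<le> P" for \<kappa> q s t
  proof -
    have "\<bar>z * t\<bar> - \<bar>q * s\<bar> \<le> \<bar>q * s + z * t\<bar>" by linarith
    then have "r * (\<bar>z * t\<bar> - \<bar>q * s\<bar>) \<le> r * \<bar>q * s + z * t\<bar>"
        using r by (intro mult_left_mono) auto
    also have "\<dots> \<le> 1 * \<bar>q * s + z * t\<bar>" using r by (intro mult_right_mono) auto
    finally have 1: "r * \<bar>z\<bar> * \<bar>t\<bar> - r * (\<bar>q\<bar> * \<bar>s\<bar>) \<le>
        \<bar>q * s + z * t\<bar>"
      by (simp add: abs_mult algebra_simps)
    have "r * (\<bar>q\<bar> * \<bar>s\<bar>) \<le> r * (P * \<bar>s\<bar>)"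
        using that r by (intro mult_left_mono mult_right_mono) auto
    also have "\<dots> \<le> p / 2 * \<bar>s\<bar>"
        using mult_right_mono[OF r(3), of "\<bar>s\<bar>"] by (simp add: mult.assoc)
    finally have 2: "r * (\<bar>q\<bar> * \<bar>s\<bar>) \<le> p / 2 * \<bar>s\<bar>" .
    have 3: "p * \<bar>s\<bar> \<le> \<bar>\<kappa> * s\<bar>"
        using that by (simp add: abs_mult mult_right_mono)
    have 4: "c * \<bar>s\<bar> \<le> p / 2 * \<bar>s\<bar>" "c * \<bar>t\<bar> \<le>
        r * \<bar>z\<bar> * \<bar>t\<bar>"
      by (intro mult_right_mono; simp add: c_def)+
    have "p * \<bar>s\<bar> = p / 2 * \<bar>s\<bar> + p / 2 * \<bar>s\<bar>" by simp
    then show ?thesis using 1 2 3 4 unfolding distrib_left by linarith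
  qed
  moreover have "0 < c" using assms r by (simp add: c_def)
  ultimately show ?thesis by blast
qed

context triangular_affine
begin

lemma norm_coords: "norm (s *\<^sub>R e + t *\<^sub>R f) \<le> \<bar>s\<bar> + \<bar>t\<bar>"
  using norm_triangle_ineq[of "s *\<^sub>R e" "t *\<^sub>R f"] norms by simp

lemma coords_le: "\<bar>e \<bullet> x\<bar> \<le> norm x" "\<bar>f \<bullet> x\<bar> \<le> norm x"
  using Cauchy_Schwarz_ineq2[of e x] Cauchy_Schwarz_ineq2[of f x] norms by simp_all

text \<open>Three copies of \<open>E\<close> move together.  Swapping the last letters of the first two
  moves their sum exactly along \<open>e\<close>, because the linear parts differ by a
  multiple of \<open>x \<mapsto> (f \<bullet> x) e\<close>; the third copy takes care of the
  direction \<open>f\<close>, which shrinks faster.\<close>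

lemma thick_if_shear_pair:
  assumes g1: "g1 \<in> words (Suc N)" and g2: "g2 \<in> words (Suc N)"
    and diag: "ca g1 = ca g2" "cd g1 = cd g2" and cb: "cb g1 \<noteq> cb g2" and cy: "cy g1 \<noteq> cy g2"
    and quarter: "\<bar>cd g1\<bar> \<le> \<bar>ca g1\<bar> / 4"
  shows "arithmetically_thick E"
proof -
  have sg: "g1 \<in> semigroup" "g2 \<in> semigroup" using g1 g2 words_semigroup by blast+
  define \<alpha> where "\<alpha> = ca g1"
  define \<delta> where "\<delta> = cd g1"
  have nz: "\<alpha> \<noteq> 0" "\<delta> \<noteq> 0"
      using ca_nonzero cd_nonzero sg by (simp_all add: \<alpha>_def \<delta>_def)
  have \<alpha>1: "\<bar>\<alpha>\<bar> < 1" using abs_ca_less_1[OF g1] by (simp add: \<alpha>_def)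
  have \<delta>\<alpha>: "\<bar>\<delta>\<bar> \<le> \<bar>\<alpha>\<bar> / 4"
      using quarter by (simp add: \<alpha>_def \<delta>_def)
  define q where "q = \<delta> / \<alpha>"
  have q: "\<bar>q\<bar> \<le> 1 / 4" using \<delta>\<alpha> nz by (simp add: q_def field_simps)
  define \<eta> where "\<eta> = (cb g1 - cb g2) / \<alpha>"
  have \<eta>: "\<eta> \<noteq> 0" using cb nz by (simp add: \<eta>_def)
  define B where "B = max \<bar>cb g1 / \<alpha>\<bar> \<bar>cb g2 / \<alpha>\<bar>"
  have B0: "0 \<le> B" unfolding B_def by (intro max.coboundedI1 abs_ge_zero)
  have hB: "\<bar>cb h / \<alpha>\<bar> \<le> B" if "h \<in> {g1, g2}" for h
    using that unfolding B_def by (auto simp del: abs_divide)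
  have hdiag: "ca h = \<alpha>" "cd h = \<delta>" "h \<in> semigroup" if "h \<in> {g1, g2}" for h
    using that diag sg by (auto simp: \<alpha>_def \<delta>_def)
  have norm_g: "norm (fst h *v x) \<le> ratio * norm x" if "h \<in> {g1, g2}" for h x
  proof -
    have "norm (fst h *v x) \<le> ratio ^ Suc N * norm x" using norm_words g1 g2 that by blast
    also have "\<dots> \<le> ratio ^ 1 * norm x"
        by (intro mult_right_mono power_decreasing) (use ratio in auto)
    finally show ?thesis by simp
  qed
  \<comment> \<open>The average of the two maps is a contraction; at its fixed point
    \<open>b\<close> the two images lie symmetrically, so exchanging the words exactly reverses the
    displacement.\<close>
  define mid where "mid x = (1/2) *\<^sub>R act g1 x + (1/2) *\<^sub>R act g2 x" for x
  have "\<exists>!x. mid x = x"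
  proof (rule banach_fix_type[of ratio])
    show "0 \<le> ratio" "ratio < 1" by (rule ratio)+
    have "dist (mid x) (mid y) \<le> ratio * dist x y" for x y
    proof -
      have "mid x - mid y = (1/2) *\<^sub>R (fst g1 *v (x - y)) + (1/2) *\<^sub>R (fst g2 *v (x - y))"
        by (simp add: mid_def act_diff[symmetric] scaleR_diff_right)
      also have "norm \<dots> \<le> (1/2) * norm (fst g1 *v (x - y)) + (1/2) * norm (fst g2 *v (x - y))"
        using norm_triangle_ineq[of "(1/2) *\<^sub>R (fst g1 *v (x - y))"
            "(1/2) *\<^sub>R (fst g2 *v (x - y))"] by simp
      finally show ?thesis using norm_g[of g1 "x - y"] norm_g[of g2 "x - y"] by (simp add: dist_norm)
    qed
    then show "\<forall>x y. dist (mid x) (mid y) \<le> ratio * dist x y" by blast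
  qed
  then obtain b where b: "mid b = b" by blast
  define \<zeta> where "\<zeta> = act g1 b - b"
  have act1: "act g1 b = b + \<zeta>" by (simp add: \<zeta>_def)
  have act2: "act g2 b = b - \<zeta>"
  proof -
    have "act g1 b + act g2 b = 2 *\<^sub>R mid b" by (simp add: mid_def scaleR_add_right)
    then show ?thesis using b act1 by (simp add: scaleR_2 algebra_simps)
  qed
  define z1 where "z1 = e \<bullet> \<zeta>"
  define z2 where "z2 = f \<bullet> \<zeta>"
  have z2: "z2 \<noteq> 0"
  proof -
    have "act g1 b - act g2 b = 2 *\<^sub>R \<zeta>" by (simp add: act1 act2 scaleR_2)
    then have "f \<bullet> (act g1 b - act g2 b) = f \<bullet> (2 *\<^sub>R \<zeta>)" by (rule arg_cong)
    then have "2 * z2 = f \<bullet> act g1 b - f \<bullet> act g2 b" by (simp add: z2_def inner_diff_right)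
    also have "\<dots> = cy g1 - cy g2" using diag by (simp add: f_act sg)
    finally show ?thesis using cy by auto
  qed
  \<comment> \<open>The shear relative to the larger diagonal entry. Level \<open>k\<close> has
    \<open>Suc k\<close> factors, so that level 0 already distinguishes two copies by the shears of
    \<open>g1\<close> and \<open>g2\<close>.\<close>
  define \<tau> where "\<tau> k u = cb u / \<alpha> ^ Suc k" for k u
  define valid where "valid k u \<longleftrightarrow> u \<in> semigroup \<and>
      ca u = \<alpha> ^ Suc k \<and> cd u = \<delta> ^ Suc k \<and>
      \<bar>\<tau> k u\<bar> \<le> 2 * B" for k u
  have vsg: "u \<in> semigroup" if "valid k u" for k u using that by (simp add: valid_def)
  have \<tau>_ext: "\<tau> (Suc k) (u \<odot> h) =
      cb h / \<alpha> + q * \<tau> k u" if "valid k u" "h \<in> {g1, g2}" for k u h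
    using that(1) hdiag[OF that(2)] nz
    by (simp add: \<tau>_def valid_def cb_mult q_def field_simps)
  have valid_ext: "valid (Suc k) (u \<odot> h)" if v: "valid k u" and h: "h \<in> {g1, g2}" for k u h
  proof -
    \<comment> \<open>The bound \<open>2 * B\<close> reproduces itself, because the new shear is at
      most \<open>B\<close> plus a quarter of the old one.\<close>
    have "\<bar>q * \<tau> k u\<bar> \<le> 1 / 4 * (2 * B)"
      unfolding abs_mult using q v by (intro mult_mono) (auto simp: valid_def)
    then have "\<bar>\<tau> (Suc k) (u \<odot> h)\<bar> \<le> 2 * B" unfolding \<tau>_ext[OF v h]
        using hB[OF h] B0 by linarith
    moreover have "u \<odot> h \<in> semigroup" using vsg[OF v] hdiag(3)[OF h] by (rule semigroup_amult)
    ultimately show ?thesis using v hdiag[OF h]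
      by (simp add: valid_def ca_mult cd_mult mult.commute)
  qed
  define G where "G k x = (\<alpha> ^ Suc k * (e \<bullet> x)) *\<^sub>R e +
      (\<delta> ^ Suc k * (f \<bullet> x)) *\<^sub>R f" for k x
  have linG: "linear (G k)" for k
    by (rule linearI) (simp_all add: G_def inner_add_right algebra_simps)
  have img: "fst u *v y = G k ((e \<bullet> y + \<tau> k u * (f \<bullet> y)) *\<^sub>R e +
      (f \<bullet> y) *\<^sub>R f)" if "valid k u" for k u y
    using that nz by (simp add: image_coords valid_def G_def \<tau>_def inner_add_right ee ef fe ff
        algebra_simps)
  have ab_le: "\<bar>\<delta>\<bar> ^ k \<le> \<bar>\<alpha>\<bar> ^ k" for k
      using \<delta>\<alpha> by (intro power_mono) auto
  have normG: "norm (G k x) \<le> 2 * \<bar>\<alpha>\<bar> ^ Suc k * norm x" for k x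
  proof -
    have "norm (G k x) \<le> \<bar>\<alpha>\<bar> ^ Suc k * \<bar>e \<bullet> x\<bar> +
        \<bar>\<delta>\<bar> ^ Suc k * \<bar>f \<bullet> x\<bar>"
      unfolding G_def using norm_coords[of "\<alpha> ^ Suc k * (e \<bullet> x)"
          "\<delta> ^ Suc k * (f \<bullet> x)"]
      by (simp add: abs_mult power_abs)
    also have "\<dots> \<le> \<bar>\<alpha>\<bar> ^ Suc k * norm x + \<bar>\<alpha>\<bar> ^ Suc k * norm x"
      using coords_le[of x] ab_le[of "Suc k"] by (intro add_mono mult_mono) auto
    finally show ?thesis by (simp add: mult_ac)
  qed
  define D where "D x = (\<alpha> * (e \<bullet> x)) *\<^sub>R e +
      (\<delta> * (f \<bullet> x)) *\<^sub>R f" for x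
  define D' where "D' x = ((1 / \<alpha>) * (e \<bullet> x)) *\<^sub>R e +
      ((1 / \<delta>) * (f \<bullet> x)) *\<^sub>R f" for x
  define P0 where "P0 = \<bar>z1\<bar> + 2 * B * \<bar>z2\<bar>"
  obtain c where c: "0 < c" "\<And>\<kappa> r s t. \<bar>\<eta> * z2\<bar> / 2 \<le>
      \<bar>\<kappa>\<bar> \<Longrightarrow> \<bar>r\<bar> \<le> P0 \<Longrightarrow>
      c * (\<bar>s\<bar> + \<bar>t\<bar>) \<le> \<bar>\<kappa> * s\<bar> + \<bar>r * s + z2 * t\<bar>"
    using sum_abs_shear_ge[of "\<bar>\<eta> * z2\<bar> / 2" z2 P0] \<eta> z2 B0 by (auto simp: P0_def)
  obtain p where p: "p \<in> E" using E_nonempty by blast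
  \<comment> \<open>The first three summands bound a move, the last one the distance of a
    configuration from a sum of points of \<open>E\<close>.\<close>
  define h where "h = 2 * \<bar>\<eta> * z2\<bar> + P0 + \<bar>z2\<bar> + 3 * ((2 + 2 * B) * norm (p - b))"
  have h0: "0 \<le> P0" "0 \<le> (2 + 2 * B) * norm (p - b)" using B0 by (auto simp: P0_def)
  define P where "P k x \<longleftrightarrow> (\<exists>u1 u2 u3. valid k u1 \<and> valid k u2 \<and>
      valid k u3 \<and>
    \<bar>\<eta>\<bar> / 2 \<le> \<bar>\<tau> k u1 - \<tau> k u2\<bar> \<and>
        \<bar>\<tau> k u1 - \<tau> k u2\<bar> \<le> 2 * \<bar>\<eta>\<bar> \<and>
    x = act u1 b + act u2 b + act u3 b)" for k x
  have "\<exists>N\<ge>1. interior (sum_power N (sum_power 3 E)) \<noteq> {}"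
  proof (rule interior_sum_power_steered[where G = G and D = D and D' = D'
        and \<eta> = "\<lambda>k. 2 * \<bar>\<alpha>\<bar> ^ Suc k" and P = P and h = h and c = c])
    show "linear (G k)" for k by (rule linG)
    show "G (Suc k) x = G k (D x)" for k x
      by (simp add: G_def D_def inner_add_right ee ef fe ff mult_ac)
    show "inj (G 0)"
    proof (rule injI)
      fix x y assume eq: "G 0 x = G 0 y"
      have "e \<bullet> G 0 x = e \<bullet> G 0 y" "f \<bullet> G 0 x = f \<bullet> G 0 y"
          using eq by simp_all
      then have "e \<bullet> x = e \<bullet> y" "f \<bullet> x = f \<bullet> y"
        using nz by (simp_all add: G_def inner_add_right ee ef fe ff)
      then show "x = y" using decomp[of x] decomp[of y] by simp
    qed
    show "linear D'" by (rule linearI) (simp_all add: D'_def inner_add_right add_divide_distrib algebra_simps)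
    show "D (D' x) = x" for x
      using nz decomp[of x] by (simp add: D_def D'_def inner_add_right ee ef fe ff)
    show "norm (G k x) \<le> 2 * \<bar>\<alpha>\<bar> ^ Suc k * norm x" for k x by (rule normG)
    have "(\<lambda>k. 2 * \<bar>\<alpha>\<bar> ^ Suc k) \<longlonglongrightarrow> 2 * 0"
      using \<alpha>1 by (intro tendsto_mult tendsto_const LIMSEQ_Suc LIMSEQ_power_zero) simp
    then show "(\<lambda>k. 2 * \<bar>\<alpha>\<bar> ^ Suc k) \<longlonglongrightarrow> 0" by simp
    show "0 < c" by (rule c)
    show "compact (sum_power 3 E)" by (rule compact_sum_power[OF compact_E])
    have v0: "valid 0 h" if "h \<in> {g1, g2}" for h
      using that hdiag[OF that] hB[OF that] B0 by (simp add: valid_def \<tau>_def)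
    have "\<tau> 0 g1 - \<tau> 0 g2 = \<eta>" by (simp add: \<tau>_def \<eta>_def diff_divide_distrib)
    then show "P 0 (act g1 b + act g2 b + act g1 b)"
      unfolding P_def using v0[of g1] v0[of g2]
      by (intro exI[of _ g1] exI[of _ g2] exI[of _ g1]) simp
    show "\<exists>y\<in>sum_power 3 E. norm (y - x) \<le>
        2 * \<bar>\<alpha>\<bar> ^ Suc k * h" if "P k x" for k x
    proof -
      obtain u1 u2 u3 where u: "valid k u1" "valid k u2" "valid k u3" "x = act u1 b + act u2 b + act u3 b"
        using \<open>P k x\<close> P_def by blast
      have mem: "act u1 p + act u2 p + act u3 p \<in> sum_power 3 E"
      proof -
        have "act u p \<in> sum_power 1 E" if "valid k u" for u
          unfolding sum_power_1 using act_E[OF vsg[OF that] p] .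
        then have "act u1 p + act u2 p + act u3 p \<in> sum_power (1 + 1 + 1) E"
          using u by (intro sum_power_add) auto
        then show ?thesis by (simp add: numeral_3_eq_3)
      qed
      have "norm (act u p - act u b) \<le>
          2 * \<bar>\<alpha>\<bar> ^ Suc k * ((2 + 2 * B) * norm (p - b))" if v: "valid k u" for u
      proof -
        let ?y = "p - b"
        have "\<bar>e \<bullet> ?y + \<tau> k u * (f \<bullet> ?y)\<bar> \<le> norm ?y + 2 * B * norm ?y"
        proof -
          have "\<bar>\<tau> k u * (f \<bullet> ?y)\<bar> \<le> 2 * B * norm ?y"
            unfolding abs_mult using v coords_le[of ?y] by (intro mult_mono) (auto simp: valid_def)
          then show ?thesis using coords_le(1)[of ?y] by linarith
        qed
        then have "norm ((e \<bullet> ?y + \<tau> k u * (f \<bullet> ?y)) *\<^sub>R e +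
            (f \<bullet> ?y) *\<^sub>R f) \<le> (2 + 2 * B) * norm ?y"
          using norm_coords[of "e \<bullet> ?y +
              \<tau> k u * (f \<bullet> ?y)" "f \<bullet> ?y"] coords_le(2)[of ?y]
          by (simp add: algebra_simps)
        then have "2 * \<bar>\<alpha>\<bar> ^ Suc k * norm ((e \<bullet> ?y +
            \<tau> k u * (f \<bullet> ?y)) *\<^sub>R e + (f \<bullet> ?y) *\<^sub>R f) \<le>
            2 * \<bar>\<alpha>\<bar> ^ Suc k * ((2 + 2 * B) * norm ?y)"
          by (rule mult_left_mono) simp
        then show ?thesis unfolding act_diff img[OF v] using normG order_trans by blast
      qed
      note near = this[OF u(1)] this[OF u(2)] this[OF u(3)]
      have "norm (act u1 p + act u2 p + act u3 p - x) \<le>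
          norm (act u1 p - act u1 b) + norm (act u2 p - act u2 b) + norm (act u3 p - act u3 b)"
      proof -
        have eq: "act u1 p + act u2 p + act u3 p - x =
            (act u1 p - act u1 b) + (act u2 p - act u2 b) + (act u3 p - act u3 b)"
          by (simp add: u(4))
        show ?thesis unfolding eq
          using norm_triangle_ineq[of "act u1 p - act u1 b" "act u2 p - act u2 b"]
            norm_triangle_ineq[of "act u1 p - act u1 b + (act u2 p - act u2 b)" "act u3 p - act u3 b"]
          by linarith
      qed
      also have "\<dots> \<le> 2 * \<bar>\<alpha>\<bar> ^ Suc k * (3 * ((2 +
          2 * B) * norm (p - b)))" using near by linarith
      also have "\<dots> \<le> 2 * \<bar>\<alpha>\<bar> ^ Suc k * h"
          using h0 by (intro mult_left_mono) (auto simp: h_def)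
      finally show ?thesis using mem by blast
    qed
    show "\<exists>m. P (Suc k) (x + G k m) \<and> norm m \<le> h \<and>
        c * norm \<epsilon> \<le> m \<bullet> \<epsilon>" if "P k x" for k x \<epsilon>
    proof -
      obtain u1 u2 u3 where u: "valid k u1" "valid k u2" "valid k u3" 
        "\<bar>\<eta>\<bar> / 2 \<le> \<bar>\<tau> k u1 - \<tau> k u2\<bar>"
            "\<bar>\<tau> k u1 - \<tau> k u2\<bar> \<le>
            2 * \<bar>\<eta>\<bar>" "x = act u1 b + act u2 b + act u3 b"
        using \<open>P k x\<close> P_def by blast
      define \<kappa> where "\<kappa> = (\<tau> k u1 - \<tau> k u2) * z2"
      define r where "r = z1 + \<tau> k u3 * z2"
      define s where "s = e \<bullet> \<epsilon>"
      define t where "t = f \<bullet> \<epsilon>"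
      define \<sigma> where "\<sigma> = (if 0 \<le> \<kappa> * s then 1 else -1 :: real)"
      define \<rho> where "\<rho> = (if 0 \<le> r * s + z2 * t then 1 else -1 :: real)"
      define pick where "pick x = (if x = (1::real) then g1 else g2)" for x
      have pick: "pick x \<in> {g1, g2}" for x by (simp add: pick_def)
      have act_pick: "act (pick x) b = b + x *\<^sub>R \<zeta>" if "x = 1 \<or> x = -1" for x
        using that by (auto simp: pick_def act1 act2)
      have move: "act (v \<odot> pick x) b =
          act v b + G k (x *\<^sub>R ((z1 + \<tau> k v * z2) *\<^sub>R e + z2 *\<^sub>R f))"
        if v: "valid k v" and x: "x = 1 \<or> x = -1" for v x
      proof -
        have "act v (b + x *\<^sub>R \<zeta>) - act v b = x *\<^sub>R (fst v *v \<zeta>)"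
          by (simp add: act_diff matrix_vector_mult_scaleR)
        also have "\<dots> = G k (x *\<^sub>R ((z1 + \<tau> k v * z2) *\<^sub>R e + z2 *\<^sub>R f))"
          unfolding img[OF v] linear_scale[OF linG] by (simp add: z1_def z2_def)
        finally show ?thesis by (simp add: act_pick[OF x] diff_eq_eq add.commute)
      qed
      have \<sigma>: "\<sigma> = 1 \<or> \<sigma> = -1" "- \<sigma> = 1 \<or> - \<sigma> =
          -1" and \<rho>: "\<rho> = 1 \<or> \<rho> = -1"
        by (simp_all add: \<sigma>_def \<rho>_def)
      define m where "m = (\<sigma> * \<kappa> + \<rho> * r) *\<^sub>R e + (\<rho> * z2) *\<^sub>R f"
      have m_eq: "m = \<sigma> *\<^sub>R ((z1 + \<tau> k u1 * z2) *\<^sub>R e + z2 *\<^sub>R f) +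
          (- \<sigma>) *\<^sub>R ((z1 + \<tau> k u2 * z2) *\<^sub>R e + z2 *\<^sub>R f)
          + \<rho> *\<^sub>R ((z1 + \<tau> k u3 * z2) *\<^sub>R e + z2 *\<^sub>R f)"
        by (simp add: m_def \<kappa>_def r_def algebra_simps)
      have x': "act (u1 \<odot> pick \<sigma>) b + act (u2 \<odot> pick (- \<sigma>)) b +
          act (u3 \<odot> pick \<rho>) b = x + G k m"
        unfolding move[OF u(1) \<sigma>(1)] move[OF u(2) \<sigma>(2)] move[OF u(3) \<rho>] m_eq u(6)
        by (simp only: linear_add[OF linG] add_ac)
      have "P (Suc k) (x + G k m)"
      proof -
        have \<tau>': "\<tau> (Suc k) (u1 \<odot> pick \<sigma>)
            - \<tau> (Suc k) (u2 \<odot> pick (- \<sigma>)) =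
            \<sigma> * \<eta> + q * (\<tau> k u1 - \<tau> k u2)"
          unfolding \<tau>_ext[OF u(1) pick] \<tau>_ext[OF u(2) pick] using \<sigma>(1)
          by (auto simp: pick_def \<eta>_def diff_divide_distrib right_diff_distrib)
        \<comment> \<open>The old difference contributes at most half of
          \<open>\<bar>\<eta>\<bar>\<close>, so whichever words are chosen, the new one lies again
          between half and twice \<open>\<bar>\<eta>\<bar>\<close>; here the ratio 1/4 is
          decisive.\<close>
        have "\<bar>q * (\<tau> k u1 - \<tau> k u2)\<bar> \<le> 1 / 4 * (2 * \<bar>\<eta>\<bar>)"
          unfolding abs_mult using q u(5) by (intro mult_mono) auto
        moreover have "\<bar>\<sigma> * \<eta>\<bar> = \<bar>\<eta>\<bar>" using \<sigma>(1) by auto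
        ultimately have "\<bar>\<eta>\<bar> / 2 \<le>
            \<bar>\<sigma> * \<eta> + q * (\<tau> k u1 - \<tau> k u2)\<bar>"
          "\<bar>\<sigma> * \<eta> + q * (\<tau> k u1 - \<tau> k u2)\<bar> \<le>
              2 * \<bar>\<eta>\<bar>" by linarith+
        then show ?thesis unfolding P_def x'[symmetric]
          using valid_ext[OF u(1) pick] valid_ext[OF u(2) pick] valid_ext[OF u(3) pick] \<tau>' by metis
      qed
      moreover have r_le: "\<bar>r\<bar> \<le> P0"
      proof -
        have "\<bar>\<tau> k u3 * z2\<bar> \<le> 2 * B * \<bar>z2\<bar>"
          unfolding abs_mult using u(3) by (intro mult_right_mono) (auto simp: valid_def)
        then show ?thesis unfolding r_def P0_def by linarith
      qed
      moreover have "norm m \<le> h"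
      proof -
        have "\<bar>\<kappa>\<bar> \<le> 2 * \<bar>\<eta> * z2\<bar>"
          using mult_right_mono[OF u(5), of "\<bar>z2\<bar>"] by (simp add: \<kappa>_def abs_mult)
        moreover have "\<bar>\<sigma> * \<kappa>\<bar> =
            \<bar>\<kappa>\<bar>" "\<bar>\<rho> * r\<bar> = \<bar>r\<bar>" "\<bar>\<rho> * z2\<bar> =
            \<bar>z2\<bar>" using \<sigma>(1) \<rho> by auto
        ultimately show ?thesis
          using norm_coords[of "\<sigma> * \<kappa> +
              \<rho> * r" "\<rho> * z2"] r_le h0(2) unfolding m_def h_def by linarith
      qed
      moreover have "c * norm \<epsilon> \<le> m \<bullet> \<epsilon>"
      proof -
        have "\<bar>\<eta> * z2\<bar> / 2 \<le> \<bar>\<kappa>\<bar>"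
          using mult_right_mono[OF u(4), of "\<bar>z2\<bar>"] by (simp add: \<kappa>_def abs_mult)
        then have "c * (\<bar>s\<bar> + \<bar>t\<bar>) \<le>
            \<bar>\<kappa> * s\<bar> + \<bar>r * s + z2 * t\<bar>" using c(2) r_le by blast
        also have "\<dots> = \<sigma> * (\<kappa> * s) + \<rho> * (r * s + z2 * t)"
            by (simp add: \<sigma>_def \<rho>_def)
        also have "\<dots> = m \<bullet> \<epsilon>"
            by (simp add: m_def inner_add_left s_def t_def algebra_simps)
        finally have "c * (\<bar>s\<bar> + \<bar>t\<bar>) \<le> m \<bullet> \<epsilon>" .
        moreover have "norm \<epsilon> \<le> \<bar>s\<bar> + \<bar>t\<bar>"
          using norm_coords[of s t] decomp[of \<epsilon>] by (simp add: s_def t_def)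
        then have "c * norm \<epsilon> \<le> c * (\<bar>s\<bar> + \<bar>t\<bar>)"
            using c(1) by (intro mult_left_mono) auto
        ultimately show ?thesis by linarith
      qed
      ultimately show ?thesis by blast
    qed
  qed
  then show ?thesis by (rule interior_sum_power_thick[OF compact_E, of 3, rotated]) simp
qed

text \<open>Once letters fail to commute, the comparison of \<open>ca\<close> with \<open>cd\<close>
  decides: either the transverse direction dominates in some word, or the invariant line does in
  some word and never loses, or the moduli agree for all letters.\<close>

theorem thick_if_triangular: "arithmetically_thick E"
proof (cases "\<forall>k\<in>{1..l}. \<forall>m\<in>{1..l}. T k ** T m = T m ** T k")
  case True
  then show ?thesis using thick_if_all_commute by blast
next
  case False
  then obtain k m where nc: "k \<in> {1..l}" "m \<in> {1..l}" "T k ** T m \<noteq> T m ** T k" by blast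
  show ?thesis
  proof (cases "\<exists>n w. w \<in> words (Suc n) \<and> \<bar>ca w\<bar> < \<bar>cd w\<bar>")
    case True
    then show ?thesis using thick_if_lower_dominates nc by blast
  next
    case le: False
    have le': "\<bar>cd g\<bar> \<le> \<bar>ca g\<bar>" if g: "g \<in> semigroup" for g
    proof -
      obtain n where n: "g \<in> words n" using semigroup_words g by blast
      show ?thesis
      proof (cases n)
        case 0
        then show ?thesis using n by (simp add: ca_def cd_def ee ff)
      next
        case (Suc n')
        then have "\<not> \<bar>ca g\<bar> < \<bar>cd g\<bar>" using le n by blast
        then show ?thesis by simp
      qed
    qed
    show ?thesis
    proof (cases "\<exists>n w. w \<in> words (Suc n) \<and> \<bar>cd w\<bar> < \<bar>ca w\<bar>")
      case True
      then show ?thesis using shear_pair[OF _ _ le' nc] thick_if_shear_pair by metis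
    next
      case eq: False
      have "\<bar>cd (T q, a q)\<bar> = \<bar>ca (T q, a q)\<bar>" if "q \<in> {1..l}" for q
      proof -
        have "\<not> \<bar>cd (T q, a q)\<bar> < \<bar>ca (T q, a q)\<bar>"
            using eq letter_words[OF that] by simp
        then show ?thesis using le'[OF letter_semigroup[OF that]] by simp
      qed
      then show ?thesis by (rule thick_if_diagonals_equal_modulus)
    qed
  qed
qed

end

section \<open>Reducible planar systems in triangular form\<close>

context planar_affine
begin

text \<open>A proper nonzero invariant subspace of the plane is a line, since an element off the
  line of \<open>e\<close> would span everything together with \<open>e\<close>. Its unit vector and
  the rotated one are the basis of the triangular form.\<close>

theorem thick_if_planar: "arithmetically_thick E"
proof (cases "irreducible_tuple l T")
  case True
  then show ?thesis by (rule thick_if_irreducible)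
next
  case False
  then obtain V where V: "subspace V" "V \<noteq> {0}" "V \<noteq> UNIV" "\<And>k.
      k \<in> {1..l} \<Longrightarrow> (*v) (T k) ` V \<subseteq> V"
    unfolding irreducible_tuple_def by blast
  obtain u where u: "u \<in> V" "u \<noteq> 0" using V(1,2) subspace_0 by blast
  define e where "e = u /\<^sub>R norm u"
  have e: "e \<in> V" "norm e = 1" using u V(1) by (simp_all add: e_def subspace_scale)
  have line: "\<exists>s. x = s *\<^sub>R e" if "x \<in> V" for x
  proof (rule ccontr)
    assume "\<nexists>s. x = s *\<^sub>R e"
    moreover have "e \<noteq> 0" using e(2) by auto
    ultimately have "cross e x \<noteq> 0" using cross_zero_parallel by blast
    have "y \<in> V" for y
    proof -
      obtain s t where "y = s *\<^sub>R e + t *\<^sub>R x"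
          using cross_basis[OF \<open>cross e x \<noteq> 0\<close>] by blast
      then show ?thesis using V(1) e(1) that by (simp add: subspace_add subspace_scale)
    qed
    then show False using V(3) by blast
  qed
  have cr: "cross e (rot e) \<noteq> 0" using e(2) by (simp add: cross_rot)
  interpret triangular_affine l T a E i j e "rot e"
  proof unfold_locales
    show ee: "e \<bullet> e = 1" using e(2) by (simp add: norm_eq_1)
    show ff: "rot e \<bullet> rot e = 1" using norm_eq_1[of "rot e"] norm_rot[of e] e(2) by simp
    show ef: "e \<bullet> rot e = 0" by (rule inner_rot)
    show "x = (e \<bullet> x) *\<^sub>R e + (rot e \<bullet> x) *\<^sub>R rot e" for x
    proof -
      obtain s t where x: "x = s *\<^sub>R e + t *\<^sub>R rot e" using cross_basis[OF cr] by blast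
      have "e \<bullet> x = s" "rot e \<bullet> x = t"
        using ee ff ef by (simp_all add: x inner_add_right inner_commute[of "rot e" e])
      then show ?thesis using x by simp
    qed
    show "\<exists>s. T k *v e = s *\<^sub>R e" if "k \<in> {1..l}" for k
      using line V(4)[OF that] e(1) by blast
  qed
  show ?thesis by (rule thick_if_triangular)
qed

end

theorem theorem1p6:
  fixes l :: nat
    and T :: "nat \<Rightarrow> real^'n^'n"
    and a :: "nat \<Rightarrow> real^'n"
    and \<phi> :: "nat \<Rightarrow> real^'n \<Rightarrow> real^'n"
    and E :: "(real^'n) set"
  assumes "CARD('n) \<ge> 2"
    and "affine_ifs l T a \<phi>"
    and "is_attractor l \<phi> E"
    and "\<not> (\<exists>H. hyperplane H \<and> E \<subseteq> H)"
    and "(\<forall>i\<in>{1..l}. \<forall>j\<in>{1..l}. T i ** T j = T j ** T i)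
      \<or> (irreducible_tuple l T \<and>
          (\<exists>M\<in>mult_semigroup (T ` {1..l}). has_simple_dominant_eigenvalue M))
      \<or> CARD('n) = 2"
  shows "arithmetically_thick E"
proof -
  interpret self_affine l T a E
  proof unfold_locales
    show "invertible (T k)" "onorm ((*v) (T k)) < 1" if "k \<in> {1..l}" for k
      using assms(2) that by (simp_all add: affine_ifs_def)
    show "E \<noteq> {}" "compact E" using assms(3) by (simp_all add: is_attractor_def)
    have "E = (\<Union>k\<in>{1..l}. \<phi> k ` E)" using assms(3) unfolding is_attractor_def by blast
    also have "\<dots> = (\<Union>k\<in>{1..l}. (\<lambda>x. T k *v x + a k) ` E)"
      using assms(2) by (intro SUP_cong refl) (auto simp: affine_ifs_def affine_map_def)
    finally show "E = (\<Union>k\<in>{1..l}. (\<lambda>x. T k *v x + a k) ` E)" .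
    show "\<exists>x\<in>E. v \<bullet> x \<noteq> c" if "v \<noteq> 0" for v c
    proof (rule ccontr)
      assume "\<not> (\<exists>x\<in>E. v \<bullet> x \<noteq> c)"
      then have "hyperplane {x. v \<bullet> x = c}" "E \<subseteq> {x. v \<bullet> x = c}"
          using that by (auto simp: hyperplane_def)
      then show False using assms(4) by blast
    qed
  qed
  from assms(5) show ?thesis
  proof (elim disjE conjE bexE)
    assume "\<forall>i\<in>{1..l}. \<forall>j\<in>{1..l}. T i ** T j = T j ** T i"
    then show ?thesis using thick_if_all_commute by blast
  next
    fix M assume irr: "irreducible_tuple l T" and M: "M \<in> mult_semigroup (T ` {1..l})"
      "has_simple_dominant_eigenvalue M"
    obtain n w where w: "w \<in> words (Suc n)" "fst w = M" using mult_semigroup_words[OF M(1)] by blast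
    then obtain \<mu> v f where "proximal (fst w) \<mu> v f"
      using proximal_if_simple_dominant[of "fst w"] M(2) invertible_semigroup[OF words_semigroup] by blast
    then show ?thesis using thick_if_irreducible_proximal[OF irr w(1)] by blast
  next
    assume "CARD('n) = 2"
    then obtain i j :: 'n where "UNIV = {i, j}" "i \<noteq> j" by (auto simp: card_2_iff)
    then interpret planar_affine l T a E i j by unfold_locales auto
    show ?thesis by (rule thick_if_planar)
  qed
qed

end
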